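(* Let $N\ge3$, $R>0$, and let $B_R\subset\mathbb{R}^N$ be the open ball of radius $R$ centered at the origin. The infimum of the ratio $$\frac{\displaystyle\int_{B_R}|x|^{-(N-2)}|\nabla v(|x|)|^2\,dx}{\left(\displaystyle\int_{B_R}|x|^{-N}\left(-\log\frac{|x|}{R}\right)^{-\frac{2(N-1)}{N-2}}|v(|x|)|^{\frac{2N}{N-2}}\,dx\right)^{\frac{N-2}{N}}},$$ taken over the (nonzero) radially symmetric functions $v$ of $W_0^{1,2}(|x|^{-(N-2)},B_R)$, is $$C_{HS}:=S(N)\,(N-2)^{-2(N-1)/N},$$ and it is achieved by $$v_{\mu,\nu}(|x|)=\left(\mu^2+\nu^2\left(-\log\frac{|x|}{R}\right)^{-\frac{2}{N-2}}\right)^{-\frac{N-2}{2}},\qquad \mu\ne0,\ \nu\ne0.$$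
   Context: $W_0^{1,2}(|x|^{-(N-2)},B_R)$ is the completion of $C_0^\infty(B_R)$ under the norm $\|v\|^2=\int_{B_R}|x|^{-(N-2)}|\nabla v|^2dx$. $S(N)=\frac{N(N-2)}{4}|\mathbb{S}_N|^{2/N}$, with $|\mathbb{S}_N|=2\pi^{(N+1)/2}/\Gamma((N+1)/2)$ the area of the $N$-dimensional unit sphere, is the best constant in the Sobolev inequality $\int_{\mathbb{R}^N}|\nabla u|^2dx\ge S(N)\left(\int_{\mathbb{R}^N}|u|^{\frac{2N}{N-2}}dx\right)^{\frac{N-2}{N}}$. *)

theory Defs
  imports "HOL-Analysis.Analysis"
begin

text \<open>\<open>C_diff k f\<close>: \<open>f\<close> is of class \<open>C\<^sup>k\<close> on the whole space.\<close>

primrec C_diff :: "nat \<Rightarrow> ('a::euclidean_space \<Rightarrow> real) \<Rightarrow> bool" where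
  "C_diff 0 f \<longleftrightarrow> continuous_on UNIV f"
| "C_diff (Suc k) f \<longleftrightarrow>
     (\<forall>x. f differentiable (at x)) \<and>
     (\<forall>i\<in>Basis. C_diff k (\<lambda>x. frechet_derivative f (at x) i))"

text \<open>A function in \<open>C\<^sub>0\<^sup>\<infinity>(\<Omega>)\<close> is represented by its extension by zero to the whole space.\<close>

definition Cc_infty :: "'a::euclidean_space set \<Rightarrow> ('a \<Rightarrow> real) set" where
  "Cc_infty \<Omega> = {\<phi>. (\<forall>k. C_diff k \<phi>) \<and>
     compact (closure {x. \<phi> x \<noteq> 0}) \<and> closure {x. \<phi> x \<noteq> 0} \<subseteq> \<Omega>}"

definition grad :: "('a::euclidean_space \<Rightarrow> real) \<Rightarrow> 'a \<Rightarrow> 'a" where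
  "grad f x = (\<Sum>i\<in>Basis. frechet_derivative f (at x) i *\<^sub>R i)"

definition is_weak_gradient ::
    "'a::euclidean_space set \<Rightarrow> ('a \<Rightarrow> real) \<Rightarrow> ('a \<Rightarrow> 'a) \<Rightarrow> bool" where
  "is_weak_gradient \<Omega> v G \<longleftrightarrow>
     (\<forall>K. compact K \<and> K \<subseteq> \<Omega> \<longrightarrow>
        v absolutely_integrable_on K \<and> G absolutely_integrable_on K) \<and>
     (\<forall>\<phi>\<in>Cc_infty \<Omega>.
        (LINT x|lebesgue_on \<Omega>. v x *\<^sub>R grad \<phi> x) = - (LINT x|lebesgue_on \<Omega>. \<phi> x *\<^sub>R G x))"

text \<open>The choice is immaterial: weak gradients on open sets are unique almost everywhere.\<close>

definition weak_grad :: "'a::euclidean_space set \<Rightarrow> ('a \<Rightarrow> real) \<Rightarrow> 'a \<Rightarrow> 'a" where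
  "weak_grad \<Omega> v = (SOME G. is_weak_gradient \<Omega> v G)"

text \<open>The norm \<open>(\<integral>\<^sub>\<Omega> w |\<nabla>\<phi>|\<^sup>2 dx)\<^sup>1\<^sup>/\<^sup>2\<close> on \<open>C\<^sub>0\<^sup>\<infinity>(\<Omega>)\<close>; the integral is finite whenever
  \<open>w\<close> is locally integrable on \<open>\<Omega>\<close>.\<close>

definition W_norm :: "('a::euclidean_space \<Rightarrow> real) \<Rightarrow> 'a set \<Rightarrow> ('a \<Rightarrow> real) \<Rightarrow> real" where
  "W_norm w \<Omega> \<phi> = sqrt (LINT x|lebesgue_on \<Omega>. w x * (norm (grad \<phi> x))\<^sup>2)"

text \<open>The space \<open>W\<^sub>0\<^sup>1\<^sup>,\<^sup>2(w, \<Omega>)\<close>, the completion of \<open>C\<^sub>0\<^sup>\<infinity>(\<Omega>)\<close> under \<open>W_norm w \<Omega>\<close>, realised as a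
  space of functions on \<open>\<Omega>\<close> (modulo equality almost everywhere): the elements are the limits
  in \<open>L\<^sup>2(\<Omega>)\<close> of \<open>W_norm\<close>-Cauchy sequences in \<open>C\<^sub>0\<^sup>\<infinity>(\<Omega>)\<close>. This realisation is the completion
  if \<open>\<Omega>\<close> is open and bounded and \<open>w\<close> is locally integrable on \<open>\<Omega>\<close> and bounded below by a
  positive constant, as \<open>|x| powr -(N-2)\<close> is on a ball. Indeed, Poincare's inequality then
  makes every \<open>W_norm\<close>-Cauchy sequence converge in \<open>L\<^sup>2(\<Omega>)\<close>, and Cauchy sequences with the
  same limit are equivalent, because their gradients converge to the weak gradient of that limit.\<close>

definition W0_12 :: "('a::euclidean_space \<Rightarrow> real) \<Rightarrow> 'a set \<Rightarrow> ('a \<Rightarrow> real) set" where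
  "W0_12 w \<Omega> = {v. v \<in> borel_measurable (lebesgue_on \<Omega>) \<and>
     (\<exists>\<phi> :: nat \<Rightarrow> 'a \<Rightarrow> real.
        (\<forall>n. \<phi> n \<in> Cc_infty \<Omega>) \<and>
        (\<forall>\<epsilon>>0. \<exists>M. \<forall>m\<ge>M. \<forall>n\<ge>M. W_norm w \<Omega> (\<lambda>x. \<phi> m x - \<phi> n x) < \<epsilon>) \<and>
        (\<lambda>n. \<integral>\<^sup>+x. ennreal ((\<phi> n x - v x)\<^sup>2) \<partial>lebesgue_on \<Omega>) \<longlonglongrightarrow> 0)}"

definition radially_symmetric_on :: "'a::euclidean_space set \<Rightarrow> ('a \<Rightarrow> real) \<Rightarrow> bool" where
  "radially_symmetric_on \<Omega> v \<longleftrightarrow> (\<exists>g :: real \<Rightarrow> real. AE x in lebesgue_on \<Omega>. v x = g (norm x))"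

text \<open>In the weights and functions below the value at \<open>x = 0\<close> is an artefact of \<open>0 powr a = 0\<close>
  and \<open>ln 0 = 0\<close>; it concerns a null set only.\<close>

definition W0_ball :: "real \<Rightarrow> ('a::euclidean_space \<Rightarrow> real) set" where
  "W0_ball R = W0_12 (\<lambda>x. norm x powr - (real DIM('a) - 2)) (ball 0 R)"

definition W0_rad :: "real \<Rightarrow> ('a::euclidean_space \<Rightarrow> real) set" where
  "W0_rad R = {v \<in> W0_ball R. radially_symmetric_on (ball 0 R) v \<and>
     \<not> (AE x in lebesgue_on (ball 0 R). v x = 0)}"

definition HS_numerator :: "real \<Rightarrow> ('a::euclidean_space \<Rightarrow> real) \<Rightarrow> real" where
  "HS_numerator R v = (let N = real DIM('a) in
     LINT x|lebesgue_on (ball 0 R). norm x powr - (N - 2) * (norm (weak_grad (ball 0 R) v x))\<^sup>2)"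

definition HS_denominator :: "real \<Rightarrow> ('a::euclidean_space \<Rightarrow> real) \<Rightarrow> real" where
  "HS_denominator R v = (let N = real DIM('a) in
     (LINT x|lebesgue_on (ball 0 R).
        norm x powr - N * (- ln (norm x / R)) powr - (2 * (N - 1) / (N - 2))
        * \<bar>v x\<bar> powr (2 * N / (N - 2))) powr ((N - 2) / N))"

definition HS_ratio :: "real \<Rightarrow> ('a::euclidean_space \<Rightarrow> real) \<Rightarrow> real" where
  "HS_ratio R v = HS_numerator R v / HS_denominator R v"

text \<open>Area of the unit sphere of dimension \<open>N\<close>, i.e. of the unit sphere in dimension \<open>N + 1\<close>.\<close>

definition sphere_area :: "nat \<Rightarrow> real" where
  "sphere_area N = 2 * pi powr ((real N + 1) / 2) / Gamma ((real N + 1) / 2)"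

definition Sobolev_const :: "nat \<Rightarrow> real" where
  "Sobolev_const N = real N * (real N - 2) / 4 * sphere_area N powr (2 / real N)"

definition C_HS :: "nat \<Rightarrow> real" where
  "C_HS N = Sobolev_const N * (real N - 2) powr - (2 * (real N - 1) / real N)"

definition v_ext :: "real \<Rightarrow> real \<Rightarrow> real \<Rightarrow> 'a::euclidean_space \<Rightarrow> real" where
  "v_ext R \<mu> \<nu> x = (let N = real DIM('a) in
     (\<mu>\<^sup>2 + \<nu>\<^sup>2 * (- ln (norm x / R)) powr - (2 / (N - 2))) powr - ((N - 2) / 2))"

end

theory Submission
  imports Defs
begin

text \<open>With \<open>t = - ln (\<bar>x\<bar> / R)\<close> and \<open>v(x) = f(t)\<close>, the quotient for radial \<open>v\<close> becomes a power of the sphere area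
  times the quotient of \<open>\<integral> f'\<^sup>2 dt\<close> and \<open>(\<integral> \<bar>f\<bar>\<^sup>p t powr -(1 + p/2) dt) powr (2/p)\<close> over \<open>t > 0\<close>, where \<open>p = 2N/(N-2)\<close>
  and \<open>f(0) = 0\<close>; its infimum is Bliss' constant.

  Bliss' inequality: put \<open>q = p/2 - 1\<close> and scale \<open>f\<close> so that \<open>k(t) = f(t) / \<surd>t\<close> has maximum modulus 1. Then
  \<open>f'\<^sup>2 = t k'\<^sup>2 + k k' + k\<^sup>2/(4t)\<close>, and AM-GM applied to \<open>t k'\<^sup>2\<close> and \<open>k\<^sup>2 (1 - \<bar>k\<bar>\<^sup>2\<^sup>q)/(4t)\<close> bounds \<open>f'\<^sup>2\<close> from
  below by \<open>\<bar>k\<bar>\<^sup>p/(4t)\<close> plus an exact derivative, taken with opposite signs before and after the maximum.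
  Undoing the scaling leaves a function of the maximum alone, which Young's inequality minimises.

  An element of the completion is only a limit of test functions, which need not be radial. The inequality is
  therefore applied to the test functions along almost every ray. Their limits along these rays are all the same
  function, because \<open>v\<close> is radial, so Fatou's lemma, first on the rays and then over the directions, gives the
  bound. The extremals are approximated by composing them with smooth truncations of the real line.\<close>

section \<open>Smooth functions\<close>

text \<open>Equality in the AM-GM step means that \<open>2 t k'\<close> equals
  \<open>|k| sqrt (1 - |k| powr (2 q))\<close> up to sign. The normalised profiles of
  \<open>v_ext\<close> satisfy this equation, which is why a pointwise estimate can be sharp. The
  exact derivative contributes \<open>bliss_half\<close> twice, for the rise of \<open>k\<close> to
  its maximum and for its fall. Undoing the scaling gives one term with \<open>M powr (-2 q)\<close>
  and one with the square of \<open>M\<close>; the Young weights are those for which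
  \<open>M\<close> cancels. That the two constants agree is Legendre's duplication formula, which
  also turns the area of the sphere bounding the N-dimensional ball into that of the N-dimensional
  sphere in \<open>S(N)\<close>. The obstacle is how little is known of \<open>v\<close>: no
  pointwise derivative, a profile fixed only almost everywhere, a weak gradient given by
  \<open>SOME\<close>. Test functions on rays are smooth, so no theory of Sobolev functions in one
  variable is needed. Integrals stay in \<open>ennreal\<close> until they are known to be finite,
  because both the Bochner integral and \<open>enn2real\<close> turn infinity into 0.\<close>

primrec Ck_on :: "nat \<Rightarrow> 'a::euclidean_space set \<Rightarrow> ('a \<Rightarrow> real) \<Rightarrow> bool" where
  "Ck_on 0 S f \<longleftrightarrow> continuous_on S f"
| "Ck_on (Suc k) S f \<longleftrightarrow> (\<forall>x\<in>S. f differentiable (at x)) \<and>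
     (\<forall>i\<in>Basis. Ck_on k S (\<lambda>x. frechet_derivative f (at x) i))"

text \<open>The relative notion is needed because \<open>ln\<close> and \<open>powr\<close> are
  smooth on a half line only, and the approximations of the extremals are smooth for different
  reasons on different open pieces. Derivatives remain full derivatives, \<open>at x\<close> and not
  \<open>at x within S\<close>.\<close>

lemma C_diff_iff_Ck_on: "C_diff k f \<longleftrightarrow> Ck_on k UNIV f"
  by (induction k arbitrary: f) simp_all

lemma Ck_on_subset: "Ck_on k T f \<Longrightarrow> S \<subseteq> T \<Longrightarrow> Ck_on k S f"
proof (induction k arbitrary: f)
  case 0
  then show ?case using continuous_on_subset by auto
next
  case (Suc k)
  then show ?case by (simp add: subset_iff)
qed

text \<open>Openness of \<open>S\<close> spreads the agreement to a neighbourhood of each point, so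
  the derivatives agree too and the induction continues with them.\<close>

lemma Ck_on_cong:
  assumes "open S" "\<And>x. x \<in> S \<Longrightarrow> f x = g x" "Ck_on k S f"
  shows "Ck_on k S g"
  using assms(2,3)
proof (induction k arbitrary: f g)
  case 0
  then show ?case using continuous_on_cong by (metis Ck_on.simps(1))
next
  case (Suc k)
  have D: "(g has_derivative frechet_derivative f (at x)) (at x)" if "x \<in> S" for x
  proof -
    have "(f has_derivative frechet_derivative f (at x)) (at x)"
      using Suc.prems(2) that frechet_derivative_works by auto
    then show ?thesis
      by (rule has_derivative_transform_within_open[OF _ assms(1) that]) (use Suc.prems in auto)
  qed
  have "Ck_on k S (\<lambda>x. frechet_derivative g (at x) i)" if "i \<in> Basis" for i
    by (rule Suc.IH[of "\<lambda>x. frechet_derivative f (at x) i"])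
       (use Suc.prems that frechet_derivative_at[OF D] in auto)
  then show ?case using D by (auto simp: differentiable_def)
qed

text \<open>Glues smoothness over an open cover: a derivative at a point sees only a neighbourhood
  of that point.\<close>

lemma Ck_on_local:
  assumes "\<And>x. x \<in> S \<Longrightarrow> \<exists>T. open T \<and> x \<in> T \<and> Ck_on k T f"
  shows "Ck_on k S f"
  using assms
proof (induction k arbitrary: f)
  case 0
  have "isCont f x" if "x \<in> S" for x
    using 0[OF that] by (auto simp: continuous_on_eq_continuous_at)
  then show ?case by (auto intro: continuous_at_imp_continuous_on)
next
  case (Suc k)
  have "f differentiable at x" if "x \<in> S" for x
    using Suc.prems[OF that] by auto
  moreover have "Ck_on k S (\<lambda>x. frechet_derivative f (at x) i)" if "i \<in> Basis" for i
  proof (rule Suc.IH)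
    fix x assume "x \<in> S"
    from Suc.prems[OF this] that
    show "\<exists>T. open T \<and> x \<in> T \<and> Ck_on k T (\<lambda>x. frechet_derivative f (at x) i)" by auto
  qed
  ultimately show ?case by simp
qed

lemma Ck_on_SucI:
  assumes "open S" "\<And>x. x \<in> S \<Longrightarrow> (f has_derivative D x) (at x)"
    and "\<And>i. i \<in> Basis \<Longrightarrow> Ck_on k S (\<lambda>x. D x i)"
  shows "Ck_on (Suc k) S f"
proof -
  have "Ck_on k S (\<lambda>x. frechet_derivative f (at x) i)" if "i \<in> Basis" for i
    by (rule Ck_on_cong[OF assms(1) _ assms(3)[OF that]])
       (use frechet_derivative_at[OF assms(2)] in auto)
  then show ?thesis using assms(2) by (auto simp: differentiable_def)
qed

lemma Ck_on_SucI_real: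
  fixes f :: "real \<Rightarrow> real"
  assumes "open S" "\<And>x. x \<in> S \<Longrightarrow> (f has_real_derivative f' x) (at x)" "Ck_on k S f'"
  shows "Ck_on (Suc k) S f"
  by (rule Ck_on_SucI[where D = "\<lambda>x h. f' x * h"])
     (use assms in \<open>auto simp: has_field_derivative_def\<close>)

lemma Ck_on_SucD: "Ck_on (Suc k) S f \<Longrightarrow> Ck_on k S f"
proof (induction k arbitrary: f)
  case 0
  then show ?case
    by (auto intro!: continuous_at_imp_continuous_on differentiable_imp_continuous_within)
next
  case (Suc k)
  then show ?case by auto
qed

lemma Ck_on_has_derivative:
  "Ck_on (Suc k) S f \<Longrightarrow> x \<in> S \<Longrightarrow> (f has_derivative frechet_derivative f (at x)) (at x)"
  by (simp add: frechet_derivative_works)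

lemma Ck_on_const: "open S \<Longrightarrow> Ck_on k S (\<lambda>_. c)"
proof (induction k arbitrary: c)
  case (Suc k)
  then show ?case by (intro Ck_on_SucI[where D="\<lambda>_ _. 0"]) simp_all
qed simp

lemma Ck_on_inner: "open S \<Longrightarrow> Ck_on k S (\<lambda>x. x \<bullet> b)"
proof (cases k)
  case (Suc k)
  assume "open S" then show ?thesis unfolding Suc
    by (intro Ck_on_SucI[where D="\<lambda>_ h. h \<bullet> b"] Ck_on_const) (auto intro!: derivative_eq_intros)
qed (auto intro!: continuous_intros)

lemma Ck_on_add: "open S \<Longrightarrow> Ck_on k S f \<Longrightarrow> Ck_on k S g \<Longrightarrow> Ck_on k S (\<lambda>x. f x + g x)"
proof (induction k arbitrary: f g)
  case (Suc k)
  show ?case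
    by (rule Ck_on_SucI[where D="\<lambda>x h. frechet_derivative f (at x) h + frechet_derivative g (at x) h"])
       (use Suc in \<open>auto intro!: has_derivative_add simp: frechet_derivative_works[symmetric]\<close>)
qed (auto intro!: continuous_intros)

lemma Ck_on_mult: "open S \<Longrightarrow> Ck_on k S f \<Longrightarrow> Ck_on k S g \<Longrightarrow> Ck_on k S (\<lambda>x. f x * g x)"
proof (induction k arbitrary: f g)
  case (Suc k)
  have fg: "Ck_on k S f" "Ck_on k S g"
    using Suc.prems Ck_on_SucD by blast+
  show ?case
    by (rule Ck_on_SucI[where D="\<lambda>x h. f x * frechet_derivative g (at x) h + frechet_derivative f (at x) h * g x"])
       (use Suc fg in \<open>auto intro!: has_derivative_mult Ck_on_add simp: frechet_derivative_works[symmetric]\<close>)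
qed (auto intro!: continuous_intros)

lemma Ck_on_diff: 
  assumes "open S" "Ck_on k S f" "Ck_on k S g" shows "Ck_on k S (\<lambda>x. f x - g x)"
  using Ck_on_add[OF assms(1,2) Ck_on_mult[OF assms(1) Ck_on_const[OF assms(1), of k "-1"] assms(3)]]
  by simp

lemma Ck_on_sum: "open S \<Longrightarrow> (\<And>i. i \<in> I \<Longrightarrow> Ck_on k S (f i)) \<Longrightarrow> Ck_on k S (\<lambda>x. \<Sum>i\<in>I. f i x)"
  by (induction I rule: infinite_finite_induct) (auto intro: Ck_on_const Ck_on_add)

lemma Ck_on_prod: "open S \<Longrightarrow> (\<And>i. i \<in> I \<Longrightarrow> Ck_on k S (f i)) \<Longrightarrow> Ck_on k S (\<lambda>x. \<Prod>i\<in>I. f i x)"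
  by (induction I rule: infinite_finite_induct) (auto intro: Ck_on_const Ck_on_mult)

text \<open>The partial derivatives of the composition are \<open>D_i f\<close> times
  \<open>g' o f\<close>. The induction therefore replaces \<open>g\<close> by its derivative and
  keeps \<open>f\<close> fixed, which is why only \<open>g\<close> is generalised.\<close>

lemma Ck_on_compose:
  fixes g :: "real \<Rightarrow> real"
  assumes "open S" "open T" "\<And>x. x \<in> S \<Longrightarrow> f x \<in> T" "Ck_on k T g" "Ck_on k S f"
  shows "Ck_on k S (\<lambda>x. g (f x))"
  using assms(4,5)
proof (induction k arbitrary: g)
  case 0
  then show ?case using assms(3) 
    by (auto intro!: continuous_on_compose2[of T g S f])
next
  case (Suc k)
  have f: "Ck_on k S f" using Suc.prems Ck_on_SucD by blast
  show ?case
  proof (rule Ck_on_SucI[OF assms(1),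
        where D = "\<lambda>x h. frechet_derivative f (at x) h * frechet_derivative g (at (f x)) 1"])
    fix x assume x: "x \<in> S"
    show "((\<lambda>x. g (f x)) has_derivative (\<lambda>h. frechet_derivative f (at x) h * frechet_derivative g (at (f x)) 1)) (at x)"
    proof -
      have g: "(g has_derivative frechet_derivative g (at (f x))) (at (f x))"
        using Suc.prems(1) assms(3)[OF x] by (rule Ck_on_has_derivative)
      then have lin: "linear (frechet_derivative g (at (f x)))"
        by (rule has_derivative_linear)
      have eq: "frechet_derivative g (at (f x)) y = y * frechet_derivative g (at (f x)) 1" for y
        using linear_cmul[OF lin, of y 1] by simp
      show ?thesis
        by (rule has_derivative_eq_rhs[OF has_derivative_compose[OF Ck_on_has_derivative[OF Suc.prems(2) x] g]])
           (rule ext, rule eq)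
    qed
  next
    fix i :: 'a assume i: "i \<in> Basis"
    show "Ck_on k S (\<lambda>x. frechet_derivative f (at x) i * frechet_derivative g (at (f x)) 1)"
      using Suc.prems i f 
      by (intro Ck_on_mult[OF assms(1)] Suc.IH[of "\<lambda>y. frechet_derivative g (at y) 1"]) simp_all
  qed
qed

lemma Ck_on_powr: "Ck_on k {0<..} (\<lambda>x::real. x powr a)"
proof (induction k arbitrary: a)
  case (Suc k)
  show ?case
    by (rule Ck_on_SucI_real[where f'="\<lambda>x. a * x powr (a - 1)"])
       (auto intro!: Ck_on_mult Ck_on_const Suc has_real_derivative_powr)
qed (auto intro!: continuous_intros)

lemma Ck_on_ln: "Ck_on k {0<..} (ln :: real \<Rightarrow> real)"
proof (cases k)
  case (Suc k)
  show ?thesis unfolding Suc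
  proof (rule Ck_on_SucI_real[where f'="\<lambda>x. x powr (-1)"])
    show "(ln has_real_derivative x powr -1) (at x)" if "x \<in> {0<..}" for x :: real
      using that by (auto intro!: derivative_eq_intros)
  qed (rule open_greaterThan Ck_on_powr)+
qed (auto intro!: continuous_intros)

text \<open>Differentiation maps the family into its own span, which turns the smoothness of \<open>exp (-1/x)\<close> into an induction.\<close>

definition bump_fam :: "nat \<Rightarrow> real \<Rightarrow> real" where
  "bump_fam j x = (if x > 0 then inverse x ^ j * exp (- inverse x) else 0)"

text \<open>With \<open>y = 1 / x\<close> this is the decay of \<open>y ^ j / exp y\<close> at
  infinity.\<close>

lemma bump_fam_tendsto_0: "(bump_fam j \<longlongrightarrow> 0) (at 0)"
proof -
  have "((\<lambda>y::real. y ^ j / exp y) \<longlongrightarrow> 0) at_top" by (rule tendsto_power_div_exp_0)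
  then have "((\<lambda>x::real. inverse x ^ j / exp (inverse x)) \<longlongrightarrow> 0) (at_right 0)"
    by (rule filterlim_compose) (rule filterlim_inverse_at_top_right)
  then have 1: "(bump_fam j \<longlongrightarrow> 0) (at_right 0)"
    by (rule tendsto_cong[THEN iffD1, rotated])
       (auto simp: eventually_at_filter bump_fam_def exp_minus divide_inverse)
  have "(bump_fam j \<longlongrightarrow> 0) (at_left 0)"
    by (rule tendsto_eventually) (auto simp: eventually_at_filter bump_fam_def)
  with 1 show ?thesis by (simp add: filterlim_split_at)
qed

lemma bump_fam_has_derivative:
  "(bump_fam j has_real_derivative bump_fam (j + 2) x - real j * bump_fam (j + 1) x) (at x)"
proof (cases x "0::real" rule: linorder_cases)
  case less
  have "((\<lambda>_. 0) has_real_derivative bump_fam (j + 2) x - real j * bump_fam (j + 1) x) (at x)"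
    using less by (simp add: bump_fam_def)
  then show ?thesis
    by (rule DERIV_cong_ev[THEN iffD1, rotated -1, OF _ refl])
       (use less in \<open>auto simp: bump_fam_def intro!: eventually_mono[OF eventually_nhds_in_open[of "{..<0}" x]]\<close>)
next
  case equal
  \<comment> \<open>The difference quotient of \<open>bump_fam j\<close> at 0 is
    \<open>bump_fam (Suc j)\<close>, so the limit one index higher is the derivative.\<close>
  have "((\<lambda>h. (bump_fam j (0 + h) - bump_fam j 0) / h) \<longlongrightarrow> 0) (at 0)"
    using bump_fam_tendsto_0[of "Suc j"]
    by (rule tendsto_cong[THEN iffD1, rotated]) (auto simp: bump_fam_def divide_inverse)
  then show ?thesis unfolding equal by (simp add: DERIV_def bump_fam_def)
next
  case greater
  have "((\<lambda>x. inverse x ^ j * exp (- inverse x)) has_real_derivative bump_fam (j + 2) x - real j * bump_fam (j + 1) x) (at x)"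
    using greater
    using power_eq_if[of x "j - 1"]
    by (cases j) (auto simp: bump_fam_def power2_eq_square field_simps intro!: derivative_eq_intros)
  then show ?thesis
    by (rule DERIV_cong_ev[THEN iffD1, rotated -1, OF _ refl])
       (use greater in \<open>auto simp: bump_fam_def intro!: eventually_mono[OF eventually_nhds_in_open[of "{0<..}" x]]\<close>)
qed

lemma Ck_on_bump_fam: "Ck_on k UNIV (bump_fam j)"
proof (induction k arbitrary: j)
  case 0
  then show ?case
    by (auto intro!: continuous_at_imp_continuous_on DERIV_isCont bump_fam_has_derivative)
next
  case (Suc k)
  show ?case
    by (rule Ck_on_SucI_real[OF _ bump_fam_has_derivative]) 
       (auto intro!: Ck_on_diff Ck_on_mult Ck_on_const Suc)
qed

abbreviation "bump \<equiv> bump_fam 0"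

lemma bump_eq: "bump x = (if x > 0 then exp (- inverse x) else 0)"
  by (simp add: bump_fam_def)

lemma bump_nonneg: "0 \<le> bump x" and bump_le_1: "bump x \<le> 1"
  by (auto simp: bump_eq)

lemma bump_tendsto_1:
  assumes "filterlim f at_top F" shows "((\<lambda>n. bump (f n)) \<longlongrightarrow> 1) F"
proof -
  have "((\<lambda>n. exp (- inverse (f n))) \<longlongrightarrow> exp (- 0)) F"
    using tendsto_inverse_0_at_top[OF assms] by (intro tendsto_intros)
  moreover have "eventually (\<lambda>n. f n > 0) F"
    using assms by (auto simp: filterlim_at_top_dense)
  ultimately show ?thesis
    by (auto elim!: tendsto_cong[THEN iffD1, rotated] eventually_mono simp: bump_eq)
qed

section \<open>Compactly supported functions\<close>

lemma grad_inner_Basis: "i \<in> Basis \<Longrightarrow> grad f x \<bullet> i = frechet_derivative f (at x) i"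
  by (simp add: grad_def inner_sum_left inner_Basis if_distrib cong: if_cong)

lemma grad_eqI:
  assumes "(f has_derivative (\<lambda>h. G \<bullet> h)) (at x)"
  shows "grad f x = G"
  by (rule euclidean_eqI) (simp add: grad_inner_Basis frechet_derivative_at[OF assms, symmetric])

lemma has_derivative_grad:
  assumes "f differentiable (at x)"
  shows "(f has_derivative (\<lambda>h. grad f x \<bullet> h)) (at x)"
proof -
  have d: "(f has_derivative frechet_derivative f (at x)) (at x)"
    using assms frechet_derivative_works by blast
  then have lin: "linear (frechet_derivative f (at x))" by (rule has_derivative_linear)
  have "frechet_derivative f (at x) h = grad f x \<bullet> h" for h
  proof -
    have "frechet_derivative f (at x) h = frechet_derivative f (at x) (\<Sum>i\<in>Basis. (h \<bullet> i) *\<^sub>R i)"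
      by (simp add: euclidean_representation)
    also have "\<dots> = (\<Sum>i\<in>Basis. (h \<bullet> i) * frechet_derivative f (at x) i)"
      by (simp add: linear_sum[OF lin] linear_cmul[OF lin])
    also have "\<dots> = (\<Sum>i\<in>Basis. (h \<bullet> i) * (grad f x \<bullet> i))" by (simp add: grad_inner_Basis)
    also have "\<dots> = grad f x \<bullet> h" by (subst euclidean_inner) (simp add: mult.commute)
    finally show ?thesis .
  qed
  then have "frechet_derivative f (at x) = (\<lambda>h. grad f x \<bullet> h)" by blast
  with d show ?thesis by metis
qed

text \<open>\<open>K\<close> is any compact set off which \<open>f\<close> vanishes, not the support
  itself, so that a product can inherit it from its first factor. One continuous derivative suffices
  for integration by parts and for the estimates on rays.\<close>

definition C1_cpt :: "'a::euclidean_space set \<Rightarrow> ('a \<Rightarrow> real) \<Rightarrow> bool" where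
  "C1_cpt K f \<longleftrightarrow> compact K \<and> (\<forall>x. f differentiable at x) \<and> continuous_on UNIV (grad f) \<and> (\<forall>x. x \<notin> K \<longrightarrow> f x = 0)"

lemma Cc_infty_C1_cpt:
  assumes "f \<in> Cc_infty \<Omega>"
  obtains K where "C1_cpt K f" "K \<subseteq> \<Omega>"
proof (rule that)
  let ?K = "closure {x. f x \<noteq> 0}"
  have c1: "C_diff (Suc 0) f" using assms by (auto simp: Cc_infty_def)
  have "continuous_on UNIV (grad f)" unfolding grad_def
    using c1 by (intro continuous_intros) auto
  moreover have "f x = 0" if "x \<notin> ?K" for x using that closure_subset[of "{x. f x \<noteq> 0}"] by auto
  moreover have "compact ?K" using assms by (simp add: Cc_infty_def)
  moreover have "\<forall>x. f differentiable at x" using c1 unfolding C_diff.simps by (rule conjunct1)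
  ultimately show "C1_cpt ?K f" unfolding C1_cpt_def by blast
  show "?K \<subseteq> \<Omega>" using assms by (auto simp: Cc_infty_def)
qed

lemma
  assumes f: "C1_cpt K f"
  shows C1_cpt_deriv: "(f has_derivative (\<lambda>h. grad f x \<bullet> h)) (at x)"
    and C1_cpt_cont: "continuous_on S f"
    and C1_cpt_cont_grad: "continuous_on S (grad f)"
    and C1_cpt_compact: "compact K"
    and C1_cpt_zero: "x \<notin> K \<Longrightarrow> f x = 0"
    and C1_cpt_grad_zero: "x \<notin> K \<Longrightarrow> grad f x = 0"
    and C1_cpt_measurable: "f \<in> borel_measurable borel"
    and C1_cpt_grad_measurable: "grad f \<in> borel_measurable borel"
proof -
  show d: "(f has_derivative (\<lambda>h. grad f x \<bullet> h)) (at x)" for x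
    using f by (intro has_derivative_grad) (auto simp: C1_cpt_def)
  have c: "continuous_on UNIV f"
    by (intro continuous_at_imp_continuous_on ballI has_derivative_continuous[OF d])
  then show "continuous_on S f" by (rule continuous_on_subset) simp
  have cg: "continuous_on UNIV (grad f)" using f by (simp add: C1_cpt_def)
  then show "continuous_on S (grad f)" by (rule continuous_on_subset) simp
  show K: "compact K" "x \<notin> K \<Longrightarrow> f x = 0" for x using f by (auto simp: C1_cpt_def)
  show "grad f x = 0" if x: "x \<notin> K"
  proof (rule grad_eqI)
    have "((\<lambda>_. 0) has_derivative (\<lambda>h. 0 \<bullet> h)) (at x)" by simp
    then show "(f has_derivative (\<lambda>h. 0 \<bullet> h)) (at x)"
      by (rule has_derivative_transform_within_open[where s="- K"]) (use K x in \<open>auto intro: compact_imp_closed\<close>)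
  qed
  show "f \<in> borel_measurable borel" "grad f \<in> borel_measurable borel"
    using c cg by (auto intro: borel_measurable_continuous_onI)
qed

lemma bounded_of_compact_support:
  fixes g :: "'a::euclidean_space \<Rightarrow> 'b::real_normed_vector"
  assumes "compact K" "continuous_on UNIV g" "\<And>x. x \<notin> K \<Longrightarrow> g x = 0"
  shows "\<exists>B\<ge>0. \<forall>x. norm (g x) \<le> B"
proof -
  have "continuous_on K g" using assms(2) by (rule continuous_on_subset) simp
  then have "bounded (g ` K)"
    using assms(1) by (intro compact_imp_bounded compact_continuous_image)
  then obtain B where B: "\<And>x. x \<in> K \<Longrightarrow> norm (g x) \<le> B" "B > 0" by (auto simp: bounded_pos)
  have "norm (g x) \<le> B" for x using B assms(3)[of x] by (cases "x \<in> K") auto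
  then show ?thesis using B(2) by (intro exI[of _ B]) auto
qed

lemma C1_cpt_bound: "C1_cpt K f \<Longrightarrow> \<exists>B\<ge>0. \<forall>x. norm (f x) \<le> B"
  by (rule bounded_of_compact_support[OF C1_cpt_compact C1_cpt_cont C1_cpt_zero])

lemma C1_cpt_grad_bound: "C1_cpt K f \<Longrightarrow> \<exists>B\<ge>0. \<forall>x. norm (grad f x) \<le> B"
  by (rule bounded_of_compact_support[OF C1_cpt_compact C1_cpt_cont_grad C1_cpt_grad_zero])

lemma integrable_of_compact_support:
  fixes g :: "'a::euclidean_space \<Rightarrow> 'b::euclidean_space"
  assumes "compact K" "continuous_on UNIV g" "\<And>x. x \<notin> K \<Longrightarrow> g x = 0"
  shows "integrable lborel g"
proof -
  have "integrable lborel (\<lambda>x. indicator K x *\<^sub>R g x)"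
    by (intro borel_integrable_compact assms(1) continuous_on_subset[OF assms(2)]) simp
  moreover have "(\<lambda>x. indicator K x *\<^sub>R g x) = g" using assms(3) by (auto simp: indicator_def)
  ultimately show ?thesis by simp
qed

text \<open>Difference quotients have integral zero by translation invariance, so no iterated integrals are needed.\<close>

lemma C1_cpt_integral_grad:
  assumes f: "C1_cpt K f" and i: "i \<in> Basis"
  shows "(\<integral>x. grad f x \<bullet> i \<partial>lborel) = 0"
proof -
  obtain B where B: "\<And>x. norm (grad f x) \<le> B" "B \<ge> 0" using C1_cpt_grad_bound[OF f] by blast
  obtain \<rho> where \<rho>: "K \<subseteq> ball 0 \<rho>"
    using C1_cpt_compact[OF f] compact_imp_bounded bounded_subset_ballD by blast
  \<comment> \<open>Steps of length at most 1 keep all difference quotients supported in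
    \<open>ball 0 (\<rho> + 1)\<close>, where one constant dominates them.\<close>
  define h where "h n = 1 / real (Suc n)" for n
  have h: "h n > 0" "h n \<le> 1" for n by (auto simp: h_def field_simps)
  have h0: "h \<longlonglongrightarrow> 0" unfolding h_def using LIMSEQ_inverse_real_of_nat by (simp add: inverse_eq_divide)
  define s where "s n x = (f (x + h n *\<^sub>R i) - f x) / h n" for n x
  have [measurable]: "f \<in> borel_measurable borel" using C1_cpt_measurable[OF f] .
  have fi: "integrable lborel f"
    using integrable_of_compact_support[OF C1_cpt_compact[OF f] C1_cpt_cont[OF f] C1_cpt_zero[OF f]] .
  have tr: "integrable lborel (\<lambda>x. f (x + c))" "(\<integral>x. f (x + c) \<partial>lborel) = (\<integral>x. f x \<partial>lborel)" for c
  proof -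
    have D: "distr lborel borel ((+) c) = (lborel :: 'a measure)" by (rule lborel_distr_plus)
    have "integrable (distr lborel borel ((+) c)) f" using fi D by simp
    then have "integrable lborel (\<lambda>x. f (c + x))" by (subst (asm) integrable_distr_eq) auto
    then show "integrable lborel (\<lambda>x. f (x + c))" by (simp add: add.commute)
    have "(\<integral>x. f x \<partial>lborel) = (\<integral>x. f x \<partial>distr lborel borel ((+) c))" using D by simp
    also have "\<dots> = (\<integral>x. f (c + x) \<partial>lborel)" by (subst integral_distr) auto
    finally show "(\<integral>x. f (x + c) \<partial>lborel) = (\<integral>x. f x \<partial>lborel)" by (simp add: add.commute)
  qed
  have zero: "(\<integral>x. s n x \<partial>lborel) = 0" for n
    unfolding s_def using tr[of "h n *\<^sub>R i"] fi by (simp add: Bochner_Integration.integral_diff)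
  have "(\<lambda>n. \<integral>x. s n x \<partial>lborel) \<longlonglongrightarrow> (\<integral>x. grad f x \<bullet> i \<partial>lborel)"
  proof (rule integral_dominated_convergence[where w="\<lambda>x. B * indicator (ball 0 (\<rho> + 1)) x"])
    show "(\<lambda>x. grad f x \<bullet> i) \<in> borel_measurable lborel"
      using C1_cpt_grad_measurable[OF f] by simp
    show "s n \<in> borel_measurable lborel" for n unfolding s_def by measurable
    show "integrable lborel (\<lambda>x. B * indicator (ball (0::'a) (\<rho> + 1)) x)"
      by (intro integrable_mult_right integrable_real_indicator emeasure_bounded_finite bounded_ball) simp
    show "AE x in lborel. (\<lambda>n. s n x) \<longlonglongrightarrow> grad f x \<bullet> i"
    proof (rule AE_I2)
      fix x
      have "((\<lambda>t. f (x + t *\<^sub>R i)) has_derivative (\<lambda>t. grad f x \<bullet> (t *\<^sub>R i))) (at 0)"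
        by (rule has_derivative_compose[where g=f and f="\<lambda>t. x + t *\<^sub>R i", of "\<lambda>t. t *\<^sub>R i"])
           (auto intro!: derivative_eq_intros C1_cpt_deriv[OF f])
      then have "((\<lambda>t. f (x + t *\<^sub>R i)) has_real_derivative grad f x \<bullet> i) (at 0)"
        by (rule has_derivative_imp_has_field_derivative) simp
      then have "((\<lambda>t. (f (x + t *\<^sub>R i) - f x) / t) \<longlongrightarrow> grad f x \<bullet> i) (at 0)"
        by (simp add: DERIV_def)
      then show "(\<lambda>n. s n x) \<longlonglongrightarrow> grad f x \<bullet> i" unfolding s_def
      proof (rule filterlim_compose)
        have "h n \<noteq> 0" for n using h(1)[of n] by linarith
        then show "filterlim h (at 0) sequentially" using h0 by (simp add: filterlim_at)
      qed
    qed
    show "AE x in lborel. norm (s n x) \<le> B * indicator (ball 0 (\<rho> + 1)) x" for n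
    proof (rule AE_I2)
      fix x
      have "norm (f (x + h n *\<^sub>R i) - f x) \<le> B * norm (x + h n *\<^sub>R i - x)"
      proof (rule differentiable_bound[where S=UNIV and f'="\<lambda>x h. grad f x \<bullet> h"])
        show "onorm (\<lambda>h. grad f y \<bullet> h) \<le> B" for y
        proof (rule onorm_le)
          fix z
          have "norm (grad f y \<bullet> z) \<le> norm (grad f y) * norm z" using Cauchy_Schwarz_ineq2 by simp
          also have "\<dots> \<le> B * norm z" using B by (intro mult_right_mono) auto
          finally show "norm (grad f y \<bullet> z) \<le> B * norm z" .
        qed
      qed (use C1_cpt_deriv[OF f] in auto)
      then have 1: "norm (s n x) \<le> B" using h[of n] i by (simp add: s_def field_simps)
      have "s n x = 0" if "norm x \<ge> \<rho> + 1"
      proof -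
        have "norm (x + h n *\<^sub>R i) \<ge> norm x - norm (h n *\<^sub>R i)" using norm_triangle_ineq4[of "x + h n *\<^sub>R i" "h n *\<^sub>R i"] by simp
        then have "norm (x + h n *\<^sub>R i) \<ge> \<rho>" "norm x \<ge> \<rho>" using that h[of n] i by auto
        moreover have "norm y < \<rho>" if "y \<in> K" for y using \<rho> that by (auto simp: dist_norm)
        ultimately have "x \<notin> K" "x + h n *\<^sub>R i \<notin> K" by force+
        then show ?thesis using C1_cpt_zero[OF f] by (simp add: s_def)
      qed
      with 1 show "norm (s n x) \<le> B * indicator (ball 0 (\<rho> + 1)) x" by (auto simp: indicator_def)
    qed
  qed
  with zero show ?thesis by (simp add: LIMSEQ_const_iff)
qed

lemma C1_cpt_mult:
  assumes f: "C1_cpt K f" and g: "C1_cpt L g"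
  shows "C1_cpt K (\<lambda>x. f x * g x)" "grad (\<lambda>x. f x * g x) x = f x *\<^sub>R grad g x + g x *\<^sub>R grad f x"
proof -
  have d: "((\<lambda>x. f x * g x) has_derivative (\<lambda>h. (f x *\<^sub>R grad g x + g x *\<^sub>R grad f x) \<bullet> h)) (at x)" for x
    by (rule has_derivative_eq_rhs[OF has_derivative_mult[OF C1_cpt_deriv[OF f] C1_cpt_deriv[OF g]]])
       (auto simp: inner_add_left)
  then show gr: "grad (\<lambda>x. f x * g x) x = f x *\<^sub>R grad g x + g x *\<^sub>R grad f x" for x by (rule grad_eqI)
  show "C1_cpt K (\<lambda>x. f x * g x)"
    unfolding C1_cpt_def
  proof (intro conjI allI impI)
    show "continuous_on UNIV (grad (\<lambda>x. f x * g x))" unfolding gr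
      by (intro continuous_intros C1_cpt_cont[OF f] C1_cpt_cont[OF g] C1_cpt_cont_grad[OF f] C1_cpt_cont_grad[OF g])
  qed (use d C1_cpt_compact[OF f] C1_cpt_zero[OF f] in \<open>auto simp: differentiable_def\<close>)
qed

text \<open>Each component of the gradient of \<open>f * g\<close> has integral 0, and the product
  rule splits that gradient into the two sides.\<close>

lemma C1_cpt_integration_by_parts:
  assumes f: "C1_cpt K f" and g: "C1_cpt L g"
  shows "(\<integral>x. f x *\<^sub>R grad g x \<partial>lborel) = - (\<integral>x. g x *\<^sub>R grad f x \<partial>lborel)"
proof -
  have i1: "integrable lborel (\<lambda>x. f x *\<^sub>R grad g x)" if f: "C1_cpt K f" and g: "C1_cpt L g" for f g K L
    by (rule integrable_of_compact_support[OF C1_cpt_compact[OF f]])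
       (auto intro!: continuous_intros C1_cpt_cont[OF f] C1_cpt_cont_grad[OF g] simp: C1_cpt_zero[OF f])
  have "(\<integral>x. f x *\<^sub>R grad g x \<partial>lborel) + (\<integral>x. g x *\<^sub>R grad f x \<partial>lborel) = (\<integral>x. grad (\<lambda>x. f x * g x) x \<partial>lborel)"
    unfolding C1_cpt_mult(2)[OF f g] by (simp add: Bochner_Integration.integral_add i1[OF f g] i1[OF g f])
  also have "\<dots> = 0"
  proof (rule euclidean_eqI)
    fix i :: 'a assume i: "i \<in> Basis"
    have m: "C1_cpt K (\<lambda>x. f x * g x)" by (rule C1_cpt_mult[OF f g])
    have "integrable lborel (grad (\<lambda>x. f x * g x))"
      by (rule integrable_of_compact_support[OF C1_cpt_compact[OF m] C1_cpt_cont_grad[OF m] C1_cpt_grad_zero[OF m]])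
    then show "(\<integral>x. grad (\<lambda>x. f x * g x) x \<partial>lborel) \<bullet> i = 0 \<bullet> i"
      using C1_cpt_integral_grad[OF m i] by simp
  qed
  finally show ?thesis by (simp add: eq_neg_iff_add_eq_0)
qed

lemma Cc_infty_diff:
  assumes f: "f \<in> Cc_infty \<Omega>" and g: "g \<in> Cc_infty \<Omega>"
  shows "(\<lambda>x. f x - g x) \<in> Cc_infty \<Omega>" "grad (\<lambda>x. f x - g x) x = grad f x - grad g x"
proof -
  have "{x. f x - g x \<noteq> 0} \<subseteq> {x. f x \<noteq> 0} \<union> {x. g x \<noteq> 0}" by auto
  then have s: "closure {x. f x - g x \<noteq> 0} \<subseteq> closure {x. f x \<noteq> 0} \<union> closure {x. g x \<noteq> 0}"
    by (metis closure_Un closure_mono)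
  moreover have "compact (closure {x. f x \<noteq> 0} \<union> closure {x. g x \<noteq> 0})"
    using f g by (auto simp: Cc_infty_def)
  ultimately have "compact (closure {x. f x - g x \<noteq> 0})"
    using compact_Int_closed[OF _ closed_closure] by (metis Int_absorb1)
  then show "(\<lambda>x. f x - g x) \<in> Cc_infty \<Omega>"
    using f g s by (auto simp: Cc_infty_def C_diff_iff_Ck_on intro!: Ck_on_diff)
  obtain K L where KL: "C1_cpt K f" "C1_cpt L g"
    by (rule Cc_infty_C1_cpt[OF f], rule Cc_infty_C1_cpt[OF g])
  show "grad (\<lambda>x. f x - g x) x = grad f x - grad g x"
    by (rule grad_eqI)
       (use has_derivative_diff[OF C1_cpt_deriv[OF KL(1)] C1_cpt_deriv[OF KL(2)]] in \<open>simp add: inner_diff_left\<close>)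
qed

section \<open>Limits of square integrable functions\<close>

text \<open>A fast subsequence converges almost everywhere and defines \<open>U\<close>; Fatou's
  lemma then turns the Cauchy property of the whole sequence into convergence. The measure is
  arbitrary so that the weight can be absorbed into it, and the values are vectors because it is
  applied to gradients.\<close>

lemma riesz_fischer_L2:
  fixes u :: "nat \<Rightarrow> 'a \<Rightarrow> 'b::euclidean_space"
  assumes [measurable]: "\<And>n. u n \<in> borel_measurable M"
    and Cauchy: "\<And>e::real. e > 0 \<Longrightarrow> \<exists>K. \<forall>m\<ge>K. \<forall>n\<ge>K.
       (\<integral>\<^sup>+x. ennreal ((norm (u m x - u n x))\<^sup>2) \<partial>M) \<le> ennreal e"
  shows "\<exists>U\<in>borel_measurable M. (\<lambda>n. \<integral>\<^sup>+x. ennreal ((norm (u n x - U x))\<^sup>2) \<partial>M) \<longlonglongrightarrow> 0"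
proof -
  define D where "D m n = (\<integral>\<^sup>+x. ennreal ((norm (u m x - u n x))\<^sup>2) \<partial>M)" for m n
  \<comment> \<open>The rate \<open>(1/8)^k\<close> still leaves the summable \<open>(1/4)^k\<close>
    after multiplication by the weight \<open>2^k\<close> used below.\<close>
  have "\<exists>r. \<forall>k. (\<forall>m\<ge>r k. \<forall>n\<ge>r k. D m n \<le> ennreal ((1/8)^k)) \<and> r k < r (Suc k)"
  proof (rule dependent_nat_choice)
    show "\<exists>x. \<forall>m\<ge>x. \<forall>n\<ge>x. D m n \<le> ennreal ((1/8)^0)"
      using Cauchy[of 1] by (simp add: D_def)
  next
    fix x k
    obtain K where K: "\<forall>m\<ge>K. \<forall>n\<ge>K. D m n \<le> ennreal ((1/8)^Suc k)"
      using Cauchy[of "(1/8)^Suc k"] by (auto simp: D_def)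
    show "\<exists>y. (\<forall>m\<ge>y. \<forall>n\<ge>y. D m n \<le> ennreal ((1/8)^Suc k)) \<and> x < y"
      using K by (intro exI[of _ "max K (Suc x)"]) auto
  qed
  then obtain r :: "nat \<Rightarrow> nat" where
    r: "\<And>k m n. m \<ge> r k \<Longrightarrow> n \<ge> r k \<Longrightarrow> D m n \<le> ennreal ((1/8)^k)" and r_less: "\<And>k. r k < r (Suc k)"
    by blast
  have r_mono: "strict_mono r" using r_less by (simp add: strict_mono_Suc_iff)
  define d where "d k x = u (r (Suc k)) x - u (r k) x" for k x
  \<comment> \<open>The weights \<open>2^k\<close> make the increments decay geometrically wherever \<open>S\<close> is finite.\<close>
  define S where "S x = (\<Sum>k. ennreal (2^k * (norm (d k x))\<^sup>2))" for x
  have [measurable]: "d k \<in> borel_measurable M" for k unfolding d_def by measurable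
  have [measurable]: "S \<in> borel_measurable M" unfolding S_def by measurable
  have "(\<integral>\<^sup>+x. S x \<partial>M) = (\<Sum>k. \<integral>\<^sup>+x. ennreal (2^k * (norm (d k x))\<^sup>2) \<partial>M)"
    unfolding S_def by (rule nn_integral_suminf) measurable
  also have "\<dots> \<le> (\<Sum>k. ennreal ((1/4)^k))"
  proof (rule suminf_le)
    fix k
    have "(\<integral>\<^sup>+x. ennreal (2^k * (norm (d k x))\<^sup>2) \<partial>M) = ennreal (2^k) * D (r (Suc k)) (r k)"
      unfolding D_def d_def by (subst nn_integral_cmult[symmetric]) (auto simp: ennreal_mult)
    also have "\<dots> \<le> ennreal (2^k) * ennreal ((1/8)^k)"
      using r_less[of k] by (intro mult_left_mono r) auto
    also have "\<dots> = ennreal ((1/4)^k)"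
      by (simp add: ennreal_mult[symmetric] power_mult_distrib[symmetric])
    finally show "(\<integral>\<^sup>+x. ennreal (2^k * (norm (d k x))\<^sup>2) \<partial>M) \<le> ennreal ((1/4)^k)" .
  qed auto
  also have "\<dots> = ennreal (\<Sum>k. (1/4)^k)"
    by (rule suminf_ennreal2) auto
  also have "\<dots> < \<infinity>" by simp
  finally have "AE x in M. S x \<noteq> \<infinity>"
    by (intro nn_integral_PInf_AE) auto
  then have conv: "AE x in M. convergent (\<lambda>k. u (r k) x)"
  proof eventually_elim
    case (elim x)
    then obtain s where s: "S x = ennreal s" "s \<ge> 0" by (cases "S x") auto
    have le: "norm (d k x) \<le> sqrt s * (1 / sqrt 2) ^ k" for k
    proof -
      have "(\<Sum>k\<in>{k}. ennreal (2^k * (norm (d k x))\<^sup>2)) \<le> S x"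
        unfolding S_def by (rule sum_le_suminf) (rule summableI, simp, rule zero_le)
      then have "ennreal (2^k * (norm (d k x))\<^sup>2) \<le> ennreal s" unfolding s by simp
      then have "2^k * (norm (d k x))\<^sup>2 \<le> s" using s(2) by (subst (asm) ennreal_le_iff)
      then have "sqrt (2^k * (norm (d k x))\<^sup>2) \<le> sqrt s" by simp
      then have "sqrt 2 ^ k * norm (d k x) \<le> sqrt s"
        by (simp add: real_sqrt_mult real_sqrt_power)
      then show ?thesis by (simp add: field_simps power_divide)
    qed
    have "summable (\<lambda>k. sqrt s * (1 / sqrt 2) ^ k)"
      by (intro summable_mult summable_geometric) (simp add: real_less_rsqrt)
    then have "summable (\<lambda>k. norm (d k x))"
      by (rule summable_comparison_test'[where N=0]) (simp only: real_norm_def abs_norm_cancel le)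
    then have "summable (\<lambda>k. d k x)" by (rule summable_norm_cancel)
    then have "convergent (\<lambda>n. \<Sum>k<n. d k x)" by (simp add: summable_iff_convergent)
    moreover have "(\<Sum>k<n. d k x) = u (r n) x - u (r 0) x" for n
      unfolding d_def by (rule sum_lessThan_telescope)
    ultimately have "convergent (\<lambda>n. u (r n) x - u (r 0) x + u (r 0) x)"
      by (intro convergent_add convergent_const) simp
    then show ?case by simp
  qed
  define U where "U x = lim (\<lambda>k. u (r k) x)" for x
  have [measurable]: "U \<in> borel_measurable M" unfolding U_def by measurable
  have "(\<lambda>n. D' n) \<longlonglongrightarrow> 0" if D'_def: "D' = (\<lambda>n. \<integral>\<^sup>+x. ennreal ((norm (u n x - U x))\<^sup>2) \<partial>M)" for D'
  proof (rule order_tendstoI)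
    fix a :: ennreal assume "0 < a"
    then have "\<exists>e>0. ennreal e < a"
    proof (cases a)
      case (real b)
      with \<open>0 < a\<close> show ?thesis by (intro exI[of _ "b / 2"]) (auto simp: ennreal_less_iff)
    qed (auto intro: exI[of _ 1])
    then obtain e where e: "0 < e" "ennreal e < a" by blast
    obtain K where K: "\<forall>m\<ge>K. \<forall>n\<ge>K. D m n \<le> ennreal e" using Cauchy[OF e(1)] by (auto simp: D_def)
    have "D' n \<le> ennreal e" if n: "n \<ge> K" for n
    proof -
      \<comment> \<open>Fatou along the subsequence: \<open>r j \<ge> j\<close>, so for large
        \<open>j\<close> both indices in \<open>D n (r j)\<close> are beyond
        \<open>K\<close>.\<close>
      have "D' n = (\<integral>\<^sup>+x. liminf (\<lambda>j. ennreal ((norm (u n x - u (r j) x))\<^sup>2)) \<partial>M)"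
        unfolding D'_def
      proof (rule nn_integral_cong_AE, use conv in eventually_elim)
        case (elim x)
        then have "(\<lambda>j. u (r j) x) \<longlonglongrightarrow> U x" by (simp add: U_def convergent_LIMSEQ_iff)
        then have "(\<lambda>j. ennreal ((norm (u n x - u (r j) x))\<^sup>2)) \<longlonglongrightarrow> ennreal ((norm (u n x - U x))\<^sup>2)"
          by (intro tendsto_intros)
        then show ?case by (metis lim_imp_Liminf trivial_limit_sequentially)
      qed
      also have "\<dots> \<le> liminf (\<lambda>j. D n (r j))" unfolding D_def
        by (rule nn_integral_liminf) measurable
      also have "\<dots> \<le> liminf (\<lambda>j. ennreal e)"
      proof (rule Liminf_mono)
        show "\<forall>\<^sub>F j in sequentially. D n (r j) \<le> ennreal e"
          using eventually_ge_at_top[of K]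
        proof eventually_elim
          case (elim j)
          then show ?case using K n seq_suble[OF r_mono, of j] by auto
        qed
      qed
      finally show ?thesis by (simp add: Liminf_const)
    qed
    then show "\<forall>\<^sub>F n in sequentially. D' n < a"
      using e by (auto simp: eventually_sequentially intro!: exI[of _ K] intro: le_less_trans)
  qed auto
  then show ?thesis by (intro bexI[of _ U]) auto
qed

text \<open>Made for Cauchy-Schwarz, which bounds the square of an L1 distance; it spares square
  roots in \<open>ennreal\<close>.\<close>

lemma ennreal_power2_tendsto_0:
  fixes a :: "nat \<Rightarrow> ennreal"
  assumes "\<And>n. (a n)\<^sup>2 \<le> b n" "b \<longlonglongrightarrow> 0"
  shows "a \<longlonglongrightarrow> 0"
proof (rule order_tendstoI)
  fix c :: ennreal assume "0 < c"
  then have "0 < c\<^sup>2" by (simp add: zero_less_iff_neq_zero)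
  then have "\<forall>\<^sub>F n in sequentially. b n < c\<^sup>2" using order_tendstoD(2)[OF assms(2)] by auto
  then show "\<forall>\<^sub>F n in sequentially. a n < c"
  proof eventually_elim
    case (elim n)
    then have "(a n)\<^sup>2 < c\<^sup>2" using assms(1)[of n] by (rule le_less_trans[rotated])
    then show ?case by (meson not_le power_mono zero_le)
  qed
qed auto

text \<open>On a finite measure space Cauchy-Schwarz against the constant 1 turns convergence in L2
  into convergence in L1, which a bounded factor preserves. The general bilinear \<open>pr\<close>
  covers both sides of the weak gradient identity, a function times a vector field and a vector
  field times a function.\<close>

lemma L2_limit_pairing:
  fixes u :: "nat \<Rightarrow> 'a \<Rightarrow> 'b::euclidean_space" and g :: "'a \<Rightarrow> 'c::euclidean_space"
    and pr :: "'b \<Rightarrow> 'c \<Rightarrow> 'd::euclidean_space"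
  assumes "finite_measure M" "bounded_bilinear pr"
    and u: "\<And>n. integrable M (u n)" and U[measurable]: "U \<in> borel_measurable M"
    and lim: "(\<lambda>n. \<integral>\<^sup>+x. ennreal ((norm (u n x - U x))\<^sup>2) \<partial>M) \<longlonglongrightarrow> 0"
    and g[measurable]: "g \<in> borel_measurable M" and gB: "\<And>x. norm (g x) \<le> B"
  shows "integrable M U" "(\<lambda>n. \<integral>x. pr (u n x) (g x) \<partial>M) \<longlonglongrightarrow> (\<integral>x. pr (U x) (g x) \<partial>M)"
proof -
  interpret finite_measure M by fact
  interpret pr: bounded_bilinear pr by fact
  have um[measurable]: "u n \<in> borel_measurable M" for n using u by auto
  define d where "d n = (\<integral>\<^sup>+x. ennreal (norm (u n x - U x)) \<partial>M)" for n
  have d0: "d \<longlonglongrightarrow> 0"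
  proof (rule ennreal_power2_tendsto_0)
    fix n
    show "(d n)\<^sup>2 \<le> (\<integral>\<^sup>+x. ennreal ((norm (u n x - U x))\<^sup>2) \<partial>M) * emeasure M (space M)"
      using Cauchy_Schwarz_nn_integral[of "\<lambda>x. ennreal (norm (u n x - U x))" M "\<lambda>_. 1"]
      by (simp add: d_def ennreal_power)
    have "(\<lambda>n. (\<integral>\<^sup>+x. ennreal ((norm (u n x - U x))\<^sup>2) \<partial>M) * emeasure M (space M)) \<longlonglongrightarrow> 0 * emeasure M (space M)"
      by (rule tendsto_mult_ennreal[OF lim tendsto_const]) (auto simp: emeasure_finite)
    then show "(\<lambda>n. (\<integral>\<^sup>+x. ennreal ((norm (u n x - U x))\<^sup>2) \<partial>M) * emeasure M (space M)) \<longlonglongrightarrow> 0" by simp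
  qed
  then have "\<forall>\<^sub>F n in sequentially. d n < \<infinity>" using order_tendstoD(2) by force
  then obtain n0 where n0: "d n0 < \<infinity>" by (auto simp: eventually_sequentially)
  have "integrable M (\<lambda>x. u n0 x - U x)"
    using n0 by (intro integrableI_bounded) (auto simp: d_def)
  from Bochner_Integration.integrable_diff[OF u[of n0] this] show iU: "integrable M U" by simp
  obtain K where K: "\<And>a b. norm (pr a b) \<le> norm a * norm b * K" "K > 0" using pr.pos_bounded by blast
  have B: "B \<ge> 0" using gB[of undefined] norm_ge_zero order_trans by blast
  have m_pr[measurable]: "(\<lambda>x. pr (f x) (g x)) \<in> borel_measurable M" if [measurable]: "f \<in> borel_measurable M" for f
  proof -
    have "continuous_on UNIV (\<lambda>(a, b). pr a b)"
      by (auto simp: split_beta intro!: pr.continuous_on continuous_intros)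
    then show ?thesis by (intro borel_measurable_continuous_Pair[where H=pr]) (auto simp: split_beta)
  qed
  have bound: "norm (pr a (g x)) \<le> B * K * norm a" for a x
  proof -
    have "norm (pr a (g x)) \<le> norm a * norm (g x) * K" by (rule K)
    also have "\<dots> \<le> norm a * B * K" using K gB by (intro mult_right_mono mult_left_mono) auto
    finally show ?thesis by (simp add: mult_ac)
  qed
  have ipr: "integrable M (\<lambda>x. pr (f x) (g x))" if f: "integrable M f" for f
  proof (rule Bochner_Integration.integrable_bound)
    show "integrable M (\<lambda>x. B * K * norm (f x))" using f by auto
    show "(\<lambda>x. pr (f x) (g x)) \<in> borel_measurable M" using f by auto
    show "AE x in M. norm (pr (f x) (g x)) \<le> norm (B * K * norm (f x))"
      using bound B K by (auto intro: order_trans)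
  qed
  have "(\<lambda>n. ennreal (norm ((\<integral>x. pr (u n x) (g x) \<partial>M) - (\<integral>x. pr (U x) (g x) \<partial>M)))) \<longlonglongrightarrow> 0"
  proof (rule tendsto_sandwich[OF _ _ tendsto_const])
    show "\<forall>\<^sub>F n in sequentially. ennreal (norm ((\<integral>x. pr (u n x) (g x) \<partial>M) - (\<integral>x. pr (U x) (g x) \<partial>M))) \<le> ennreal (B * K) * d n"
    proof (rule always_eventually, rule allI)
      fix n
      have "(\<integral>x. pr (u n x) (g x) \<partial>M) - (\<integral>x. pr (U x) (g x) \<partial>M) = (\<integral>x. pr (u n x - U x) (g x) \<partial>M)"
        by (simp add: pr.diff_left Bochner_Integration.integral_diff ipr u iU)
      also have "ennreal (norm \<dots>) \<le> (\<integral>\<^sup>+x. norm (pr (u n x - U x) (g x)) \<partial>M)"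
        by (rule integral_norm_bound_ennreal) (intro ipr Bochner_Integration.integrable_diff u iU)
      also have "\<dots> \<le> (\<integral>\<^sup>+x. ennreal (B * K) * ennreal (norm (u n x - U x)) \<partial>M)"
        using bound B K by (intro nn_integral_mono) (auto simp flip: ennreal_mult intro!: ennreal_leI)
      also have "\<dots> = ennreal (B * K) * d n" unfolding d_def by (rule nn_integral_cmult) measurable
      finally show "ennreal (norm ((\<integral>x. pr (u n x) (g x) \<partial>M) - (\<integral>x. pr (U x) (g x) \<partial>M))) \<le> ennreal (B * K) * d n" .
    qed
    have "(\<lambda>n. ennreal (B * K) * d n) \<longlonglongrightarrow> ennreal (B * K) * 0"
      by (rule ennreal_tendsto_cmult[OF _ d0]) simp
    then show "(\<lambda>n. ennreal (B * K) * d n) \<longlonglongrightarrow> 0" by simp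
  qed auto
  then have "(\<lambda>n. norm ((\<integral>x. pr (u n x) (g x) \<partial>M) - (\<integral>x. pr (U x) (g x) \<partial>M))) \<longlonglongrightarrow> 0"
    by (subst (asm) ennreal_0[symmetric], subst (asm) tendsto_ennreal_iff) auto
  then show "(\<lambda>n. \<integral>x. pr (u n x) (g x) \<partial>M) \<longlonglongrightarrow> (\<integral>x. pr (U x) (g x) \<partial>M)"
    by (subst (asm) tendsto_norm_zero_iff) (rule LIM_zero_cancel)
qed

section \<open>Uniqueness of weak gradients\<close>

text \<open>As \<open>k\<close> grows this tends to the indicator of the open box while its support
  stays in the closed box. In this way integrals over boxes are reached from test functions.\<close>

definition box_bump :: "'a::euclidean_space \<Rightarrow> 'a \<Rightarrow> nat \<Rightarrow> 'a \<Rightarrow> real" where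
  "box_bump l u k x = (\<Prod>i\<in>Basis. bump (real k * (x \<bullet> i - l \<bullet> i)) * bump (real k * (u \<bullet> i - x \<bullet> i)))"

lemma box_bump_zero: "x \<notin> box l u \<Longrightarrow> box_bump l u k x = 0"
proof -
  assume "x \<notin> box l u"
  then obtain i where "i \<in> Basis" "x \<bullet> i \<le> l \<bullet> i \<or> u \<bullet> i \<le> x \<bullet> i"
    by (auto simp: mem_box not_less)
  then have "i \<in> Basis" "bump (real k * (x \<bullet> i - l \<bullet> i)) * bump (real k * (u \<bullet> i - x \<bullet> i)) = 0"
    by (auto simp: bump_eq zero_less_mult_iff)
  then show ?thesis unfolding box_bump_def using finite_Basis by (intro prod_zero) blast+
qed

lemma box_bump_range: "0 \<le> box_bump l u k x" "box_bump l u k x \<le> 1"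
  unfolding box_bump_def by (auto intro!: prod_nonneg prod_le_1 mult_nonneg_nonneg mult_le_one bump_nonneg bump_le_1)

lemma box_bump_tendsto:
  fixes x :: "'a::euclidean_space"
  shows "(\<lambda>k. box_bump l u k x) \<longlonglongrightarrow> indicator (box l u) x"
proof (cases "x \<in> box l u")
  case True
  have lim: "filterlim (\<lambda>k. real k * c) at_top sequentially" if "c > 0" for c
    using that by (intro filterlim_at_top_mult_tendsto_pos[OF tendsto_const] filterlim_real_sequentially)
  have "(\<lambda>k. box_bump l u k x) \<longlonglongrightarrow> (\<Prod>i\<in>(Basis::'a set). (1::real) * 1)"
    unfolding box_bump_def
  proof (rule tendsto_prod)
    fix i :: 'a assume "i \<in> Basis"
    then show "(\<lambda>k. bump (real k * (x \<bullet> i - l \<bullet> i)) * bump (real k * (u \<bullet> i - x \<bullet> i))) \<longlonglongrightarrow> 1 * 1"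
      using True by (intro tendsto_mult bump_tendsto_1 lim) (auto simp: mem_box)
  qed
  then show ?thesis using True by simp
qed (simp add: box_bump_zero)

lemma box_bump_Cc_infty:
  assumes "cbox l u \<subseteq> \<Omega>" shows "box_bump l u k \<in> Cc_infty \<Omega>"
proof -
  have "{x. box_bump l u k x \<noteq> 0} \<subseteq> cbox l u"
    using box_bump_zero box_subset_cbox by blast
  then have s: "closure {x. box_bump l u k x \<noteq> 0} \<subseteq> cbox l u"
    by (rule closure_minimal[OF _ closed_cbox])
  then have "compact (closure {x. box_bump l u k x \<noteq> 0})"
    using compact_Int_closed[OF compact_cbox closed_closure] by (metis Int_absorb1)
  moreover have "C_diff j (box_bump l u k)" for j
    unfolding C_diff_iff_Ck_on box_bump_def
  proof (intro Ck_on_prod Ck_on_mult open_UNIV)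
    fix i :: 'a
    show "Ck_on j UNIV (\<lambda>x. bump (real k * (x \<bullet> i - l \<bullet> i)))"
      by (rule Ck_on_compose[OF open_UNIV open_UNIV UNIV_I Ck_on_bump_fam])
         (intro Ck_on_mult Ck_on_diff Ck_on_const Ck_on_inner open_UNIV)
    show "Ck_on j UNIV (\<lambda>x. bump (real k * (u \<bullet> i - x \<bullet> i)))"
      by (rule Ck_on_compose[OF open_UNIV open_UNIV UNIV_I Ck_on_bump_fam])
         (intro Ck_on_mult Ck_on_diff Ck_on_const Ck_on_inner open_UNIV)
  qed
  ultimately show ?thesis using s assms by (auto simp: Cc_infty_def)
qed

text \<open>The positive and the negative part of \<open>g\<close> are densities of two measures
  that agree on open boxes, an intersection-stable generator, hence everywhere. Since
  \<open>ennreal\<close> sends negative numbers to 0, equality of the densities forces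
  \<open>g x = 0\<close>.\<close>

lemma AE_zero_of_box_integrals:
  fixes g :: "'a::euclidean_space \<Rightarrow> real"
  assumes g: "integrable lborel g" and zero: "\<And>l u. (\<integral>x. indicator (box l u) x * g x \<partial>lborel) = 0"
  shows "AE x in lborel. g x = 0"
proof -
  have [measurable]: "g \<in> borel_measurable borel" using g by auto
  have bi: "integrable lborel (\<lambda>x. indicator (box l u) x * g x)" for l u
    by (rule Bochner_Integration.integrable_bound[OF g]) (auto simp: indicator_def)
  have eq: "emeasure (density lborel (\<lambda>x. ennreal (g x))) (box l u) = emeasure (density lborel (\<lambda>x. ennreal (- g x))) (box l u)"
    and fin: "emeasure (density lborel (\<lambda>x. ennreal (g x))) (box l u) \<noteq> \<infinity>" for l u
  proof -
    let ?h = "\<lambda>x. indicator (box l u) x * g x"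
    have 1: "(\<integral>\<^sup>+x. ennreal (?h x) \<partial>lborel) < \<infinity>" "(\<integral>\<^sup>+x. ennreal (- ?h x) \<partial>lborel) < \<infinity>"
      using bi[of l u] by (auto simp: real_integrable_def less_top)
    have "enn2real (\<integral>\<^sup>+x. ennreal (?h x) \<partial>lborel) = enn2real (\<integral>\<^sup>+x. ennreal (- ?h x) \<partial>lborel)"
      using real_lebesgue_integral_def[OF bi, of l u] zero[of l u] by simp
    then have 2: "(\<integral>\<^sup>+x. ennreal (?h x) \<partial>lborel) = (\<integral>\<^sup>+x. ennreal (- ?h x) \<partial>lborel)"
      using 1 by (metis ennreal_enn2real infinity_ennreal_def)
    have 3: "emeasure (density lborel (\<lambda>x. ennreal (s * g x))) (box l u) = (\<integral>\<^sup>+x. ennreal (s * ?h x) \<partial>lborel)" for s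
      by (subst emeasure_density) (auto intro!: nn_integral_cong simp: indicator_def)
    show "emeasure (density lborel (\<lambda>x. ennreal (g x))) (box l u) = emeasure (density lborel (\<lambda>x. ennreal (- g x))) (box l u)"
      using 3[of 1] 3[of "-1"] 2 by simp
    show "emeasure (density lborel (\<lambda>x. ennreal (g x))) (box l u) \<noteq> \<infinity>"
      using 3[of 1] 1 by simp
  qed
  have "density lborel (\<lambda>x. ennreal (g x)) = density lborel (\<lambda>x. ennreal (- g x))"
  proof (rule measure_eqI_generator_eq)
    let ?E = "range (\<lambda>(a, b). box a b::'a set)"
    show "Int_stable ?E" by (auto simp: Int_stable_def box_Int_box)
    show "?E \<subseteq> Pow UNIV" "sets (density lborel (\<lambda>x. ennreal (g x))) = sigma_sets UNIV ?E"
      "sets (density lborel (\<lambda>x. ennreal (- g x))) = sigma_sets UNIV ?E"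
      by (simp_all add: borel_eq_box)
    let ?A = "\<lambda>n::nat. box (- (real n *\<^sub>R One)) (real n *\<^sub>R One) :: 'a set"
    show "range ?A \<subseteq> ?E" "(\<Union>i. ?A i) = UNIV"
      unfolding UN_box_eq_UNIV by auto
  qed (use eq fin in auto)
  then have "AE x in lborel. ennreal (g x) = ennreal (- g x)"
    by (rule sigma_finite_measure.density_unique[OF sigma_finite_lborel, rotated 2]) auto
  then show ?thesis
    by (rule eventually_mono) (metis ennreal_eq_0_iff ennreal_le_iff2 linear neg_0_le_iff_le order.antisym neg_le_0_iff_le)
qed

text \<open>\<open>H\<close> is only locally integrable and Lebesgue measurable. So each closed box
  in \<open>\<Omega>\<close> is treated separately, with a Borel version of \<open>H\<close> cut off
  to its interior, and countably many such boxes cover \<open>\<Omega>\<close>.\<close>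

lemma AE_zero_of_Cc_infty:
  fixes H :: "'a::euclidean_space \<Rightarrow> real"
  assumes \<Omega>: "open \<Omega>"
    and H: "\<And>K. compact K \<Longrightarrow> K \<subseteq> \<Omega> \<Longrightarrow> set_integrable lebesgue K H"
    and zero: "\<And>\<phi>. \<phi> \<in> Cc_infty \<Omega> \<Longrightarrow> (\<integral>x. indicator \<Omega> x *\<^sub>R (\<phi> x * H x) \<partial>lebesgue) = 0"
  shows "AE x in lebesgue. x \<in> \<Omega> \<longrightarrow> H x = 0"
proof -
  have box0: "(\<integral>x. indicator (box l u) x * H x \<partial>lebesgue) = 0" if lu: "cbox l u \<subseteq> \<Omega>" for l u
  proof -
    have Hc: "integrable lebesgue (\<lambda>x. indicator (cbox l u) x *\<^sub>R H x)"
      using H[OF compact_cbox that] by (simp add: set_integrable_def)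
    have e: "box_bump l u k x * H x = box_bump l u k x * (indicator (cbox l u) x *\<^sub>R H x)" for k x
      using box_bump_zero[of x l u k] box_subset_cbox[of l u] by (auto simp: indicator_def)
    have [measurable]: "box_bump l u k \<in> borel_measurable lebesgue" for k
    proof -
      obtain K where "C1_cpt K (box_bump l u k)" by (rule Cc_infty_C1_cpt[OF box_bump_Cc_infty[OF lu]])
      from C1_cpt_measurable[OF this] show ?thesis by (intro measurable_completion) simp
    qed
    have [measurable]: "(\<lambda>x. indicator (cbox l u) x *\<^sub>R H x) \<in> borel_measurable lebesgue" using Hc by auto
    have "(\<lambda>k. \<integral>x. box_bump l u k x * (indicator (cbox l u) x *\<^sub>R H x) \<partial>lebesgue) \<longlonglongrightarrow>
      (\<integral>x. indicator (box l u) x * (indicator (cbox l u) x *\<^sub>R H x) \<partial>lebesgue)"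
    proof (rule integral_dominated_convergence[where w="\<lambda>x. norm (indicator (cbox l u) x *\<^sub>R H x)"])
      show "AE x in lebesgue. (\<lambda>k. box_bump l u k x * (indicator (cbox l u) x *\<^sub>R H x)) \<longlonglongrightarrow> indicator (box l u) x * (indicator (cbox l u) x *\<^sub>R H x)"
        by (intro AE_I2 tendsto_intros box_bump_tendsto)
      show "AE x in lebesgue. norm (box_bump l u k x * (indicator (cbox l u) x *\<^sub>R H x)) \<le> norm (indicator (cbox l u) x *\<^sub>R H x)" for k
        using box_bump_range[of l u k] by (intro AE_I2) (simp add: abs_mult mult_left_le_one_le)
      show "(\<lambda>x. indicator (box l u) x * (indicator (cbox l u) x *\<^sub>R H x)) \<in> borel_measurable lebesgue"
        by (intro borel_measurable_times borel_measurable_integrable[OF Hc] borel_measurable_indicator) simp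
    qed (use Hc in auto)
    moreover have "(\<integral>x. box_bump l u k x * (indicator (cbox l u) x *\<^sub>R H x) \<partial>lebesgue) = 0" for k
    proof -
      have "indicator \<Omega> x *\<^sub>R (box_bump l u k x * H x) = box_bump l u k x * (indicator (cbox l u) x *\<^sub>R H x)" for x
        unfolding e[symmetric] using box_bump_zero[of x l u k] lu box_subset_cbox[of l u] by (auto simp: indicator_def)
      then have "(\<lambda>x. indicator \<Omega> x *\<^sub>R (box_bump l u k x * H x)) = (\<lambda>x. box_bump l u k x * (indicator (cbox l u) x *\<^sub>R H x))"
        by (rule ext)
      with zero[OF box_bump_Cc_infty[OF lu], of k] show ?thesis by (simp only:)
    qed
    moreover have "indicator (box l u) x * (indicator (cbox l u) x *\<^sub>R H x) = indicator (box l u) x * H x" for x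
      using box_subset_cbox[of l u] by (auto simp: indicator_def)
    ultimately show ?thesis by (simp only: LIMSEQ_const_iff)
  qed
  have cb: "AE x in lebesgue. x \<in> cbox a b \<longrightarrow> H x = 0" if ab: "cbox a b \<subseteq> \<Omega>" for a b
  proof -
    define g where "g = (\<lambda>x. indicator (box a b) x * H x)"
    have "set_integrable lebesgue (box a b) H"
      by (rule set_integrable_subset[OF H[OF compact_cbox ab]]) (auto simp: box_subset_cbox)
    then have gi: "integrable lebesgue g" by (simp add: set_integrable_def g_def)
    then obtain g' where g': "g' \<in> borel_measurable lborel" "AE x in lborel. g x = g' x"
      using completion_ex_borel_measurable_real by blast
    have ae: "AE x in lebesgue. g x = g' x" using g'(2) by (rule AE_completion)
    have m': "g' \<in> borel_measurable lebesgue" using g'(1) by (rule measurable_completion)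
    have "integrable lebesgue g'"
      using gi integrable_cong_AE[OF _ m' ae] by auto
    then have "integrable lborel g'" using g'(1) by (simp add: integrable_completion)
    moreover have "(\<integral>x. indicator (box l u) x * g' x \<partial>lborel) = 0" for l u
    proof -
      obtain l' u' where lu: "box l u \<inter> box a b = box l' u'" using box_Int_box by blast
      have "(\<integral>x. indicator (box l u) x * g' x \<partial>lborel) = (\<integral>x. indicator (box l u) x * g' x \<partial>lebesgue)"
        using g'(1) by (intro integral_completion[symmetric] borel_measurable_times borel_measurable_indicator) simp_all
      also have "\<dots> = (\<integral>x. indicator (box l u) x * g x \<partial>lebesgue)"
        by (rule integral_cong_AE) (use gi m' ae in \<open>auto elim!: eventually_mono intro!: borel_measurable_times borel_measurable_indicator\<close>)
      also have "\<dots> = (\<integral>x. indicator (box l' u') x * H x \<partial>lebesgue)"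
        unfolding lu[symmetric] g_def by (intro Bochner_Integration.integral_cong) (auto simp: indicator_def)
      also have "\<dots> = 0"
      \<comment> \<open>An empty open box may have a degenerate closed box that leaves
        \<open>\<Omega>\<close>. A nonempty one has its closed box as closure, which stays inside
        \<open>cbox a b\<close>.\<close>
      proof (cases "box l' u' = {}")
        case False
        then have "cbox l' u' = closure (box l' u')" by simp
        also have "\<dots> \<subseteq> closure (cbox a b)" using lu box_subset_cbox[of a b] by (intro closure_mono) blast
        finally show ?thesis using ab by (intro box0) auto
      qed simp
      finally show ?thesis .
    qed
    ultimately have "AE x in lborel. g' x = 0" by (rule AE_zero_of_box_integrals)
    then have "AE x in lebesgue. g' x = 0" by (rule AE_completion)
    moreover have "AE x in lebesgue. x \<notin> cbox a b - box a b"
      using negligible_frontier_interval[of a b] by (intro AE_not_in) (simp add: negligible_iff_null_sets)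
    ultimately show ?thesis using ae
      by eventually_elim (auto simp: g_def indicator_def)
  qed
  obtain \<D> where D: "countable \<D>" "\<D> \<subseteq> Pow \<Omega>" "\<And>X. X \<in> \<D> \<Longrightarrow> \<exists>a b. X = cbox a b" "\<Union>\<D> = \<Omega>"
    using open_countable_Union_open_cbox[OF \<Omega>] by blast
  have "AE x in lebesgue. \<forall>X\<in>\<D>. x \<in> X \<longrightarrow> H x = 0"
    unfolding AE_ball_countable[OF D(1)]
  proof
    fix X assume X: "X \<in> \<D>"
    then obtain a b where "X = cbox a b" using D(3) by blast
    then show "AE x in lebesgue. x \<in> X \<longrightarrow> H x = 0" using cb D(2) X by blast
  qed
  then show ?thesis by (rule eventually_mono) (use D(4) in blast)
qed

text \<open>This is what allows \<open>HS_numerator\<close> to be computed from any weak gradient at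
  hand. Each component of the difference is locally integrable and has integral 0 against every test
  function.\<close>

lemma weak_gradient_unique:
  fixes v :: "'a::euclidean_space \<Rightarrow> real"
  assumes \<Omega>: "open \<Omega>" and G: "is_weak_gradient \<Omega> v G" and G': "is_weak_gradient \<Omega> v G'"
  shows "AE x in lebesgue. x \<in> \<Omega> \<longrightarrow> G x = G' x"
proof -
  have int: "integrable (lebesgue_on \<Omega>) (\<lambda>x. \<phi> x *\<^sub>R G x)"
    if G: "is_weak_gradient \<Omega> v G" and \<phi>: "\<phi> \<in> Cc_infty \<Omega>" for G \<phi>
  proof -
    obtain K where K: "C1_cpt K \<phi>" "K \<subseteq> \<Omega>" by (rule Cc_infty_C1_cpt[OF \<phi>])
    obtain B where B: "B \<ge> 0" "\<And>x. norm (\<phi> x) \<le> B" using C1_cpt_bound[OF K(1)] by blast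
    have GK: "integrable lebesgue (\<lambda>x. indicator K x *\<^sub>R G x)"
      using G C1_cpt_compact[OF K(1)] K(2) by (simp add: is_weak_gradient_def set_integrable_def)
    have [measurable]: "\<phi> \<in> borel_measurable lebesgue"
      by (rule measurable_completion) (simp add: C1_cpt_measurable[OF K(1)])
    have e: "indicator \<Omega> x *\<^sub>R (\<phi> x *\<^sub>R G x) = \<phi> x *\<^sub>R (indicator K x *\<^sub>R G x)" for x
      using C1_cpt_zero[OF K(1), of x] K(2) by (auto simp: indicator_def)
    have "integrable lebesgue (\<lambda>x. \<phi> x *\<^sub>R (indicator K x *\<^sub>R G x))"
    proof (rule Bochner_Integration.integrable_bound)
      show "integrable lebesgue (\<lambda>x. B * norm (indicator K x *\<^sub>R G x))"
        by (intro integrable_mult_right integrable_norm GK)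
      show "(\<lambda>x. \<phi> x *\<^sub>R (indicator K x *\<^sub>R G x)) \<in> borel_measurable lebesgue"
        by (intro borel_measurable_scaleR borel_measurable_integrable[OF GK]) measurable
      show "AE x in lebesgue. norm (\<phi> x *\<^sub>R (indicator K x *\<^sub>R G x)) \<le> norm (B * norm (indicator K x *\<^sub>R G x))"
        using B by (intro AE_I2) (auto simp: abs_mult mult.assoc intro!: mult_right_mono)
    qed
    moreover have "\<Omega> \<inter> space lebesgue \<in> sets lebesgue" using \<Omega> by auto
    ultimately show ?thesis by (simp only: integrable_restrict_space e)
  qed
  have "AE x in lebesgue. x \<in> \<Omega> \<longrightarrow> (G x - G' x) \<bullet> i = 0" if i: "i \<in> Basis" for i
  proof (rule AE_zero_of_Cc_infty[OF \<Omega>])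
    fix K assume K: "compact K" "K \<subseteq> \<Omega>"
    have "integrable lebesgue (\<lambda>x. (indicator K x *\<^sub>R G x - indicator K x *\<^sub>R G' x) \<bullet> i)"
      using G G' K by (intro integrable_inner_left Bochner_Integration.integrable_diff)
        (auto simp: is_weak_gradient_def set_integrable_def)
    then show "set_integrable lebesgue K (\<lambda>x. (G x - G' x) \<bullet> i)"
      by (simp add: set_integrable_def inner_diff_left right_diff_distrib)
  next
    fix \<phi> assume \<phi>: "\<phi> \<in> Cc_infty \<Omega>"
    have "(\<integral>x. indicator \<Omega> x *\<^sub>R (\<phi> x * ((G x - G' x) \<bullet> i)) \<partial>lebesgue) = (\<integral>x. \<phi> x * ((G x - G' x) \<bullet> i) \<partial>lebesgue_on \<Omega>)"
      using \<Omega> by (subst integral_restrict_space) auto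
    also have "\<dots> = (\<integral>x. (\<phi> x *\<^sub>R G x - \<phi> x *\<^sub>R G' x) \<bullet> i \<partial>lebesgue_on \<Omega>)"
      by (simp add: inner_diff_left right_diff_distrib)
    also have "\<dots> = ((\<integral>x. \<phi> x *\<^sub>R G x \<partial>lebesgue_on \<Omega>) - (\<integral>x. \<phi> x *\<^sub>R G' x \<partial>lebesgue_on \<Omega>)) \<bullet> i"
      using int[OF G \<phi>] int[OF G' \<phi>]
      by (subst integral_inner_left) (auto simp: Bochner_Integration.integral_diff)
    also have "(\<integral>x. \<phi> x *\<^sub>R G x \<partial>lebesgue_on \<Omega>) = (\<integral>x. \<phi> x *\<^sub>R G' x \<partial>lebesgue_on \<Omega>)"
      using G G' \<phi> unfolding is_weak_gradient_def by (metis neg_equal_iff_equal)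
    finally show "(\<integral>x. indicator \<Omega> x *\<^sub>R (\<phi> x * ((G x - G' x) \<bullet> i)) \<partial>lebesgue) = 0" by simp
  qed
  then have "AE x in lebesgue. \<forall>i\<in>Basis. x \<in> \<Omega> \<longrightarrow> (G x - G' x) \<bullet> i = 0"
    by (subst AE_ball_countable) (auto intro: countable_finite)
  then show ?thesis
  proof eventually_elim
    case (elim x)
    then show ?case using euclidean_all_zero_iff[of "G x - G' x"] by auto
  qed
qed

section \<open>Polar coordinates\<close>

text \<open>The density \<open>ang\<close> on the annulus \<open>1 < \<bar>x\<bar> < e\<close> replaces the surface measure of the sphere: in logarithmic
  length, every ray from the origin meets this annulus in a segment of length 1.\<close>

definition ray :: "real \<Rightarrow> 'a::euclidean_space \<Rightarrow> real \<Rightarrow> 'a" where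
  "ray R x t = (R * exp (- t) / norm x) *\<^sub>R x"

definition ang :: "'a::euclidean_space \<Rightarrow> ennreal" where
  "ang x = ennreal (norm x powr - real DIM('a)) * indicator {x. 1 < norm x \<and> norm x < exp 1} x"

lemma ang_measurable [measurable]: "ang \<in> borel_measurable borel"
  unfolding ang_def by measurable

lemma ray_measurable [measurable]: "(\<lambda>(x, t). ray R x t) \<in> borel \<Otimes>\<^sub>M borel \<rightarrow>\<^sub>M borel"
  unfolding ray_def by measurable

lemma ray_measurable2 [measurable]: "ray R x \<in> borel \<rightarrow>\<^sub>M borel"
  unfolding ray_def by measurable

lemma norm_ray: "R > 0 \<Longrightarrow> x \<noteq> 0 \<Longrightarrow> norm (ray R x t) = R * exp (- t)"
  by (simp add: ray_def)

lemma nn_integral_lborel_scaleR: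
  fixes f :: "'a::euclidean_space \<Rightarrow> ennreal"
  assumes [measurable]: "f \<in> borel_measurable borel" and c: "c > 0"
  shows "(\<integral>\<^sup>+x. f x \<partial>lborel) = ennreal (c ^ DIM('a)) * (\<integral>\<^sup>+x. f (c *\<^sub>R x) \<partial>lborel)"
proof -
  have "lborel = density (distr lborel borel (\<lambda>x::'a. c *\<^sub>R x)) (\<lambda>_. ennreal (c ^ DIM('a)))" (is "_ = ?D")
    using lborel_affine[of c "0::'a"] c by (simp add: ennreal_power)
  then have "(\<integral>\<^sup>+x. f x \<partial>lborel) = (\<integral>\<^sup>+x. f x \<partial>?D)" by (rule arg_cong)
  also have "\<dots> = ennreal (c ^ DIM('a)) * (\<integral>\<^sup>+x. f (c *\<^sub>R x) \<partial>lborel)"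
    by (simp add: nn_integral_density nn_integral_distr nn_integral_cmult)
  finally show ?thesis .
qed

text \<open>The measure \<open>|y| powr (-N) dy\<close> is invariant under dilations, so for fixed
  \<open>t\<close> the substitution \<open>y = exp (- t) x\<close> leaves only the condition that
  \<open>exp t * norm y\<close> lies between 1 and \<open>exp 1\<close>. By Fubini the set of these
  \<open>t\<close> contributes its length, which is 1.\<close>

lemma polar:
  fixes F :: "'a::euclidean_space \<Rightarrow> ennreal"
  assumes [measurable]: "F \<in> borel_measurable borel" and R: "R > 0"
  shows "(\<integral>\<^sup>+y. F y * ennreal (norm y powr - real DIM('a)) \<partial>lborel) =
    (\<integral>\<^sup>+x. ang x * (\<integral>\<^sup>+t. F (ray R x t) \<partial>lborel) \<partial>lborel)"
proof -
  let ?N = "real DIM('a)"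
  \<comment> \<open>A translation of \<open>t\<close> by \<open>ln (R / norm x)\<close> changes
    nothing in the integral and makes the point on the ray linear in \<open>x\<close>.\<close>
  have shift: "ang x * (\<integral>\<^sup>+t. F (ray R x t) \<partial>lborel) = (\<integral>\<^sup>+t. ang x * F (exp (- t) *\<^sub>R x) \<partial>lborel)" for x :: 'a
  proof (cases "x = 0")
    case False
    have "(\<integral>\<^sup>+t. F (exp (- t) *\<^sub>R x) \<partial>lborel) = (\<integral>\<^sup>+t. F (exp (- (- ln (R / norm x) + 1 * t)) *\<^sub>R x) \<partial>lborel)"
      by (subst nn_integral_real_affine[where c=1 and t="- ln (R / norm x)"]) auto
    also have "\<dots> = (\<integral>\<^sup>+t. F (ray R x t) \<partial>lborel)"
      using R False by (simp add: ray_def exp_diff exp_minus field_simps)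
    finally show ?thesis by (simp add: nn_integral_cmult)
  qed (simp add: ang_def)
  have inner: "(\<integral>\<^sup>+x. ang x * F (exp (- t) *\<^sub>R x) \<partial>lborel) =
     (\<integral>\<^sup>+y. ennreal (norm y powr - ?N) * F y * indicator {t. 1 < exp t * norm y \<and> exp t * norm y < exp 1} t \<partial>lborel)" for t
  proof -
    have "(\<integral>\<^sup>+x. ang x * F (exp (- t) *\<^sub>R x) \<partial>lborel) =
      ennreal (exp t ^ DIM('a)) * (\<integral>\<^sup>+y. ang (exp t *\<^sub>R y) * F (exp (- t) *\<^sub>R exp t *\<^sub>R y) \<partial>lborel)"
      by (rule nn_integral_lborel_scaleR) auto
    also have "\<dots> = (\<integral>\<^sup>+y. ennreal (exp t ^ DIM('a)) * (ang (exp t *\<^sub>R y) * F y) \<partial>lborel)"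
      by (subst nn_integral_cmult) (auto simp: exp_minus)
    also have "\<dots> = (\<integral>\<^sup>+y. ennreal (norm y powr - ?N) * F y * indicator {t. 1 < exp t * norm y \<and> exp t * norm y < exp 1} t \<partial>lborel)"
    proof (rule nn_integral_cong)
      fix y :: 'a
      have "exp t ^ DIM('a) * (exp t * norm y) powr - ?N = norm y powr - ?N"
      proof -
        have "exp t ^ DIM('a) = exp t powr ?N" by (simp add: powr_realpow)
        then show ?thesis by (simp add: powr_mult powr_minus field_simps)
      qed
      then have "ennreal (exp t ^ DIM('a)) * ennreal ((exp t * norm y) powr - ?N) = ennreal (norm y powr - ?N)"
        by (simp flip: ennreal_mult)
      then show "ennreal (exp t ^ DIM('a)) * (ang (exp t *\<^sub>R y) * F y) =
        ennreal (norm y powr - ?N) * F y * indicator {t. 1 < exp t * norm y \<and> exp t * norm y < exp 1} t"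
        by (auto simp: ang_def indicator_def mult_ac simp flip: mult.assoc)
    qed
    finally show ?thesis .
  qed
  have len: "ennreal (norm y powr - ?N) * F y * (\<integral>\<^sup>+t. indicator {t. 1 < exp t * norm y \<and> exp t * norm y < exp 1} t \<partial>lborel)
      = F y * ennreal (norm y powr - ?N)" for y :: 'a
  proof (cases "y = 0")
    case False
    have "{t. 1 < exp t * norm y \<and> exp t * norm y < exp 1} = {- ln (norm y) <..< 1 - ln (norm y)}"
    proof (rule set_eqI)
      fix t
      have "1 < exp t * norm y \<longleftrightarrow> - ln (norm y) < t"
        using False by (subst ln_less_cancel_iff[symmetric]) (auto simp: ln_mult)
      moreover have "exp t * norm y < exp 1 \<longleftrightarrow> t < 1 - ln (norm y)"
        using False by (subst ln_less_cancel_iff[symmetric]) (auto simp: ln_mult)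
      ultimately show "t \<in> {t. 1 < exp t * norm y \<and> exp t * norm y < exp 1} \<longleftrightarrow> t \<in> {- ln (norm y) <..< 1 - ln (norm y)}"
        by simp
    qed
    then show ?thesis by (simp add: mult.commute)
  qed simp
  have "(\<integral>\<^sup>+x. ang x * (\<integral>\<^sup>+t. F (ray R x t) \<partial>lborel) \<partial>lborel) = (\<integral>\<^sup>+x. (\<integral>\<^sup>+t. ang x * F (exp (- t) *\<^sub>R x) \<partial>lborel) \<partial>lborel)"
    by (simp only: shift)
  also have "\<dots> = (\<integral>\<^sup>+t. (\<integral>\<^sup>+x. ang x * F (exp (- t) *\<^sub>R x) \<partial>lborel) \<partial>lborel)"
    by (rule lborel_pair.Fubini') measurable
  also have "\<dots> = (\<integral>\<^sup>+t. (\<integral>\<^sup>+y. ennreal (norm y powr - ?N) * F y * indicator {t. 1 < exp t * norm y \<and> exp t * norm y < exp 1} t \<partial>lborel) \<partial>lborel)"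
    by (simp only: inner)
  also have "\<dots> = (\<integral>\<^sup>+y. (\<integral>\<^sup>+t. ennreal (norm y powr - ?N) * F y * indicator {t. 1 < exp t * norm y \<and> exp t * norm y < exp 1} t \<partial>lborel) \<partial>lborel)"
    by (rule lborel_pair.Fubini') measurable
  also have "\<dots> = (\<integral>\<^sup>+y. F y * ennreal (norm y powr - ?N) \<partial>lborel)"
    by (subst nn_integral_cmult) (auto simp only: len, measurable)
  finally show ?thesis ..
qed

text \<open>The area of the unit sphere inside the space itself. It must not be confused with
  \<open>sphere_area\<close> at the same dimension, which is the sphere of one dimension
  more.\<close>

definition ang_mass :: "'a::euclidean_space itself \<Rightarrow> real" where
  "ang_mass _ = real DIM('a) * unit_ball_vol (real DIM('a))"

lemma ang_mass_pos: "ang_mass TYPE('a::euclidean_space) > 0"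
  by (simp add: ang_mass_def)

text \<open>The mass of \<open>ang\<close> is left unevaluated because this formula is what
  evaluates it in the next lemma.\<close>

lemma polar_radial':
  assumes [measurable]: "G \<in> borel_measurable borel" and R: "R > 0"
  shows "(\<integral>\<^sup>+y. G (norm y) * ennreal (norm y powr - real DIM('a)) \<partial>(lborel :: 'a::euclidean_space measure)) =
    (\<integral>\<^sup>+x. ang x \<partial>(lborel :: 'a measure)) * (\<integral>\<^sup>+t. G (R * exp (- t)) \<partial>lborel)"
proof -
  have "(\<integral>\<^sup>+y. G (norm y) * ennreal (norm y powr - real DIM('a)) \<partial>(lborel :: 'a measure)) =
     (\<integral>\<^sup>+x. ang x * (\<integral>\<^sup>+t. G (norm (ray R x t)) \<partial>lborel) \<partial>(lborel :: 'a measure))"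
    by (rule polar) (use R in auto)
  also have "\<dots> = (\<integral>\<^sup>+x. ang x * (\<integral>\<^sup>+t. G (R * exp (- t)) \<partial>lborel) \<partial>(lborel :: 'a measure))"
  proof (rule nn_integral_cong)
    fix x :: 'a
    show "ang x * (\<integral>\<^sup>+t. G (norm (ray R x t)) \<partial>lborel) = ang x * (\<integral>\<^sup>+t. G (R * exp (- t)) \<partial>lborel)"
      by (cases "x = 0") (simp_all add: norm_ray[OF R] ang_def)
  qed
  finally show ?thesis by (simp add: nn_integral_multc)
qed

text \<open>The previous formula is tested with the indicator of the unit ball, multiplied by a
  power of \<open>r\<close> that cancels the weight. One side is the volume of the ball, the other
  the unknown mass divided by the dimension.\<close>

lemma nn_integral_ang: "(\<integral>\<^sup>+x. ang x \<partial>(lborel :: 'a::euclidean_space measure)) = ennreal (ang_mass TYPE('a))"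
proof -
  let ?N = "real DIM('a)" and ?A = "\<integral>\<^sup>+x. ang x \<partial>(lborel :: 'a measure)"
  have N: "?N > 0" by simp
  let ?G = "\<lambda>r::real. ennreal (r powr ?N) * indicator {..1} r"
  have "(\<integral>\<^sup>+t. ?G (1 * exp (- t)) \<partial>lborel) = (\<integral>\<^sup>+t. ennreal (exp (- ?N * t)) * indicator {0..} t \<partial>lborel)"
    by (intro nn_integral_cong) (auto simp: indicator_def powr_def)
  also have "\<dots> = ennreal (0 - (- exp (- ?N * 0) / ?N))"
  proof (rule nn_integral_FTC_atLeast)
    show "((\<lambda>x. - exp (- ?N * x) / ?N) has_real_derivative exp (- ?N * x)) (at x)" for x
      by (auto intro!: derivative_eq_intros)
    have "((\<lambda>x. - exp (- (?N * x)) / ?N) \<longlongrightarrow> - 0 / ?N) at_top"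
      by (intro tendsto_intros filterlim_compose[OF exp_at_bot] filterlim_uminus_at_bot_at_top[THEN filterlim_compose]
          filterlim_tendsto_pos_mult_at_top[OF tendsto_const N filterlim_ident]) auto
    then show "((\<lambda>x. - exp (- ?N * x) / ?N) \<longlongrightarrow> 0) at_top" by simp
  qed auto
  finally have 1: "(\<integral>\<^sup>+t. ?G (1 * exp (- t)) \<partial>lborel) = ennreal (1 / ?N)" by simp
  have "(\<integral>\<^sup>+y. ?G (norm y) * ennreal (norm y powr - ?N) \<partial>(lborel :: 'a measure)) =
      (\<integral>\<^sup>+y. indicator (cball 0 1) y \<partial>(lborel :: 'a measure))"
  proof (rule nn_integral_cong_AE)
    have "AE y in (lborel :: 'a measure). y \<noteq> 0" by (rule AE_lborel_singleton)
    then show "AE y in lborel. ?G (norm y) * ennreal (norm y powr - ?N) = indicator (cball (0::'a) 1) y"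
    proof eventually_elim
      case (elim y)
      then show ?case
        by (auto simp: indicator_def powr_minus ennreal_mult[symmetric])
    qed
  qed
  also have "\<dots> = ennreal (unit_ball_vol ?N)" by (simp add: emeasure_cball)
  finally have "?A * ennreal (1 / ?N) = ennreal (unit_ball_vol ?N)"
    using polar_radial'[of ?G 1, where 'a='a] 1 by simp
  then have "?A * (ennreal (1 / ?N) * ennreal ?N) = ennreal (unit_ball_vol ?N) * ennreal ?N"
    by (simp only: mult.assoc[symmetric])
  then show ?thesis
    by (simp add: ang_mass_def mult.commute flip: ennreal_mult')
qed

lemma polar_radial:
  assumes [measurable]: "G \<in> borel_measurable borel" and R: "R > 0"
  shows "(\<integral>\<^sup>+y. G (norm y) * ennreal (norm y powr - real DIM('a)) \<partial>(lborel :: 'a::euclidean_space measure)) =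
    ennreal (ang_mass TYPE('a)) * (\<integral>\<^sup>+t. G (R * exp (- t)) \<partial>lborel)"
  using polar_radial'[OF assms, where 'a='a] unfolding nn_integral_ang .

text \<open>By \<open>polar\<close> the indicator of a Borel null set has integral 0, so almost
  every ray meets the set in a null set of parameters. The alternative \<open>ang x = 0\<close>
  excuses the points outside the annulus.\<close>

lemma AE_ray:
  fixes P :: "'a::euclidean_space \<Rightarrow> bool"
  assumes "AE y in lborel. P y" and R: "R > 0"
  shows "AE x in lborel. ang x = 0 \<or> (AE t in lborel. P (ray R x t))"
proof -
  from assms(1) obtain Z where Z': "{y \<in> space lborel. \<not> P y} \<subseteq> Z" "emeasure lborel Z = 0" "Z \<in> sets lborel"
    by (rule AE_E)
  then have Z: "{y. \<not> P y} \<subseteq> Z" "Z \<in> null_sets lborel"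
    by (auto intro: null_setsI)
  then have [measurable]: "Z \<in> sets borel" by auto
  have "(\<integral>\<^sup>+x. ang x * (\<integral>\<^sup>+t. indicator Z (ray R x t) \<partial>lborel) \<partial>lborel) =
    (\<integral>\<^sup>+y. indicator Z y * ennreal (norm y powr - real DIM('a)) \<partial>lborel)"
    by (rule polar[symmetric]) (use R in auto)
  also have "\<dots> = (\<integral>\<^sup>+y. 0 \<partial>(lborel::'a measure))"
    by (rule nn_integral_cong_AE) (use AE_not_in[OF Z(2)] in \<open>auto elim!: eventually_mono simp: indicator_def\<close>)
  finally have "(\<integral>\<^sup>+x. ang x * (\<integral>\<^sup>+t. indicator Z (ray R x t) \<partial>lborel) \<partial>lborel) = 0"
    by simp
  then have "AE x in lborel. ang x * (\<integral>\<^sup>+t. indicator Z (ray R x t) \<partial>lborel) = 0"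
    by (subst (asm) nn_integral_0_iff_AE) auto
  then show ?thesis
  proof eventually_elim
    case (elim x)
    show ?case
    proof (cases "ang x = 0")
      case False
      with elim have "(\<integral>\<^sup>+t. indicator Z (ray R x t) \<partial>lborel) = 0" by simp
      then have "AE t in lborel. (indicator Z (ray R x t) :: ennreal) = 0"
        by (subst (asm) nn_integral_0_iff_AE) auto
      then have "AE t in lborel. P (ray R x t)"
        by (rule eventually_mono) (use Z(1) in \<open>auto simp: indicator_def\<close>)
      then show ?thesis ..
    qed simp
  qed
qed

section \<open>Bliss' inequality with its sharp constant\<close>

text \<open>The factor of \<open>k'\<close> in the cross term that AM-GM produces. The
  \<open>max 0\<close> extends it continuously beyond modulus 1, where \<open>k\<close> never
  goes.\<close>

definition bliss_dens :: "real \<Rightarrow> real \<Rightarrow> real" where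
  "bliss_dens q u = \<bar>u\<bar> * sqrt (max 0 (1 - \<bar>u\<bar> powr (2 * q)))"

text \<open>Only differences of its values matter. The base point -2 lies to the left of -1, so that
  both endpoints of \<open>[-1, 1]\<close> have a two-sided derivative.\<close>

definition bliss_prim :: "real \<Rightarrow> real \<Rightarrow> real" where
  "bliss_prim q u = integral {-2..u} (bliss_dens q)"

text \<open>The gain while \<open>k\<close> moves from 0 to its maximum 1. The return to 0 brings
  the same amount, hence the factor 2 wherever it occurs.\<close>

definition bliss_half :: "real \<Rightarrow> real" where
  "bliss_half q = bliss_prim q 1 - bliss_prim q 0"

text \<open>The minimum over \<open>M > 0\<close> of \<open>M powr (- 2 * q) / 4 + 2 * bliss_half q * M\<^sup>2\<close>.\<close>

definition bliss_const :: "real \<Rightarrow> real" where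
  "bliss_const q = (q + 1) * (1/4) powr (1 / (q + 1)) * (2 * bliss_half q / q) powr (q / (q + 1))"

lemma bliss_dens_cont: "q > 0 \<Longrightarrow> continuous_on S (bliss_dens q)"
  unfolding bliss_dens_def by (intro continuous_intros continuous_on_powr') auto

lemma bliss_dens_nonneg: "0 \<le> bliss_dens q u"
  by (simp add: bliss_dens_def)

lemma bliss_prim_deriv:
  assumes "q > 0" "\<bar>u\<bar> \<le> 1"
  shows "(bliss_prim q has_real_derivative bliss_dens q u) (at u)"
proof -
  have "((\<lambda>u. integral {-2..u} (bliss_dens q)) has_real_derivative bliss_dens q u) (at u within {-2..2})"
    by (rule integral_has_real_derivative) (use assms bliss_dens_cont in auto)
  moreover have "at u within {-2..2} = at u"
    by (rule at_within_interior) (use assms in \<open>auto simp: abs_le_iff\<close>)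
  ultimately show ?thesis unfolding bliss_prim_def by metis
qed

lemma bliss_half_eq: "q > 0 \<Longrightarrow> bliss_half q = integral {0..1} (bliss_dens q)"
  unfolding bliss_half_def bliss_prim_def
  using Henstock_Kurzweil_Integration.integral_combine[of "-2" 0 1 "bliss_dens q"]
  by (simp add: integrable_continuous_real bliss_dens_cont)

lemma bliss_half_pos: "q > 0 \<Longrightarrow> bliss_half q > 0"
proof -
  assume q: "q > 0"
  have "integral {0..1} (bliss_dens q) \<noteq> 0"
  proof
    assume "integral {0..1} (bliss_dens q) = 0"
    then have "bliss_dens q (1/2) = 0"
      using integral_eq_0_iff[of 0 1 "bliss_dens q"] bliss_dens_cont[OF q] bliss_dens_nonneg by auto
    moreover have "(1/2::real) powr (2 * q) < 1"
      using q by (simp add: powr01_less_one)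
    ultimately show False by (simp add: bliss_dens_def max_def split: if_splits)
  qed
  moreover have "integral {0..1} (bliss_dens q) \<ge> 0"
    by (rule integral_nonneg) (auto simp: integrable_continuous_real bliss_dens_cont q bliss_dens_nonneg)
  ultimately show ?thesis by (simp add: bliss_half_eq q)
qed

lemma bliss_const_pos: "q > 0 \<Longrightarrow> bliss_const q > 0"
  using bliss_half_pos[of q] by (simp add: bliss_const_def)

text \<open>Young's inequality with weights \<open>1 / (q + 1)\<close> and
  \<open>q / (q + 1)\<close>, where \<open>x\<close> and \<open>y\<close> are chosen so that the
  weighted summands are the two terms on the right. With these weights the powers of
  \<open>M\<close> in the product have exponents adding up to 0, so the bound is uniform in
  \<open>M\<close>.\<close>

lemma bliss_young:
  assumes q: "q > 0" and M: "M > 0" and J: "J \<ge> 0"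
  shows "bliss_const q * J powr (1 / (q + 1)) \<le> J * M powr (- 2 * q) / 4 + 2 * bliss_half q * M\<^sup>2"
proof (cases "J = 0")
  case True
  then show ?thesis using bliss_half_pos[OF q] by simp
next
  case False
  define c where "c = bliss_half q"
  have c: "c > 0" using bliss_half_pos[OF q] by (simp add: c_def)
  define al where "al = 1 / (q + 1)"
  define be where "be = q / (q + 1)"
  define x where "x = (q + 1) * (1/4) * J * M powr (- 2 * q)"
  define y where "y = (q + 1) * (2 * c / q) * M\<^sup>2"
  have xy: "x > 0" "y > 0" using assms False c by (auto simp: x_def y_def)
  have ab: "al + be = 1" "al \<ge> 0" "be \<ge> 0" using q by (auto simp: al_def be_def field_simps)
  have M2: "(M\<^sup>2) powr be = M powr (2 * be)"
    using M by (simp add: powr_powr flip: powr_numeral)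
  have "x powr al * y powr be = ((q + 1) powr al * (q + 1) powr be) * (1/4) powr al * (2 * c / q) powr be
        * J powr al * (M powr (- 2 * q * al) * M powr (2 * be))"
    unfolding x_def y_def powr_mult powr_powr M2 by (simp add: mult_ac)
  also have "M powr (- 2 * q * al) * M powr (2 * be) = 1"
    using M by (simp add: powr_add[symmetric] al_def be_def)
  also have "(q + 1) powr al * (q + 1) powr be = q + 1"
    using q by (simp add: powr_add[symmetric] ab)
  finally have eq: "x powr al * y powr be = bliss_const q * J powr (1 / (q + 1))"
    by (simp add: bliss_const_def al_def be_def c_def)
  have "x powr al * y powr be \<le> al * x + be * y"
    by (rule Youngs_inequality_0) (use ab xy in auto)
  also have "al * x = J * M powr (- 2 * q) / 4"
    using q by (simp add: al_def x_def)
  also have "be * y = 2 * c * M\<^sup>2"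
    using q by (simp add: be_def y_def)
  finally show ?thesis unfolding eq c_def .
qed

text \<open>Here \<open>g t / sqrt t\<close> has maximal modulus 1, attained at \<open>t0\<close>.
  The rise from \<open>a\<close> to \<open>t0\<close> yields
  \<open>bliss_prim q 1 - bliss_prim q 0\<close>, the fall from \<open>t0\<close> to
  \<open>b\<close> yields \<open>bliss_prim q 1 - bliss_prim q (g b / sqrt b)\<close>.\<close>

lemma bliss_normalized:
  fixes g g' :: "real \<Rightarrow> real"
  assumes q: "q > 0" and a: "a > 0" and t0: "a \<le> t0" "t0 \<le> b"
    and der: "\<And>t. t > 0 \<Longrightarrow> (g has_real_derivative g' t) (at t)"
    and cont: "continuous_on {0<..} g'"
    and ga: "g a = 0" and gt0: "g t0 = sqrt t0"
    and le: "\<And>t. t > 0 \<Longrightarrow> \<bar>g t\<bar> \<le> sqrt t"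
  shows "integral {a..b} (\<lambda>t. \<bar>g t\<bar> powr (2 * q + 2) * t powr - (q + 2)) / 4
      + 2 * bliss_prim q 1 - bliss_prim q 0 - bliss_prim q (g b / sqrt b)
    \<le> integral {a..b} (\<lambda>t. (g' t)\<^sup>2)"
proof -
  define k where "k t = g t / sqrt t" for t
  define k' where "k' t = g' t / sqrt t - g t / (2 * t * sqrt t)" for t
  define W where "W t = \<bar>g t\<bar> powr (2 * q + 2) * t powr - (q + 2)" for t
  have k1: "\<bar>k t\<bar> \<le> 1" if "t > 0" for t
    using le[OF that] that by (simp add: k_def)
  have kd: "(k has_real_derivative k' t) (at t)" if "t > 0" for t
    unfolding k_def k'_def
    using that by (auto intro!: derivative_eq_intros der simp: field_simps power2_eq_square)
  have contg: "continuous_on {0<..} g"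
    by (intro continuous_at_imp_continuous_on ballI DERIV_isCont[OF der]) auto
  have sub: "continuous_on {x..y} f" if "x > 0" "continuous_on {0<..} f" for x y and f :: "real \<Rightarrow> real"
    by (rule continuous_on_subset[OF that(2)]) (use that in auto)
  have contW: "continuous_on {0<..} W" unfolding W_def
    using q by (intro continuous_intros continuous_on_powr' contg) auto
  have contg2: "continuous_on {0<..} (\<lambda>t. (g' t)\<^sup>2)"
    by (intro continuous_intros cont)
  \<comment> \<open>The sign \<open>s\<close> is \<open>1\<close> up to the maximum \<open>t0\<close> of \<open>k\<close> and \<open>-1\<close> beyond it.\<close>
  have pt: "W t / 4 + k t * k' t + s * (bliss_dens q (k t) * k' t) \<le> (g' t)\<^sup>2"
    if t: "t > 0" and s: "\<bar>s\<bar> = 1" for s t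
  proof -
    define r where "r = sqrt t"
    have r: "r > 0" "t = r\<^sup>2" using t by (auto simp: r_def)
    have g't: "g' t = r * k' t + k t / (2 * r)"
      using r(1) unfolding k_def k'_def r_def[symmetric] by (simp add: r(2) field_simps power2_eq_square)
    have "W t = (\<bar>k t\<bar> powr (2*q) * (k t)\<^sup>2) / t"
    proof (cases "g t = 0")
      case False
      have "\<bar>g t\<bar> = \<bar>k t\<bar> * t powr (1/2)"
        using t by (simp add: k_def powr_half_sqrt)
      then have "W t = \<bar>k t\<bar> powr (2*q+2) * (t powr (1/2 * (2*q+2)) * t powr - (q+2))"
        unfolding W_def by (simp add: powr_mult powr_powr mult.assoc)
      also have "t powr (1/2 * (2*q+2)) * t powr - (q+2) = 1 / t"
        using t unfolding powr_add[symmetric] by (simp add: powr_minus_divide field_simps)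
      also have "\<bar>k t\<bar> powr (2*q+2) = \<bar>k t\<bar> powr (2*q) * (k t)\<^sup>2"
        using False t by (simp add: powr_add)
      finally show ?thesis by simp
    qed (simp add: W_def k_def)
    moreover define z where "z = 1 - \<bar>k t\<bar> powr (2*q)"
    ultimately have W: "W t = (1 - z) * (k t)\<^sup>2 / r\<^sup>2" by (simp add: r(2))
    have z: "z \<ge> 0" unfolding z_def using powr_le1[of "2*q" "k t"] q k1[OF t]
      by (simp add: powr_le1)
    have d: "bliss_dens q (k t) = \<bar>k t\<bar> * sqrt z"
      using z unfolding bliss_dens_def z_def by (simp add: max_def)
    \<comment> \<open>This square is the AM-GM step. It vanishes exactly if
      \<open>2 * t * k' t = s * (\<bar>k t\<bar> * sqrt z)\<close>, the equation of the
      extremals.\<close>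
    have "(r * k' t - s * (\<bar>k t\<bar> * sqrt z) / (2 * r))\<^sup>2 \<ge> 0" by simp
    also have "(r * k' t - s * (\<bar>k t\<bar> * sqrt z) / (2 * r))\<^sup>2 =
       (r * k' t)\<^sup>2 - s * (\<bar>k t\<bar> * sqrt z) * k' t + s\<^sup>2 * ((\<bar>k t\<bar>)\<^sup>2 * (sqrt z)\<^sup>2) / (4 * r\<^sup>2)"
      using r(1) by (simp add: power2_eq_square field_simps)
    also have "s\<^sup>2 = 1" using s by (metis power2_abs one_power2)
    finally have *: "s * (\<bar>k t\<bar> * sqrt z) * k' t \<le> (r * k' t)\<^sup>2 + (k t)\<^sup>2 * z / (4 * r\<^sup>2)"
      using z by simp
    have "(g' t)\<^sup>2 = (r * k' t)\<^sup>2 + k t * k' t + (k t)\<^sup>2 / (4 * r\<^sup>2)"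
      using r(1) unfolding g't by (simp add: power2_eq_square field_simps)
    moreover have "W t / 4 + (k t)\<^sup>2 * z / (4 * r\<^sup>2) = (k t)\<^sup>2 / (4 * r\<^sup>2)"
      using r(1) unfolding W by (simp add: field_simps)
    ultimately show ?thesis using * unfolding d by (simp add: algebra_simps)
  qed
  have key: "integral {x..y} W / 4 + ((k y)\<^sup>2 / 2 + s * bliss_prim q (k y)) - ((k x)\<^sup>2 / 2 + s * bliss_prim q (k x))
      \<le> integral {x..y} (\<lambda>t. (g' t)\<^sup>2)" if xy: "x > 0" "x \<le> y" and s: "\<bar>s\<bar> = 1" for x y s
  proof -
    have F: "((\<lambda>t. k t * k' t + s * (bliss_dens q (k t) * k' t)) has_integral
        ((k y)\<^sup>2 / 2 + s * bliss_prim q (k y)) - ((k x)\<^sup>2 / 2 + s * bliss_prim q (k x))) {x..y}"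
    proof (rule fundamental_theorem_of_calculus[OF xy(2)])
      fix t assume "t \<in> {x..y}"
      then have t: "t > 0" using xy by auto
      have "((\<lambda>t. (k t)\<^sup>2 / 2 + s * bliss_prim q (k t)) has_real_derivative
         k t * k' t + s * (bliss_dens q (k t) * k' t)) (at t)"
        by (auto intro!: derivative_eq_intros kd t DERIV_chain2[OF bliss_prim_deriv[OF q k1[OF t]] kd[OF t]])
      then show "((\<lambda>t. (k t)\<^sup>2 / 2 + s * bliss_prim q (k t)) has_vector_derivative
         k t * k' t + s * (bliss_dens q (k t) * k' t)) (at t within {x..y})"
        by (auto simp: has_real_derivative_iff_has_vector_derivative[symmetric] intro: has_field_derivative_at_within)
    qed
    have Wi: "(W has_integral integral {x..y} W) {x..y}"
      by (intro integrable_integral integrable_continuous_real sub xy contW)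
    have gi: "((\<lambda>t. (g' t)\<^sup>2) has_integral integral {x..y} (\<lambda>t. (g' t)\<^sup>2)) {x..y}"
      by (intro integrable_integral integrable_continuous_real sub xy contg2)
    have "integral {x..y} W / 4 + (((k y)\<^sup>2 / 2 + s * bliss_prim q (k y)) - ((k x)\<^sup>2 / 2 + s * bliss_prim q (k x)))
       \<le> integral {x..y} (\<lambda>t. (g' t)\<^sup>2)"
      by (rule has_integral_le[OF has_integral_add[OF has_integral_divide[OF Wi, of 4] F] gi])
         (use pt[OF less_le_trans[OF xy(1)] s] in \<open>simp add: add.assoc\<close>)
    then show ?thesis by simp
  qed
  have comb: "integral {a..t0} f + integral {t0..b} f = integral {a..b} f" 
    if "continuous_on {0<..} f" for f :: "real \<Rightarrow> real"
    by (rule Henstock_Kurzweil_Integration.integral_combine)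
       (use t0 a that in \<open>auto intro!: integrable_continuous_real sub\<close>)
  have [simp]: "k a = 0" "k t0 = 1" using ga gt0 a t0 by (auto simp: k_def)
  have 1: "integral {a..t0} W / 4 + 1 / 2 + bliss_prim q 1 - bliss_prim q 0 \<le> integral {a..t0} (\<lambda>t. (g' t)\<^sup>2)"
    using key[of a t0 1] a t0 by simp
  have 2: "integral {t0..b} W / 4 + (k b)\<^sup>2 / 2 - bliss_prim q (k b) - 1/2 + bliss_prim q 1 
     \<le> integral {t0..b} (\<lambda>t. (g' t)\<^sup>2)"
    using key[of t0 b "-1"] a t0 by simp
  \<comment> \<open>The values 1/2 of \<open>(k t)\<^sup>2 / 2\<close> at \<open>t0\<close> cancel
    between the two pieces; the same term at \<open>b\<close> is nonnegative and is dropped.\<close>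
  have 3: "(k b)\<^sup>2 \<ge> 0" by simp
  show ?thesis
    unfolding W_def[symmetric] k_def[symmetric]
    using 1 2 3 comb[OF contW] comb[OF contg2] by linarith
qed

text \<open>A test function along a ray vanishes for small \<open>t\<close> and is bounded. The
  former lets all integrals start at \<open>d\<close>, the latter sends
  \<open>\<bar>f t\<bar> / sqrt t\<close> to 0 at infinity, so that it attains its maximum and the
  boundary term at \<open>b\<close> disappears in the limit.\<close>

lemma bliss_inequality:
  fixes f f' :: "real \<Rightarrow> real"
  assumes q: "q > 0" and d: "d > 0" and L: "L \<ge> 0"
    and der: "\<And>t. t > 0 \<Longrightarrow> (f has_real_derivative f' t) (at t)"
    and cont: "continuous_on {0<..} f'"
    and f0: "\<And>t. 0 < t \<Longrightarrow> t \<le> d \<Longrightarrow> f t = 0" and C: "\<And>t. t > 0 \<Longrightarrow> \<bar>f t\<bar> \<le> C"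
    and fL: "(\<integral>\<^sup>+t\<in>{0<..}. ennreal ((f' t)\<^sup>2) \<partial>lborel) \<le> ennreal L"
  shows "(\<integral>\<^sup>+t\<in>{0<..}. ennreal (\<bar>f t\<bar> powr (2 * q + 2) * t powr - (q + 2)) \<partial>lborel)
    \<le> ennreal ((L / bliss_const q) powr (q + 1))"
proof (cases "\<forall>t>0. f t = 0")
  case True
  then have "(\<integral>\<^sup>+t\<in>{0<..}. ennreal (\<bar>f t\<bar> powr (2 * q + 2) * t powr - (q + 2)) \<partial>lborel) = (\<integral>\<^sup>+t. 0 \<partial>(lborel::real measure))"
    by (intro nn_integral_cong) (auto simp: indicator_def)
  then show ?thesis by simp
next
  case False
  then obtain t1 where t1: "t1 > 0" "f t1 \<noteq> 0" by auto
  have C0: "C \<ge> 0" using C[OF t1(1)] by linarith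
  define h where "h t = \<bar>f t\<bar> / sqrt t" for t
  define W where "W t = \<bar>f t\<bar> powr (2 * q + 2) * t powr - (q + 2)" for t
  have contf: "continuous_on {0<..} f"
    by (intro continuous_at_imp_continuous_on ballI DERIV_isCont[OF der]) auto
  have h1: "h t1 > 0" using t1 by (simp add: h_def)
  have h_lim: "((\<lambda>t. C / sqrt t) \<longlongrightarrow> 0) at_top"
    by (intro real_tendsto_divide_at_top[OF tendsto_const] sqrt_at_top)
  have "eventually (\<lambda>t. C / sqrt t < h t1) at_top"
    using order_tendstoD(2)[OF h_lim h1] .
  then obtain T where T: "\<And>t. t \<ge> T \<Longrightarrow> C / sqrt t < h t1"
    by (auto simp: eventually_at_top_linorder)
  \<comment> \<open>Beyond \<open>T\<close> the quotient \<open>h\<close> stays below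
    \<open>h t1\<close>, so its maximum on the compact interval up to \<open>T'\<close> is the
    maximum over all \<open>t > 0\<close>.\<close>
  define T' where "T' = max T t1"
  have hC: "h t \<le> C / sqrt t" if "t > 0" for t
    using C[OF that] that by (simp add: h_def divide_right_mono)
  have hc: "continuous_on {d..T'} h" unfolding h_def using d
    by (intro continuous_intros continuous_on_subset[OF contf]) auto
  have dt1: "d < t1" using f0[of t1] t1 by force
  obtain t0 where t0: "t0 \<in> {d..T'}" "\<And>t. t \<in> {d..T'} \<Longrightarrow> h t \<le> h t0"
    using continuous_attains_sup[OF compact_Icc _ hc] dt1 by (force simp: T'_def)
  have ht0: "h t \<le> h t0" if "t > 0" for t
  proof -
    consider "t \<le> d" | "t \<in> {d..T'}" | "t \<ge> T'" by force
    then show ?thesis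
    proof cases
      case 1 then have "h t = 0" using f0[of t] that by (simp add: h_def)
      moreover have "h t0 \<ge> 0" using t0 d by (simp add: h_def)
      ultimately show ?thesis by simp
    next
      case 3
      then have "h t < h t1" using T[of t] hC[OF that] by (simp add: T'_def)
      also have "h t1 \<le> h t0" using dt1 by (intro t0) (auto simp: T'_def)
      finally show ?thesis by simp
    qed (use t0 in auto)
  qed
  \<comment> \<open>Taken with the sign of \<open>f t0\<close>, so that \<open>f / M\<close> touches
    \<open>sqrt t\<close> from below at \<open>t0\<close> and not its negative.\<close>
  define M where "M = f t0 / sqrt t0"
  have t0p: "t0 > 0" using t0 d by auto
  have hM: "h t0 = \<bar>M\<bar>" using t0p by (simp add: h_def M_def)
  have M: "\<bar>M\<bar> > 0" using ht0[OF t1(1)] h1 hM by linarith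
  define g where "g t = f t / M" for t
  define g' where "g' t = f' t / M" for t
  define J where "J b = integral {d..b} W" for b
  \<comment> \<open>The loss from stopping at \<open>b\<close> with \<open>k b\<close> not yet back
    at 0.\<close>
  define E where "E b = bliss_prim q (g b / sqrt b) - bliss_prim q 0" for b
  have gd: "(g has_real_derivative g' t) (at t)" if "t > 0" for t
    unfolding g_def g'_def using der[OF that] by (rule DERIV_cdivide)
  have contg': "continuous_on {0<..} g'" unfolding g'_def using M by (intro continuous_intros cont) auto
  have gle: "\<bar>g t\<bar> \<le> sqrt t" if "t > 0" for t
    using ht0[OF that] that M unfolding hM by (simp add: h_def g_def field_simps)
  have contW: "continuous_on {d..b} W" for b unfolding W_def
    using q d by (intro continuous_intros continuous_on_powr' continuous_on_subset[OF contf]) auto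
  have contf2: "continuous_on {d..b} (\<lambda>t. (f' t)\<^sup>2)" for b
    using d by (intro continuous_intros continuous_on_subset[OF cont]) auto
  have fLb: "integral {d..b} (\<lambda>t. (f' t)\<^sup>2) \<le> L" for b
  proof -
    have "(\<integral>\<^sup>+t. ennreal ((f' t)\<^sup>2) * indicator {d..b} t \<partial>lborel) = ennreal (integral {d..b} (\<lambda>t. (f' t)\<^sup>2))"
      by (rule nn_integral_has_integral_lebesgue') (auto intro!: integrable_integral integrable_continuous_real contf2)
    moreover have "(\<integral>\<^sup>+t. ennreal ((f' t)\<^sup>2) * indicator {d..b} t \<partial>lborel) \<le> (\<integral>\<^sup>+t\<in>{0<..}. ennreal ((f' t)\<^sup>2) \<partial>lborel)"
      using d by (intro nn_integral_mono) (auto simp: indicator_def)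
    ultimately have "ennreal (integral {d..b} (\<lambda>t. (f' t)\<^sup>2)) \<le> ennreal L" using fL by (metis order_trans)
    then show ?thesis using L by (simp add: ennreal_le_iff)
  qed
  have J0: "J b \<ge> 0" for b
    unfolding J_def by (rule integral_nonneg) (auto intro!: integrable_continuous_real contW simp: W_def)
  \<comment> \<open>The normalised inequality times \<open>M\<^sup>2\<close>: the weighted integral
    scales by \<open>\<bar>M\<bar> powr - (2 * q + 2)\<close>, which leaves the power
    \<open>- 2 * q\<close> that \<open>bliss_young\<close> expects.\<close>
  have main: "bliss_const q * J b powr (1 / (q + 1)) \<le> L + M\<^sup>2 * E b" if b: "b \<ge> t0" for b
  proof -
    have W_g: "\<bar>g t\<bar> powr (2 * q + 2) * t powr - (q + 2) = W t * \<bar>M\<bar> powr - (2 * q + 2)" for t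
    proof -
      have "\<bar>g t\<bar> powr (2 * q + 2) = \<bar>f t\<bar> powr (2 * q + 2) / \<bar>M\<bar> powr (2 * q + 2)"
        by (simp add: g_def powr_divide)
      moreover have "\<bar>M\<bar> powr - (2 * q + 2) = 1 / \<bar>M\<bar> powr (2 * q + 2)"
        by (rule powr_minus_divide)
      ultimately show ?thesis unfolding W_def by (simp only: times_divide_eq_left times_divide_eq_right mult_1_right)
    qed
    have "integral {d..b} (\<lambda>t. \<bar>g t\<bar> powr (2 * q + 2) * t powr - (q + 2)) / 4
      + 2 * bliss_prim q 1 - bliss_prim q 0 - bliss_prim q (g b / sqrt b) \<le> integral {d..b} (\<lambda>t. (g' t)\<^sup>2)"
      by (rule bliss_normalized[OF q d _ b gd contg'])
         (use t0 f0[of d] d M gle in \<open>auto simp: g_def M_def\<close>)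
    also have "integral {d..b} (\<lambda>t. (g' t)\<^sup>2) = integral {d..b} (\<lambda>t. (f' t)\<^sup>2) / M\<^sup>2"
      by (simp add: g'_def power_divide)
    finally have "J b * \<bar>M\<bar> powr - (2 * q + 2) / 4 + 2 * bliss_half q - E b \<le> integral {d..b} (\<lambda>t. (f' t)\<^sup>2) / M\<^sup>2"
      unfolding W_g J_def E_def bliss_half_def by simp
    also have "\<dots> \<le> L / M\<^sup>2" by (intro divide_right_mono fLb) auto
    finally have "(J b * \<bar>M\<bar> powr - (2 * q + 2) / 4 + 2 * bliss_half q - E b) * M\<^sup>2 \<le> L"
      using M by (simp add: pos_le_divide_eq)
    moreover have "\<bar>M\<bar> powr - (2 * q + 2) * M\<^sup>2 = \<bar>M\<bar> powr (- 2 * q)"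
    proof -
      have "M\<^sup>2 = \<bar>M\<bar> powr 2" using M by simp
      then show ?thesis by (simp only: powr_add[symmetric]) simp
    qed
    ultimately have "J b * \<bar>M\<bar> powr (- 2 * q) / 4 + 2 * bliss_half q * \<bar>M\<bar>\<^sup>2 \<le> L + M\<^sup>2 * E b"
      by (simp add: algebra_simps)
    with bliss_young[OF q M J0[of b]] show ?thesis by linarith
  qed
  have Jmono: "J b \<le> J b'" if "b \<le> b'" for b b'
    unfolding J_def by (rule integral_subset_le) (use that in \<open>auto intro!: integrable_continuous_real contW simp: W_def\<close>)
  have E_lim: "((\<lambda>b. L + M\<^sup>2 * E b) \<longlongrightarrow> L + M\<^sup>2 * 0) at_top"
  proof -
    have "((\<lambda>b. g b / sqrt b) \<longlongrightarrow> 0) at_top"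
    proof (rule Lim_null_comparison)
      show "eventually (\<lambda>b. norm (g b / sqrt b) \<le> C / \<bar>M\<bar> / sqrt b) at_top"
        using eventually_gt_at_top[of 0]
      proof eventually_elim
        case (elim b)
        then show ?case using C[OF elim] M by (simp add: g_def abs_mult field_simps)
      qed
      show "((\<lambda>b. C / \<bar>M\<bar> / sqrt b) \<longlongrightarrow> 0) at_top"
        by (intro real_tendsto_divide_at_top[OF tendsto_const] sqrt_at_top)
    qed
    moreover have "isCont (bliss_prim q) 0" using bliss_prim_deriv[OF q, of 0] DERIV_isCont by auto
    ultimately have "((\<lambda>b. bliss_prim q (g b / sqrt b)) \<longlongrightarrow> bliss_prim q 0) at_top"
      by (rule isCont_tendsto_compose[rotated])
    then have "((\<lambda>b. E b) \<longlongrightarrow> bliss_prim q 0 - bliss_prim q 0) at_top"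
      unfolding E_def by (intro tendsto_intros)
    then show ?thesis by (intro tendsto_intros) simp
  qed
  have Jle: "J b \<le> (L / bliss_const q) powr (q + 1)" for b
  proof -
    have "bliss_const q * J b powr (1 / (q + 1)) \<le> L + M\<^sup>2 * 0"
    proof (rule tendsto_lowerbound[OF E_lim])
      show "eventually (\<lambda>b'. bliss_const q * J b powr (1 / (q + 1)) \<le> L + M\<^sup>2 * E b') at_top"
        using eventually_ge_at_top[of "max b t0"]
      proof eventually_elim
        case (elim b')
        have "J b powr (1 / (q + 1)) \<le> J b' powr (1 / (q + 1))"
          using q J0 Jmono[of b b'] elim by (intro powr_mono2) auto
        then have "bliss_const q * J b powr (1 / (q + 1)) \<le> bliss_const q * J b' powr (1 / (q + 1))"
          using bliss_const_pos[OF q] by simp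
        also have "\<dots> \<le> L + M\<^sup>2 * E b'" using main elim by simp
        finally show ?case .
      qed
    qed simp
    then have "J b powr (1 / (q + 1)) \<le> L / bliss_const q"
      using bliss_const_pos[OF q] by (simp add: field_simps)
    then have "(J b powr (1 / (q + 1))) powr (q + 1) \<le> (L / bliss_const q) powr (q + 1)"
      using q by (intro powr_mono2) auto
    then show ?thesis using q J0[of b] by (simp add: powr_powr)
  qed
  \<comment> \<open>\<open>f\<close> is controlled for positive \<open>t\<close> only, so
    measurability and the bound are taken from the compact intervals \<open>{d..n}\<close> and
    passed on by monotone convergence.\<close>
  have "(\<integral>\<^sup>+t\<in>{0<..}. ennreal (W t) \<partial>lborel) = (\<integral>\<^sup>+t. (SUP n. ennreal (W t) * indicator {d..real n} t) \<partial>lborel)"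
  proof (rule nn_integral_cong)
    fix t :: real
    show "ennreal (W t) * indicator {0<..} t = (SUP n. ennreal (W t) * indicator {d..real n} t)"
    proof (cases "t \<ge> d")
      case True
      obtain n :: nat where n: "t \<le> real n" using real_arch_simple by blast
      show ?thesis
      proof (rule antisym)
        show "ennreal (W t) * indicator {0<..} t \<le> (SUP n. ennreal (W t) * indicator {d..real n} t)"
          by (rule SUP_upper2[of n]) (use True n in \<open>auto simp: indicator_def\<close>)
        show "(SUP n. ennreal (W t) * indicator {d..real n} t) \<le> ennreal (W t) * indicator {0<..} t"
          by (rule SUP_least) (use True d in \<open>auto simp: indicator_def\<close>)
      qed
    next
      case False
      then have "ennreal (W t) * indicator {0<..} t = 0"
        using f0[of t] by (auto simp: indicator_def W_def)
      moreover have "(\<lambda>n. ennreal (W t) * indicator {d..real n} t) = (\<lambda>_. 0)"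
        using False by (auto simp: indicator_def)
      ultimately show ?thesis by (simp only: SUP_const) simp
    qed
  qed
  also have "\<dots> = (SUP n. \<integral>\<^sup>+t. ennreal (W t) * indicator {d..real n} t \<partial>lborel)"
  proof (rule nn_integral_monotone_convergence_SUP)
    show "incseq (\<lambda>n t. ennreal (W t) * indicator {d..real n} t)"
      by (auto simp: incseq_def le_fun_def indicator_def)
    fix n
    have "(\<lambda>t. indicator {d..real n} t *\<^sub>R W t) \<in> borel_measurable borel"
      by (rule borel_measurable_continuous_on_indicator) (auto intro: contW)
    then have "(\<lambda>t. ennreal (indicator {d..real n} t *\<^sub>R W t)) \<in> borel_measurable lborel" by measurable
    moreover have "(\<lambda>t. ennreal (indicator {d..real n} t *\<^sub>R W t)) = (\<lambda>t. ennreal (W t) * indicator {d..real n} t)"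
      by (auto simp: indicator_def)
    ultimately show "(\<lambda>t. ennreal (W t) * indicator {d..real n} t) \<in> borel_measurable lborel" by simp
  qed
  also have "\<dots> \<le> ennreal ((L / bliss_const q) powr (q + 1))"
  proof (rule SUP_least)
    fix n
    have "(\<integral>\<^sup>+t. ennreal (W t) * indicator {d..real n} t \<partial>lborel) = ennreal (J (real n))"
      unfolding J_def
    proof (rule nn_integral_has_integral_lebesgue')
      show "(W has_integral integral {d..real n} W) {d..real n}"
        by (intro integrable_integral integrable_continuous_real contW)
    qed (simp add: W_def)
    also have "\<dots> \<le> ennreal ((L / bliss_const q) powr (q + 1))" by (intro ennreal_leI Jle)
    finally show "(\<integral>\<^sup>+t. ennreal (W t) * indicator {d..real n} t \<partial>lborel) \<le> ennreal ((L / bliss_const q) powr (q + 1))" .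
  qed
  finally show ?thesis unfolding W_def .
qed

section \<open>The weighted energy\<close>

lemma nn_integral_lebesgue_on:
  "S \<in> sets lebesgue \<Longrightarrow> (\<integral>\<^sup>+x. f x \<partial>lebesgue_on S) = (\<integral>\<^sup>+x\<in>S. f x \<partial>lborel)"
  by (subst nn_integral_restrict_space) (auto simp: nn_integral_completion)

definition wt :: "'a::euclidean_space \<Rightarrow> real" where
  "wt x = norm x powr - (real DIM('a) - 2)"

text \<open>An \<open>ennreal\<close> integral, because a divergent energy must not be read as 0, as
  the Bochner integral of \<open>HS_numerator\<close> would do.\<close>

definition energy :: "real \<Rightarrow> ('a::euclidean_space \<Rightarrow> 'a) \<Rightarrow> ennreal" where
  "energy R G = (\<integral>\<^sup>+x\<in>ball 0 R. ennreal (wt x * (norm (G x))\<^sup>2) \<partial>lborel)"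

lemma wt_measurable [measurable]: "wt \<in> borel_measurable borel"
  unfolding wt_def by measurable

lemma ball_measurable [measurable]: "ball (c::'a::euclidean_space) r \<in> sets borel"
  by simp

lemma wt_nonneg: "0 \<le> wt x"
  by (simp add: wt_def)

lemma wt_eq: "wt (x::'a::euclidean_space) = (norm x)\<^sup>2 * norm x powr - real DIM('a)"
proof (cases "x = 0")
  case False
  then have "(norm x)\<^sup>2 = norm x powr 2" by simp
  then show ?thesis unfolding wt_def by (simp only: powr_add[symmetric]) simp
qed (simp add: wt_def)

text \<open>In the variable \<open>t\<close> the weight becomes a multiple of
  \<open>exp (- 2 * t)\<close>, whatever the dimension, and this is integrable over the positive
  half line.\<close>

lemma nn_integral_wt_finite:
  assumes R: "R > 0"
  shows "(\<integral>\<^sup>+x\<in>ball (0::'a::euclidean_space) R. ennreal (wt x) \<partial>lborel) < \<infinity>"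
proof -
  let ?G = "\<lambda>r. ennreal (r\<^sup>2) * indicator {..<R} r"
  have "(\<integral>\<^sup>+x\<in>ball (0::'a) R. ennreal (wt x) \<partial>lborel) = (\<integral>\<^sup>+x. ?G (norm x) * ennreal (norm x powr - real DIM('a)) \<partial>(lborel::'a measure))"
    by (intro nn_integral_cong) (auto simp: indicator_def wt_eq ennreal_mult)
  also have "\<dots> = ennreal (ang_mass TYPE('a)) * (\<integral>\<^sup>+t. ?G (R * exp (- t)) \<partial>lborel)"
    by (rule polar_radial) (use R in auto)
  also have "(\<integral>\<^sup>+t. ?G (R * exp (- t)) \<partial>lborel) \<le> (\<integral>\<^sup>+t. ennreal (R\<^sup>2 * exp (- 2 * t)) * indicator {0..} t \<partial>lborel)"
    using R by (intro nn_integral_mono) (auto simp: indicator_def power_mult_distrib power2_eq_square mult_exp_exp intro!: ennreal_leI)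
  also have "\<dots> = ennreal (0 - (- R\<^sup>2 * exp (- 2 * 0) / 2))"
  proof (rule nn_integral_FTC_atLeast)
    show "((\<lambda>x. - R\<^sup>2 * exp (- 2 * x) / 2) has_real_derivative R\<^sup>2 * exp (- 2 * x)) (at x)" for x
      by (auto intro!: derivative_eq_intros)
    have "((\<lambda>x::real. exp (- (2 * x))) \<longlongrightarrow> 0) at_top"
      by (intro filterlim_compose[OF exp_at_bot] filterlim_uminus_at_bot_at_top[THEN filterlim_compose]
          filterlim_tendsto_pos_mult_at_top[OF tendsto_const _ filterlim_ident]) auto
    then have "((\<lambda>x. - R\<^sup>2 * exp (- (2 * x)) / 2) \<longlongrightarrow> - R\<^sup>2 * 0 / 2) at_top"
      by (intro tendsto_intros) auto
    then show "((\<lambda>x. - R\<^sup>2 * exp (- 2 * x) / 2) \<longlongrightarrow> 0) at_top" by simp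
  qed auto
  finally show ?thesis
    by (rule le_less_trans) (auto simp: ennreal_mult_less_top mult_left_mono)
qed

lemma energy_finite:
  fixes G :: "'a::euclidean_space \<Rightarrow> 'a"
  assumes R: "R > 0" and G: "\<And>x. norm (G x) \<le> B"
  shows "energy R G < \<infinity>"
proof -
  have "energy R G \<le> (\<integral>\<^sup>+x. ennreal (B\<^sup>2) * (ennreal (wt x) * indicator (ball 0 R) x) \<partial>(lborel::'a measure))"
    unfolding energy_def
  proof (rule nn_integral_mono)
    fix x :: 'a
    have "(norm (G x))\<^sup>2 \<le> B\<^sup>2" using G[of x] by (intro power_mono) auto
    then have "wt x * (norm (G x))\<^sup>2 \<le> B\<^sup>2 * wt x" using wt_nonneg[of x] by (simp add: mult.commute mult_left_mono)
    then have "ennreal (wt x * (norm (G x))\<^sup>2) \<le> ennreal (B\<^sup>2) * ennreal (wt x)"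
      using wt_nonneg[of x] by (simp add: ennreal_mult[symmetric] ennreal_leI)
    then show "ennreal (wt x * (norm (G x))\<^sup>2) * indicator (ball 0 R) x \<le> ennreal (B\<^sup>2) * (ennreal (wt x) * indicator (ball 0 R) x)"
      by (auto simp: indicator_def)
  qed
  also have "\<dots> = ennreal (B\<^sup>2) * (\<integral>\<^sup>+x. ennreal (wt x) * indicator (ball 0 R) x \<partial>(lborel::'a measure))"
    by (rule nn_integral_cmult) measurable
  also have "\<dots> < \<infinity>"
    using nn_integral_wt_finite[OF R, where 'a='a] by (auto simp: ennreal_mult_less_top)
  finally show ?thesis .
qed

lemma LINT_ball_eq:
  fixes f :: "'a::euclidean_space \<Rightarrow> real"
  assumes "f \<in> borel_measurable (lebesgue_on (ball 0 R))" "\<And>x. 0 \<le> f x"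
  shows "(LINT x|lebesgue_on (ball 0 R). f x) = enn2real (\<integral>\<^sup>+x\<in>ball 0 R. ennreal (f x) \<partial>lborel)"
  by (subst integral_eq_nn_integral) (use assms in \<open>auto simp: nn_integral_lebesgue_on\<close>)

lemma borel_measurable_lebesgue_on:
  "f \<in> borel_measurable borel \<Longrightarrow> f \<in> borel_measurable (lebesgue_on S)"
  by (intro measurable_restrict_space1 measurable_completion) simp

lemma W_norm_energy:
  fixes \<phi> :: "'a::euclidean_space \<Rightarrow> real"
  assumes R: "R > 0" and \<phi>: "\<phi> \<in> Cc_infty (ball 0 R)"
  shows "ennreal ((W_norm wt (ball 0 R) \<phi>)\<^sup>2) = energy R (grad \<phi>)"
proof -
  obtain K where K: "C1_cpt K \<phi>" by (rule Cc_infty_C1_cpt[OF \<phi>])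
  obtain B where B: "\<And>x. norm (grad \<phi> x) \<le> B" using C1_cpt_grad_bound[OF K] by blast
  have [measurable]: "grad \<phi> \<in> borel_measurable borel" by (rule C1_cpt_grad_measurable[OF K])
  have "(LINT x|lebesgue_on (ball 0 R). wt x * (norm (grad \<phi> x))\<^sup>2) = enn2real (energy R (grad \<phi>))"
    unfolding energy_def
    by (rule LINT_ball_eq) (auto intro!: borel_measurable_lebesgue_on mult_nonneg_nonneg wt_nonneg)
  then show ?thesis using energy_finite[OF R B] by (simp add: W_norm_def less_top)
qed

text \<open>A substitute for Minkowski's inequality without square roots. Letting \<open>e\<close>
  tend to 0 loses nothing in the constant of the first term, which the sharp bound requires.\<close>

lemma energy_triangle:
  fixes F G :: "'a::euclidean_space \<Rightarrow> 'a"
  assumes [measurable]: "F \<in> borel_measurable borel" "G \<in> borel_measurable borel" and e: "e > 0"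
  shows "energy R F \<le> ennreal (1 + e) * energy R G + ennreal (1 + 1 / e) * energy R (\<lambda>x. F x - G x)"
proof -
  have pt: "(norm (F x))\<^sup>2 \<le> (1 + e) * (norm (G x))\<^sup>2 + (1 + 1 / e) * (norm (F x - G x))\<^sup>2" for x
  proof -
    define a where "a = norm (G x)"
    define b where "b = norm (F x - G x)"
    have "norm (F x) \<le> a + b" unfolding a_def b_def by norm
    then have "(norm (F x))\<^sup>2 \<le> (a + b)\<^sup>2" by (intro power_mono) auto
    also have "(a + b)\<^sup>2 \<le> (1 + e) * a\<^sup>2 + (1 + 1 / e) * b\<^sup>2"
    proof -
      have "0 \<le> (e * a - b)\<^sup>2 / e" using e by simp
      also have "\<dots> = (1 + e) * a\<^sup>2 + (1 + 1 / e) * b\<^sup>2 - (a + b)\<^sup>2"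
        using e by (simp add: field_simps power2_eq_square)
      finally show ?thesis by simp
    qed
    finally show ?thesis unfolding a_def b_def .
  qed
  have "energy R F \<le> (\<integral>\<^sup>+x. ennreal (1 + e) * (ennreal (wt x * (norm (G x))\<^sup>2) * indicator (ball 0 R) x)
     + ennreal (1 + 1 / e) * (ennreal (wt x * (norm (F x - G x))\<^sup>2) * indicator (ball 0 R) x) \<partial>lborel)"
    unfolding energy_def
  proof (rule nn_integral_mono)
    fix x :: 'a
    have "wt x * (norm (F x))\<^sup>2 \<le> wt x * ((1 + e) * (norm (G x))\<^sup>2 + (1 + 1 / e) * (norm (F x - G x))\<^sup>2)"
      by (intro mult_left_mono pt wt_nonneg)
    also have "\<dots> = (1 + e) * (wt x * (norm (G x))\<^sup>2) + (1 + 1 / e) * (wt x * (norm (F x - G x))\<^sup>2)"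
      by (simp add: algebra_simps)
    finally have "ennreal (wt x * (norm (F x))\<^sup>2) \<le> ennreal \<dots>" by (rule ennreal_leI)
    also have "\<dots> = ennreal (1 + e) * ennreal (wt x * (norm (G x))\<^sup>2) + ennreal (1 + 1 / e) * ennreal (wt x * (norm (F x - G x))\<^sup>2)"
      using e wt_nonneg[of x] by (simp add: ennreal_mult[symmetric] ennreal_plus[symmetric] del: ennreal_plus)
    finally show "ennreal (wt x * (norm (F x))\<^sup>2) * indicator (ball 0 R) x \<le>
      ennreal (1 + e) * (ennreal (wt x * (norm (G x))\<^sup>2) * indicator (ball 0 R) x)
     + ennreal (1 + 1 / e) * (ennreal (wt x * (norm (F x - G x))\<^sup>2) * indicator (ball 0 R) x)"
      by (auto simp: indicator_def)
  qed
  also have "\<dots> = ennreal (1 + e) * energy R G + ennreal (1 + 1 / e) * energy R (\<lambda>x. F x - G x)"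
    unfolding energy_def by (subst nn_integral_add) (auto simp: nn_integral_cmult)
  finally show ?thesis .
qed

text \<open>Inside the ball the weight is at least its value at radius \<open>R\<close>. Convergence
  in energy thus becomes convergence in the unweighted L2, where the pairing lemma applies.\<close>

lemma energy_dominates_L2:
  fixes G :: "'a::euclidean_space \<Rightarrow> 'a"
  assumes R: "R > 0" and N: "DIM('a) \<ge> 2"
    and [measurable]: "G \<in> borel_measurable borel"
  shows "(\<integral>\<^sup>+x. ennreal ((norm (G x))\<^sup>2) \<partial>lebesgue_on (ball 0 R)) \<le> ennreal (R powr (real DIM('a) - 2)) * energy R G"
proof -
  let ?a = "real DIM('a) - 2"
  have "(\<integral>\<^sup>+x. ennreal ((norm (G x))\<^sup>2) \<partial>lebesgue_on (ball 0 R)) = (\<integral>\<^sup>+x\<in>ball 0 R. ennreal ((norm (G x))\<^sup>2) \<partial>lborel)"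
    by (rule nn_integral_lebesgue_on) auto
  also have "\<dots> \<le> (\<integral>\<^sup>+x. ennreal (R powr ?a) * (ennreal (wt x * (norm (G x))\<^sup>2) * indicator (ball 0 R) x) \<partial>lborel)"
  proof (rule nn_integral_mono_AE)
    have "AE x in (lborel::'a measure). x \<noteq> 0" by (rule AE_lborel_singleton)
    then show "AE x in lborel. ennreal ((norm (G x))\<^sup>2) * indicator (ball 0 R) x \<le> ennreal (R powr ?a) * (ennreal (wt x * (norm (G x))\<^sup>2) * indicator (ball 0 R) x)"
    proof eventually_elim
      case (elim x)
      show ?case
      proof (cases "x \<in> ball 0 R")
        case True
        have "norm x powr ?a \<le> R powr ?a" using True N by (intro powr_mono2) auto
        then have "norm x powr ?a * wt x \<le> R powr ?a * wt x" by (intro mult_right_mono wt_nonneg)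
        also have "norm x powr ?a * wt x = 1" unfolding wt_def using elim by (simp only: powr_add[symmetric]) simp
        finally have "1 * (norm (G x))\<^sup>2 \<le> (R powr ?a * wt x) * (norm (G x))\<^sup>2" by (intro mult_right_mono) auto
        then show ?thesis using True wt_nonneg[of x] by (simp add: ennreal_mult[symmetric] mult.assoc ennreal_leI)
      qed simp
    qed
  qed
  also have "\<dots> = ennreal (R powr ?a) * energy R G"
    unfolding energy_def by (rule nn_integral_cmult) measurable
  finally show ?thesis .
qed

section \<open>Weak gradients of limits of test functions\<close>

lemma LINT_lebesgue_on_support:
  fixes f :: "'a::euclidean_space \<Rightarrow> 'b::euclidean_space"
  assumes "S \<in> sets lebesgue" "f \<in> borel_measurable borel" "\<And>x. x \<notin> S \<Longrightarrow> f x = 0"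
  shows "(\<integral>x. f x \<partial>lebesgue_on S) = (\<integral>x. f x \<partial>lborel)"
proof -
  have "(\<lambda>x. indicator S x *\<^sub>R f x) = f" using assms(3) by (auto simp: indicator_def)
  then show ?thesis using assms by (simp add: integral_restrict_space integral_completion)
qed

lemma finite_measure_lebesgue_on_ball: "finite_measure (lebesgue_on (ball (0::'a::euclidean_space) R))"
  by (rule finite_measureI) (use emeasure_bounded_finite[OF bounded_ball, of "0::'a" R] in \<open>simp add: emeasure_restrict_space\<close>)

text \<open>Integration by parts holds for each \<open>\<phi> n\<close>, and both of its sides are
  pairings with a bounded function that pass to the limit.\<close>

lemma weak_gradient_of_limit:
  fixes v :: "'a::euclidean_space \<Rightarrow> real"
  assumes R: "R > 0" and N: "DIM('a) \<ge> 2"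
    and \<phi>: "\<And>n. \<phi> n \<in> Cc_infty (ball 0 R)"
    and v: "v \<in> borel_measurable (lebesgue_on (ball 0 R))"
    and lim: "(\<lambda>n. \<integral>\<^sup>+x. ennreal ((\<phi> n x - v x)\<^sup>2) \<partial>lebesgue_on (ball 0 R)) \<longlonglongrightarrow> 0"
    and G: "G \<in> borel_measurable borel"
    and limG: "(\<lambda>n. energy R (\<lambda>x. grad (\<phi> n) x - G x)) \<longlonglongrightarrow> 0"
  shows "is_weak_gradient (ball 0 R) v G"
proof -
  let ?B = "ball (0::'a) R" and ?M = "lebesgue_on (ball (0::'a) R)"
  have "\<exists>K. C1_cpt K (\<phi> n) \<and> K \<subseteq> ?B" for n using Cc_infty_C1_cpt[OF \<phi>[of n]] by blast
  then obtain K where K: "\<And>n. C1_cpt (K n) (\<phi> n)" "\<And>n. K n \<subseteq> ?B" by metis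
  have fin: "finite_measure ?M" by (rule finite_measure_lebesgue_on_ball)
  have bi: "bounded_bilinear ((*\<^sub>R) :: real \<Rightarrow> 'a \<Rightarrow> 'a)" by (rule bounded_bilinear_scaleR)
  have bi': "bounded_bilinear (\<lambda>(x::'a) (r::real). r *\<^sub>R x)" by (rule bounded_bilinear.flip[OF bi])
  have resti: "integrable ?M f" if "integrable lborel f" for f :: "'a \<Rightarrow> 'b::euclidean_space"
  proof -
    have "integrable lebesgue f" using that by (simp add: integrable_completion)
    then show ?thesis by (simp add: integrable_restrict_space integrable_mult_indicator)
  qed
  have i\<phi>: "integrable ?M (\<phi> n)" for n
    by (intro resti integrable_of_compact_support[OF C1_cpt_compact[OF K(1)] C1_cpt_cont[OF K(1)] C1_cpt_zero[OF K(1)]])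
  have ig: "integrable ?M (grad (\<phi> n))" for n
    by (intro resti integrable_of_compact_support[OF C1_cpt_compact[OF K(1)] C1_cpt_cont_grad[OF K(1)] C1_cpt_grad_zero[OF K(1)]])
  have lim1: "(\<lambda>n. \<integral>\<^sup>+x. ennreal ((norm (\<phi> n x - v x))\<^sup>2) \<partial>?M) \<longlonglongrightarrow> 0" using lim by simp
  have GM: "G \<in> borel_measurable ?M" by (rule borel_measurable_lebesgue_on[OF G])
  have lim2: "(\<lambda>n. \<integral>\<^sup>+x. ennreal ((norm (grad (\<phi> n) x - G x))\<^sup>2) \<partial>?M) \<longlonglongrightarrow> 0"
  proof (rule tendsto_sandwich[OF _ _ tendsto_const])
    show "\<forall>\<^sub>F n in sequentially. (\<integral>\<^sup>+x. ennreal ((norm (grad (\<phi> n) x - G x))\<^sup>2) \<partial>?M)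
       \<le> ennreal (R powr (real DIM('a) - 2)) * energy R (\<lambda>x. grad (\<phi> n) x - G x)"
      using energy_dominates_L2[OF R N] C1_cpt_grad_measurable[OF K(1)] G
      by (intro always_eventually allI) auto
    have "(\<lambda>n. ennreal (R powr (real DIM('a) - 2)) * energy R (\<lambda>x. grad (\<phi> n) x - G x)) \<longlonglongrightarrow> ennreal (R powr (real DIM('a) - 2)) * 0"
      by (rule ennreal_tendsto_cmult[OF _ limG]) simp
    then show "(\<lambda>n. ennreal (R powr (real DIM('a) - 2)) * energy R (\<lambda>x. grad (\<phi> n) x - G x)) \<longlonglongrightarrow> 0" by simp
  qed auto
  \<comment> \<open>Only the integrability clause of the pairing lemma is wanted, so the partner is
    the zero function.\<close>
  have iv: "integrable ?M v"
    by (rule L2_limit_pairing(1)[OF fin bi i\<phi> v lim1, of "\<lambda>_. 0" 0]) auto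
  have iG: "integrable ?M G"
    by (rule L2_limit_pairing(1)[OF fin bi' ig GM lim2, of "\<lambda>_. 0" 0]) auto
  have sub: "set_integrable lebesgue C f" if "integrable ?M f" "compact C" "C \<subseteq> ?B" for C and f :: "'a \<Rightarrow> 'b::euclidean_space"
  proof -
    have "set_integrable lebesgue ?B f" using that(1) by (simp add: set_integrable_def integrable_restrict_space)
    then show ?thesis
      by (rule set_integrable_subset) (use that in \<open>auto intro: lmeasurable_compact fmeasurableD\<close>)
  qed
  have ibp: "(\<integral>x. v x *\<^sub>R grad \<eta> x \<partial>?M) = - (\<integral>x. \<eta> x *\<^sub>R G x \<partial>?M)" if \<eta>: "\<eta> \<in> Cc_infty ?B" for \<eta>
  proof -
    obtain L where L: "C1_cpt L \<eta>" "L \<subseteq> ?B" by (rule Cc_infty_C1_cpt[OF \<eta>])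
    obtain B where B: "\<And>x. norm (\<eta> x) \<le> B" using C1_cpt_bound[OF L(1)] by blast
    obtain B' where B': "\<And>x. norm (grad \<eta> x) \<le> B'" using C1_cpt_grad_bound[OF L(1)] by blast
    have m[measurable]: "\<eta> \<in> borel_measurable borel" "grad \<eta> \<in> borel_measurable borel"
      "\<phi> n \<in> borel_measurable borel" "grad (\<phi> n) \<in> borel_measurable borel" for n
      using C1_cpt_measurable C1_cpt_grad_measurable L K by blast+
    have 1: "(\<lambda>n. \<integral>x. \<phi> n x *\<^sub>R grad \<eta> x \<partial>?M) \<longlonglongrightarrow> (\<integral>x. v x *\<^sub>R grad \<eta> x \<partial>?M)"
      by (rule L2_limit_pairing(2)[OF fin bi i\<phi> v lim1 borel_measurable_lebesgue_on[OF m(2)] B'])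
    have 2: "(\<lambda>n. \<integral>x. \<eta> x *\<^sub>R grad (\<phi> n) x \<partial>?M) \<longlonglongrightarrow> (\<integral>x. \<eta> x *\<^sub>R G x \<partial>?M)"
      by (rule L2_limit_pairing(2)[OF fin bi' ig GM lim2 borel_measurable_lebesgue_on[OF m(1)] B])
    have 3: "(\<integral>x. \<phi> n x *\<^sub>R grad \<eta> x \<partial>?M) = - (\<integral>x. \<eta> x *\<^sub>R grad (\<phi> n) x \<partial>?M)" for n
    proof -
      have z: "\<phi> n x = 0" "\<eta> x = 0" if "x \<notin> ?B" for x
        using C1_cpt_zero[OF K(1)[of n], of x] K(2)[of n] C1_cpt_zero[OF L(1), of x] L(2) that by blast+
      have "(\<integral>x. \<phi> n x *\<^sub>R grad \<eta> x \<partial>?M) = (\<integral>x. \<phi> n x *\<^sub>R grad \<eta> x \<partial>lborel)"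
        by (rule LINT_lebesgue_on_support) (auto simp del: mem_ball_0 mem_ball simp: z)
      also have "\<dots> = - (\<integral>x. \<eta> x *\<^sub>R grad (\<phi> n) x \<partial>lborel)"
        by (rule C1_cpt_integration_by_parts[OF K(1) L(1)])
      also have "(\<integral>x. \<eta> x *\<^sub>R grad (\<phi> n) x \<partial>lborel) = (\<integral>x. \<eta> x *\<^sub>R grad (\<phi> n) x \<partial>?M)"
        by (rule LINT_lebesgue_on_support[symmetric]) (auto simp del: mem_ball_0 mem_ball simp: z)
      finally show ?thesis .
    qed
    have "(\<lambda>n. \<integral>x. \<phi> n x *\<^sub>R grad \<eta> x \<partial>?M) \<longlonglongrightarrow> - (\<integral>x. \<eta> x *\<^sub>R G x \<partial>?M)"
      unfolding 3 by (rule tendsto_minus[OF 2])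
    with 1 show ?thesis by (rule LIMSEQ_unique)
  qed
  show ?thesis unfolding is_weak_gradient_def
  proof (intro conjI allI impI ballI ibp)
    fix C :: "'a set" assume "compact C \<and> C \<subseteq> ?B"
    then show "v absolutely_integrable_on C" "G absolutely_integrable_on C" using sub[OF iv] sub[OF iG] by blast+
  qed
qed

text \<open>The choice made by \<open>weak_grad\<close> equals the Borel field \<open>G\<close>
  almost everywhere by uniqueness. This gives its measurability first and the value of the integral
  second.\<close>

lemma HS_numerator_eq:
  fixes v :: "'a::euclidean_space \<Rightarrow> real"
  assumes wg: "is_weak_gradient (ball 0 R) v G" and G[measurable]: "G \<in> borel_measurable borel"
  shows "HS_numerator R v = enn2real (energy R G)"
proof -
  let ?B = "ball (0::'a) R"
  define H where "H = weak_grad ?B v"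
  have "is_weak_gradient ?B v H" unfolding H_def weak_grad_def using wg by (rule someI[of "is_weak_gradient ?B v"])
  then have ae: "AE x in lebesgue. x \<in> ?B \<longrightarrow> G x = H x"
    using weak_gradient_unique[OF open_ball wg] by blast
  have "(\<lambda>x. indicator ?B x *\<^sub>R G x) \<in> borel_measurable lebesgue" 
    by (rule measurable_completion) measurable
  then have "(\<lambda>x. indicator ?B x *\<^sub>R H x) \<in> borel_measurable lebesgue"
    by (rule borel_measurable_AE) (use ae in \<open>auto elim!: eventually_mono simp: indicator_def\<close>)
  then have H: "H \<in> borel_measurable (lebesgue_on ?B)"
    by (subst borel_measurable_restrict_space_iff) auto
  have wm: "wt \<in> borel_measurable (lebesgue_on ?B)" by (rule borel_measurable_lebesgue_on) measurable
  have "HS_numerator R v = (LINT x|lebesgue_on ?B. wt x * (norm (H x))\<^sup>2)"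
    by (simp add: HS_numerator_def wt_def H_def Let_def)
  also have "\<dots> = enn2real (\<integral>\<^sup>+x\<in>?B. ennreal (wt x * (norm (H x))\<^sup>2) \<partial>lborel)"
    by (rule LINT_ball_eq) (use H wm in \<open>auto intro!: mult_nonneg_nonneg wt_nonneg borel_measurable_times borel_measurable_power borel_measurable_norm\<close>)
  also have "(\<integral>\<^sup>+x\<in>?B. ennreal (wt x * (norm (H x))\<^sup>2) \<partial>lborel) = energy R G"
    unfolding energy_def
    by (rule nn_integral_cong_AE) (use ae in \<open>auto simp: AE_completion_iff indicator_def elim!: eventually_mono\<close>)
  finally show ?thesis .
qed

text \<open>The gradients form a Cauchy sequence in L2 of the weighted measure, so Riesz-Fischer
  supplies \<open>G\<close>. A subsequence is taken because the argument on rays needs convergence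
  almost everywhere.\<close>

lemma W0_ball_approx:
  fixes v :: "'a::euclidean_space \<Rightarrow> real"
  assumes R: "R > 0" and v: "v \<in> W0_ball R"
  shows "\<exists>\<phi> G. (\<forall>n. \<phi> n \<in> Cc_infty (ball 0 R)) \<and> G \<in> borel_measurable borel
    \<and> (\<lambda>n. energy R (\<lambda>x. grad (\<phi> n) x - G x)) \<longlonglongrightarrow> 0
    \<and> (\<lambda>n. \<integral>\<^sup>+x. ennreal ((\<phi> n x - v x)\<^sup>2) \<partial>lebesgue_on (ball 0 R)) \<longlonglongrightarrow> 0
    \<and> (AE x in lborel. x \<in> ball 0 R \<longrightarrow> (\<lambda>n. \<phi> n x) \<longlonglongrightarrow> v x)"
proof -
  let ?B = "ball (0::'a) R" and ?M = "lebesgue_on (ball (0::'a) R)"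
  have vm: "v \<in> borel_measurable ?M" using v by (simp add: W0_ball_def W0_12_def)
  have wt': "(\<lambda>x::'a. norm x powr - (real DIM('a) - 2)) = wt" by (simp add: wt_def[abs_def])
  obtain \<phi> where \<phi>: "\<And>n. \<phi> n \<in> Cc_infty ?B"
    and cauchy: "\<And>e. e > 0 \<Longrightarrow> \<exists>M. \<forall>m\<ge>M. \<forall>n\<ge>M. W_norm wt ?B (\<lambda>x. \<phi> m x - \<phi> n x) < e"
    and lim: "(\<lambda>n. \<integral>\<^sup>+x. ennreal ((\<phi> n x - v x)\<^sup>2) \<partial>?M) \<longlonglongrightarrow> 0"
    using v unfolding W0_ball_def W0_12_def wt' by blast
  have "\<exists>K. C1_cpt K (\<phi> n)" for n using Cc_infty_C1_cpt[OF \<phi>[of n]] by blast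
  then obtain K where K: "\<And>n. C1_cpt (K n) (\<phi> n)" by metis
  have m[measurable]: "\<phi> n \<in> borel_measurable borel" "grad (\<phi> n) \<in> borel_measurable borel" for n
    using C1_cpt_measurable C1_cpt_grad_measurable K by blast+
  \<comment> \<open>A density over \<open>lborel\<close>, so that the limit field is Borel
    measurable and can be used in polar coordinates and in \<open>energy_triangle\<close>.\<close>
  define D where "D = density lborel (\<lambda>x::'a. ennreal (wt x) * indicator ?B x)"
  have nnD: "(\<integral>\<^sup>+x. ennreal ((norm (G x))\<^sup>2) \<partial>D) = energy R G" if [measurable]: "G \<in> borel_measurable borel" for G :: "'a \<Rightarrow> 'a"
    unfolding D_def energy_def
    by (subst nn_integral_density) (auto intro!: nn_integral_cong simp: ennreal_mult wt_nonneg mult_ac)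
  have "\<exists>G\<in>borel_measurable D. (\<lambda>n. \<integral>\<^sup>+x. ennreal ((norm (grad (\<phi> n) x - G x))\<^sup>2) \<partial>D) \<longlonglongrightarrow> 0"
  proof (rule riesz_fischer_L2)
    show "grad (\<phi> n) \<in> borel_measurable D" for n by (simp add: D_def)
    fix e :: real assume e: "e > 0"
    obtain M where M: "\<forall>m\<ge>M. \<forall>n\<ge>M. W_norm wt ?B (\<lambda>x. \<phi> m x - \<phi> n x) < sqrt e"
      using cauchy[of "sqrt e"] e by auto
    have "(\<integral>\<^sup>+x. ennreal ((norm (grad (\<phi> m) x - grad (\<phi> n) x))\<^sup>2) \<partial>D) \<le> ennreal e" if "m \<ge> M" "n \<ge> M" for m n
    proof -
      have "(\<integral>\<^sup>+x. ennreal ((norm (grad (\<phi> m) x - grad (\<phi> n) x))\<^sup>2) \<partial>D) = energy R (grad (\<lambda>x. \<phi> m x - \<phi> n x))"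
        using Cc_infty_diff(2)[OF \<phi>[of m] \<phi>[of n]] by (subst nnD) (auto simp: energy_def)
      also have "\<dots> = ennreal ((W_norm wt ?B (\<lambda>x. \<phi> m x - \<phi> n x))\<^sup>2)"
        by (rule W_norm_energy[symmetric, OF R Cc_infty_diff(1)[OF \<phi> \<phi>]])
      also have "\<dots> \<le> ennreal e"
      proof (rule ennreal_leI)
        have "0 \<le> W_norm wt ?B (\<lambda>x. \<phi> m x - \<phi> n x)"
          unfolding W_norm_def by (auto intro!: real_sqrt_ge_zero Bochner_Integration.integral_nonneg mult_nonneg_nonneg wt_nonneg)
        then have "(W_norm wt ?B (\<lambda>x. \<phi> m x - \<phi> n x))\<^sup>2 \<le> (sqrt e)\<^sup>2"
          using M that by (intro power_mono) (auto intro: less_imp_le)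
        then show "(W_norm wt ?B (\<lambda>x. \<phi> m x - \<phi> n x))\<^sup>2 \<le> e" using e by simp
      qed
      finally show ?thesis .
    qed
    then show "\<exists>K. \<forall>m\<ge>K. \<forall>n\<ge>K. (\<integral>\<^sup>+x. ennreal ((norm (grad (\<phi> m) x - grad (\<phi> n) x))\<^sup>2) \<partial>D) \<le> ennreal e" by blast
  qed
  then obtain G where G': "G \<in> borel_measurable D"
    "(\<lambda>n. \<integral>\<^sup>+x. ennreal ((norm (grad (\<phi> n) x - G x))\<^sup>2) \<partial>D) \<longlonglongrightarrow> 0" by blast
  have Gm[measurable]: "G \<in> borel_measurable borel" using G'(1) by (simp add: D_def)
  have "(\<lambda>n. energy R (\<lambda>x. grad (\<phi> n) x - G x)) \<longlonglongrightarrow> 0"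
    using G'(2) by (subst (asm) nnD) measurable
  note G = Gm this
  have "\<forall>\<^sub>F n in sequentially. (\<integral>\<^sup>+x. ennreal ((\<phi> n x - v x)\<^sup>2) \<partial>?M) < top"
    by (rule order_tendstoD(2)[OF lim]) simp
  then obtain n0 where n0: "\<And>n. n \<ge> n0 \<Longrightarrow> (\<integral>\<^sup>+x. ennreal ((\<phi> n x - v x)\<^sup>2) \<partial>?M) < top"
    unfolding eventually_sequentially by blast
  \<comment> \<open>The first \<open>n0\<close> terms are skipped because their distance to
    \<open>v\<close> could be infinite, and the extraction of a subsequence asks for integrable
    terms.\<close>
  define u where "u n x = (\<phi> (n + n0) x - v x)\<^sup>2" for n x
  have um: "u n \<in> borel_measurable ?M" for n
    unfolding u_def by (intro borel_measurable_power borel_measurable_diff vm borel_measurable_lebesgue_on[OF m(1)])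
  have ui: "integrable ?M (u n)" for n
    using n0[of "n + n0"] um by (intro integrableI_bounded) (auto simp: u_def)
  have "(\<lambda>n. \<integral>x. norm (u n x) \<partial>?M) \<longlonglongrightarrow> 0"
  proof -
    have "ennreal (\<integral>x. norm (u n x) \<partial>?M) = (\<integral>\<^sup>+x. ennreal ((\<phi> (n + n0) x - v x)\<^sup>2) \<partial>?M)" for n
      using nn_integral_eq_integral[OF integrable_norm[OF ui[of n]]] by (simp add: u_def)
    moreover have "(\<lambda>n. \<integral>\<^sup>+x. ennreal ((\<phi> (n + n0) x - v x)\<^sup>2) \<partial>?M) \<longlonglongrightarrow> 0"
      by (rule LIMSEQ_ignore_initial_segment[OF lim])
    ultimately show ?thesis by (subst ennreal_tendsto_0_iff[symmetric]) auto
  qed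
  from tendsto_L1_AE_subseq[OF ui this]
  obtain r where r: "strict_mono r" "AE x in ?M. (\<lambda>n. u (r n) x) \<longlonglongrightarrow> 0"
    by blast
  define s where "s n = r n + n0" for n
  have s: "filterlim s sequentially sequentially"
    unfolding s_def using r(1) by (intro filterlim_subseq) (auto simp: strict_mono_def)
  have "AE x in lebesgue. x \<in> ?B \<longrightarrow> (\<lambda>n. u (r n) x) \<longlonglongrightarrow> 0"
    using r(2) by (subst (asm) AE_restrict_space_iff) auto
  then have "AE x in lborel. x \<in> ?B \<longrightarrow> (\<lambda>n. \<phi> (s n) x) \<longlonglongrightarrow> v x"
    unfolding AE_completion_iff
  proof eventually_elim
    case (elim x)
    show ?case
    proof
      assume "x \<in> ?B"
      with elim have "(\<lambda>n. (\<phi> (s n) x - v x)\<^sup>2) \<longlonglongrightarrow> 0" by (simp add: u_def s_def)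
      then have "(\<lambda>n. \<phi> (s n) x - v x) \<longlonglongrightarrow> 0" by simp
      then show "(\<lambda>n. \<phi> (s n) x) \<longlonglongrightarrow> v x" by (rule LIM_zero_cancel)
    qed
  qed
  moreover have "(\<lambda>n. energy R (\<lambda>x. grad (\<phi> (s n)) x - G x)) \<longlonglongrightarrow> 0"
    by (rule filterlim_compose[OF G(2) s])
  moreover have "(\<lambda>n. \<integral>\<^sup>+x. ennreal ((\<phi> (s n) x - v x)\<^sup>2) \<partial>?M) \<longlonglongrightarrow> 0"
    by (rule filterlim_compose[OF lim s])
  ultimately show ?thesis using \<phi> G(1)
    by (intro exI[of _ "\<lambda>n. \<phi> (s n)"] exI[of _ G]) auto
qed

section \<open>The lower bound\<close>

lemma ray_has_derivative: "(ray R x has_derivative (\<lambda>h. h *\<^sub>R (- ray R x t))) (at t)"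
proof -
  have "((\<lambda>t. R * exp (- t)) has_real_derivative - (R * exp (- t))) (at t)"
    by (auto intro!: derivative_eq_intros)
  from DERIV_cdivide[OF this, of "norm x"]
  have "((\<lambda>t. R * exp (- t) / norm x) has_real_derivative - (R * exp (- t) / norm x)) (at t)" by simp
  then have "((\<lambda>t. R * exp (- t) / norm x) has_derivative (\<lambda>h. - (R * exp (- t) / norm x) * h)) (at t)"
    by (simp only: has_field_derivative_def)
  from has_derivative_scaleR_left[OF this, of x] show ?thesis
    unfolding ray_def[abs_def]
    by (rule has_derivative_eq_rhs) (simp add: fun_eq_iff)
qed

lemma ray_cont: "continuous_on S (ray R x)"
  by (intro continuous_at_imp_continuous_on ballI has_derivative_continuous[OF ray_has_derivative])

lemma ray_in_ball: "R > 0 \<Longrightarrow> x \<noteq> 0 \<Longrightarrow> ray R x t \<in> ball 0 R \<longleftrightarrow> t > 0"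
  by (simp add: norm_ray)

text \<open>The derivative of \<open>\<phi>\<close> along the ray. The ray runs inwards and solves
  \<open>y' = - y\<close>, hence the sign.\<close>

definition ray_deriv :: "real \<Rightarrow> ('a::euclidean_space \<Rightarrow> real) \<Rightarrow> 'a \<Rightarrow> real \<Rightarrow> real" where
  "ray_deriv R \<phi> x t = - (grad \<phi> (ray R x t) \<bullet> ray R x t)"

definition ray_energy :: "real \<Rightarrow> ('a::euclidean_space \<Rightarrow> real) \<Rightarrow> 'a \<Rightarrow> ennreal" where
  "ray_energy R \<phi> x = (\<integral>\<^sup>+t\<in>{0<..}. ennreal ((ray_deriv R \<phi> x t)\<^sup>2) \<partial>lborel)"

text \<open>The integrand need not be measurable below: the profile of a radial function is arbitrary on a null set of radii.
  Only equality almost everywhere is used for it.\<close>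

definition bliss_int :: "real \<Rightarrow> (real \<Rightarrow> real) \<Rightarrow> ennreal" where
  "bliss_int q f = (\<integral>\<^sup>+t\<in>{0<..}. ennreal (\<bar>f t\<bar> powr (2 * q + 2) * t powr - (q + 2)) \<partial>lborel)"

lemma compact_subset_smaller_ball:
  assumes "compact K" "K \<subseteq> ball (0::'a::euclidean_space) R" "R > 0"
  obtains \<rho> where "0 < \<rho>" "\<rho> < R" "K \<subseteq> cball 0 \<rho>"
proof (cases "K = {}")
  case True
  show ?thesis by (rule that[of "R / 2"]) (use True assms in auto)
next
  case False
  obtain z where z: "z \<in> K" "\<And>y. y \<in> K \<Longrightarrow> norm y \<le> norm z"
    using continuous_attains_sup[OF assms(1) False, of norm] continuous_on_norm_id by blast
  have "norm z < R" using z assms by auto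
  \<comment> \<open>The maximum with \<open>R / 2\<close> keeps the radius positive when
    \<open>K\<close> is just the origin.\<close>
  then show ?thesis using z assms(3)
    by (intro that[of "max (norm z) (R / 2)"]) (auto simp: le_max_iff_disj)
qed

text \<open>The support of \<open>\<phi>\<close> keeps a positive distance from the boundary sphere,
  so \<open>\<phi>\<close> vanishes along the ray for small \<open>t\<close>, as
  \<open>bliss_inequality\<close> demands.\<close>

lemma ray_bliss:
  fixes \<phi> :: "'a::euclidean_space \<Rightarrow> real"
  assumes R: "R > 0" and \<phi>: "C1_cpt K \<phi>" "K \<subseteq> ball 0 R" and x: "x \<noteq> 0" and q: "q > 0" and k: "k \<ge> 0"
    and le: "ray_energy R \<phi> x \<le> ennreal k"
  shows "bliss_int q (\<lambda>t. \<phi> (ray R x t)) \<le> ennreal ((k / bliss_const q) powr (q + 1))"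
proof -
  obtain \<rho> where \<rho>: "0 < \<rho>" "\<rho> < R" "K \<subseteq> cball 0 \<rho>"
    using compact_subset_smaller_ball[OF C1_cpt_compact[OF \<phi>(1)] \<phi>(2) R] .
  obtain B where B: "\<And>x. norm (\<phi> x) \<le> B" using C1_cpt_bound[OF \<phi>(1)] by blast
  \<comment> \<open>Half of the logarithmic gap, so that \<open>t \<le> d\<close> already places the
    point strictly outside \<open>cball 0 \<rho>\<close>.\<close>
  define d where "d = ln (R / \<rho>) / 2"
  have lp: "ln (R / \<rho>) > 0" using \<rho> by (simp add: ln_gt_zero)
  have "\<phi> (ray R x t) = 0" if "t \<le> d" for t
  proof -
    have "t < ln (R / \<rho>)" using that lp by (simp add: d_def)
    then have "exp t < R / \<rho>" using \<rho> R by (metis divide_pos_pos exp_less_cancel_iff exp_ln)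
    then have "\<rho> < R * exp (- t)" using \<rho> by (simp add: exp_minus field_simps)
    then have "ray R x t \<notin> cball 0 \<rho>" using R x by (simp add: norm_ray)
    then show ?thesis using \<rho>(3) C1_cpt_zero[OF \<phi>(1)] by blast
  qed
  moreover have "((\<lambda>t. \<phi> (ray R x t)) has_real_derivative ray_deriv R \<phi> x t) (at t)" for t
    by (rule has_derivative_imp_has_field_derivative[OF has_derivative_compose[OF ray_has_derivative C1_cpt_deriv[OF \<phi>(1)]]])
       (simp add: ray_deriv_def)
  moreover have "continuous_on {0<..} (ray_deriv R \<phi> x)"
    unfolding ray_deriv_def[abs_def]
    by (intro continuous_intros ray_cont continuous_on_compose2[OF C1_cpt_cont_grad[OF \<phi>(1)] ray_cont]) auto
  ultimately show ?thesis
    unfolding bliss_int_def using q k le B lp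
    by (intro bliss_inequality[where d=d and C=B and f'="ray_deriv R \<phi> x"]) (auto simp: d_def ray_energy_def)
qed

lemma ray_energy_measurable [measurable]:
  assumes "C1_cpt K \<phi>" shows "ray_energy R \<phi> \<in> borel_measurable borel"
proof -
  have [measurable]: "grad \<phi> \<in> borel_measurable borel" by (rule C1_cpt_grad_measurable[OF assms])
  show ?thesis unfolding ray_energy_def[abs_def] ray_deriv_def by measurable
qed

text \<open>Rays see only the radial part of the gradient, and Cauchy-Schwarz discards the rest. The
  factor \<open>(norm y)\<^sup>2\<close> from the speed of the ray combines with the density of
  \<open>polar\<close> into \<open>wt\<close>.\<close>

lemma ray_energy_le:
  fixes \<phi> :: "'a::euclidean_space \<Rightarrow> real"
  assumes R: "R > 0" and \<phi>: "C1_cpt K \<phi>"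
  shows "(\<integral>\<^sup>+x. ang x * ray_energy R \<phi> x \<partial>lborel) \<le> energy R (grad \<phi>)"
proof -
  have [measurable]: "grad \<phi> \<in> borel_measurable borel" by (rule C1_cpt_grad_measurable[OF \<phi>])
  define F where "F y = ennreal ((grad \<phi> y \<bullet> y)\<^sup>2) * indicator (ball 0 R) y" for y
  have [measurable]: "F \<in> borel_measurable borel" unfolding F_def by measurable
  have "(\<integral>\<^sup>+x. ang x * ray_energy R \<phi> x \<partial>lborel) = (\<integral>\<^sup>+x. ang x * (\<integral>\<^sup>+t. F (ray R x t) \<partial>lborel) \<partial>lborel)"
  proof (rule nn_integral_cong)
    fix x :: 'a
    show "ang x * ray_energy R \<phi> x = ang x * (\<integral>\<^sup>+t. F (ray R x t) \<partial>lborel)"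
    proof (cases "x = 0")
      case False
      then have "ray_energy R \<phi> x = (\<integral>\<^sup>+t. F (ray R x t) \<partial>lborel)"
        unfolding ray_energy_def F_def ray_deriv_def
        by (intro nn_integral_cong) (auto simp: indicator_def ray_in_ball[OF R] simp del: mem_ball mem_ball_0)
      then show ?thesis by simp
    qed (simp add: ang_def)
  qed
  also have "\<dots> = (\<integral>\<^sup>+y. F y * ennreal (norm y powr - real DIM('a)) \<partial>lborel)"
    by (rule polar[symmetric]) (use R in auto)
  also have "\<dots> \<le> energy R (grad \<phi>)" unfolding energy_def
  proof (rule nn_integral_mono)
    fix y :: 'a
    have "(grad \<phi> y \<bullet> y)\<^sup>2 \<le> (norm (grad \<phi> y))\<^sup>2 * (norm y)\<^sup>2"
      using Cauchy_Schwarz_ineq[of "grad \<phi> y" y] by (simp add: power2_norm_eq_inner)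
    then have "(grad \<phi> y \<bullet> y)\<^sup>2 * norm y powr - real DIM('a) \<le> (norm (grad \<phi> y))\<^sup>2 * (norm y)\<^sup>2 * norm y powr - real DIM('a)"
      by (rule mult_right_mono) simp
    also have "\<dots> = wt y * (norm (grad \<phi> y))\<^sup>2" by (simp add: wt_eq)
    finally show "F y * ennreal (norm y powr - real DIM('a)) \<le> ennreal (wt y * (norm (grad \<phi> y))\<^sup>2) * indicator (ball 0 R) y"
      by (auto simp: F_def indicator_def ennreal_mult[symmetric] intro!: ennreal_leI)
  qed
  finally show ?thesis .
qed

section \<open>The denominator as an integral of the radial profile\<close>

definition hs_dens :: "real \<Rightarrow> ('a::euclidean_space \<Rightarrow> real) \<Rightarrow> 'a \<Rightarrow> real" where
  "hs_dens R v x = norm x powr - real DIM('a) * (- ln (norm x / R)) powr - (2 * (real DIM('a) - 1) / (real DIM('a) - 2))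
     * \<bar>v x\<bar> powr (2 * real DIM('a) / (real DIM('a) - 2))"

text \<open>The dictionary between the dimension and \<open>q\<close>: with
  \<open>p = 2 * q + 2\<close> the outer power \<open>2 / p\<close> is
  \<open>1 / (q + 1)\<close>.\<close>

lemma hs_exponents:
  assumes N: "N \<ge> (3::real)" and q: "q = 2 / (N - 2)"
  shows "2 * (N - 1) / (N - 2) = q + 2" "2 * N / (N - 2) = 2 * q + 2" "(N - 2) / N = 1 / (q + 1)" "q / (q + 1) = 2 / N" "q > 0"
  using N unfolding q by (auto simp: field_simps)

lemma hs_dens_measurable:
  fixes v :: "'a::euclidean_space \<Rightarrow> real"
  assumes "v \<in> borel_measurable (lebesgue_on (ball 0 R))"
  shows "hs_dens R v \<in> borel_measurable (lebesgue_on (ball 0 R))"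
proof -
  have [measurable]: "v \<in> borel_measurable (lebesgue_on (ball 0 R))" by fact
  have [measurable]: "(\<lambda>x::'a. norm x) \<in> borel_measurable (lebesgue_on (ball 0 R))"
    by (rule borel_measurable_lebesgue_on) measurable
  show ?thesis unfolding hs_dens_def[abs_def] by measurable
qed

text \<open>The profile \<open>g\<close> need not be measurable, so Fubini is applied to a Borel
  version \<open>L\<close> of \<open>v\<close>. By \<open>AE_ray\<close> it agrees with
  \<open>g\<close> at almost every parameter of almost every ray, which makes the inner integral
  independent of the ray.\<close>

lemma hs_dens_integral:
  fixes v :: "'a::euclidean_space \<Rightarrow> real"
  assumes R: "R > 0" and N: "DIM('a) \<ge> 3" and q: "q = 2 / (real DIM('a) - 2)"
    and v: "v \<in> borel_measurable (lebesgue_on (ball 0 R))"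
    and g: "AE x in lborel. x \<in> ball 0 R \<longrightarrow> v x = g (norm x)"
  shows "(\<integral>\<^sup>+x\<in>ball 0 R. ennreal (hs_dens R v x) \<partial>lborel) = ennreal (ang_mass TYPE('a)) * bliss_int q (\<lambda>t. g (R * exp (- t)))"
proof -
  let ?N = "real DIM('a)" and ?B = "ball (0::'a) R"
  have ex: "2 * (?N - 1) / (?N - 2) = q + 2" "2 * ?N / (?N - 2) = 2 * q + 2"
    using hs_exponents[of ?N q] N q by auto
  have "(\<lambda>x. indicator ?B x *\<^sub>R v x) \<in> borel_measurable lebesgue"
    using v by (subst (asm) borel_measurable_restrict_space_iff) auto
  then obtain L where L[measurable]: "L \<in> borel_measurable borel" and Lv: "AE x in lborel. indicator ?B x *\<^sub>R v x = L x"
    using completion_ex_borel_measurable_real by force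
  define F where "F y = ennreal ((- ln (norm y / R)) powr - (q + 2) * \<bar>L y\<bar> powr (2 * q + 2)) * indicator ?B y" for y
  have [measurable]: "F \<in> borel_measurable borel" unfolding F_def by measurable
  have "(\<integral>\<^sup>+x\<in>?B. ennreal (hs_dens R v x) \<partial>lborel) = (\<integral>\<^sup>+y. F y * ennreal (norm y powr - ?N) \<partial>lborel)"
  proof (rule nn_integral_cong_AE, use Lv in eventually_elim)
    case (elim x)
    show ?case
    proof (cases "x \<in> ?B")
      case True
      with elim have "v x = L x" by (simp only: indicator_simps) simp
      then have "hs_dens R v x = ((- ln (norm x / R)) powr - (q + 2) * \<bar>L x\<bar> powr (2 * q + 2)) * norm x powr - ?N"
        unfolding hs_dens_def ex by (simp only: mult_ac)
      then show ?thesis using True unfolding F_def by (simp only: indicator_simps mult_1_right ennreal_mult powr_ge_zero mult_nonneg_nonneg)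
    qed (simp add: F_def)
  qed
  also have "\<dots> = (\<integral>\<^sup>+x. ang x * (\<integral>\<^sup>+t. F (ray R x t) \<partial>lborel) \<partial>lborel)"
    by (rule polar) (use R in auto)
  also have "\<dots> = (\<integral>\<^sup>+x. ang x * bliss_int q (\<lambda>t. g (R * exp (- t))) \<partial>(lborel::'a measure))"
  proof (rule nn_integral_cong_AE)
    have "AE x in lborel. x \<in> ?B \<longrightarrow> L x = g (norm x)"
      using g Lv by eventually_elim (auto simp: indicator_def)
    from AE_ray[OF this R] show "AE x in lborel. ang x * (\<integral>\<^sup>+t. F (ray R x t) \<partial>lborel) = ang x * bliss_int q (\<lambda>t. g (R * exp (- t)))"
    proof eventually_elim
      case (elim x)
      show ?case
      proof (cases "ang x = 0")
        case False
        then have x: "x \<noteq> 0" by (auto simp: ang_def)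
        have "AE t in lborel. ray R x t \<in> ?B \<longrightarrow> L (ray R x t) = g (norm (ray R x t))" using elim False by simp
        then have "(\<integral>\<^sup>+t. F (ray R x t) \<partial>lborel) = bliss_int q (\<lambda>t. g (R * exp (- t)))"
          unfolding bliss_int_def
        proof (intro nn_integral_cong_AE, eventually_elim)
          case (elim t)
          then show ?case using R x
            by (auto simp: F_def indicator_def ray_in_ball[OF R x] norm_ray mult.commute simp del: mem_ball mem_ball_0)
        qed
        then show ?thesis by simp
      qed simp
    qed
  qed
  also have "\<dots> = ennreal (ang_mass TYPE('a)) * bliss_int q (\<lambda>t. g (R * exp (- t)))"
    by (subst nn_integral_multc) (auto simp: nn_integral_ang)
  finally show ?thesis .
qed

lemma HS_denominator_eq:
  fixes v :: "'a::euclidean_space \<Rightarrow> real"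
  assumes R: "R > 0" and N: "DIM('a) \<ge> 3" and q: "q = 2 / (real DIM('a) - 2)"
    and v: "v \<in> borel_measurable (lebesgue_on (ball 0 R))"
    and g: "AE x in lborel. x \<in> ball 0 R \<longrightarrow> v x = g (norm x)"
  shows "HS_denominator R v =
    (ang_mass TYPE('a) * enn2real (bliss_int q (\<lambda>t. g (R * exp (- t))))) powr (1 / (q + 1))"
proof -
  have "HS_denominator R v = (LINT x|lebesgue_on (ball 0 R). hs_dens R v x) powr (1 / (q + 1))"
    using hs_exponents(3)[of "real DIM('a)" q] N q by (simp add: HS_denominator_def Let_def hs_dens_def)
  also have "(LINT x|lebesgue_on (ball 0 R). hs_dens R v x) = enn2real (\<integral>\<^sup>+x\<in>ball 0 R. ennreal (hs_dens R v x) \<partial>lborel)"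
    by (rule LINT_ball_eq[OF hs_dens_measurable[OF v]]) (simp add: hs_dens_def)
  also have "\<dots> = ang_mass TYPE('a) * enn2real (bliss_int q (\<lambda>t. g (R * exp (- t))))"
    unfolding hs_dens_integral[OF R N q v g] using ang_mass_pos[where 'a='a] by (simp add: enn2real_mult)
  finally show ?thesis .
qed

text \<open>Off the origin the weight is positive throughout the ball, so a vanishing integral would
  force \<open>v\<close> to vanish almost everywhere. This keeps the denominator of the quotient
  away from 0.\<close>

lemma bliss_int_nonzero:
  fixes v :: "'a::euclidean_space \<Rightarrow> real"
  assumes R: "R > 0" and N: "DIM('a) \<ge> 3" and q: "q = 2 / (real DIM('a) - 2)"
    and v: "v \<in> borel_measurable (lebesgue_on (ball 0 R))"
    and g: "AE x in lborel. x \<in> ball 0 R \<longrightarrow> v x = g (norm x)"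
    and nz: "\<not> (AE x in lebesgue_on (ball 0 R). v x = 0)"
  shows "bliss_int q (\<lambda>t. g (R * exp (- t))) \<noteq> 0"
proof
  assume "bliss_int q (\<lambda>t. g (R * exp (- t))) = 0"
  then have "(\<integral>\<^sup>+x. ennreal (hs_dens R v x) \<partial>lebesgue_on (ball 0 R)) = 0"
    using hs_dens_integral[OF R N q v g] by (simp add: nn_integral_lebesgue_on)
  then have "AE x in lebesgue_on (ball 0 R). ennreal (hs_dens R v x) = 0"
    using hs_dens_measurable[OF v] by (subst (asm) nn_integral_0_iff_AE) auto
  moreover have "AE x in lebesgue_on (ball 0 R). x \<noteq> (0::'a)"
    by (subst AE_restrict_space_iff) (auto simp: AE_completion_iff intro: AE_lborel_singleton eventually_mono)
  moreover have "AE x in lebesgue_on (ball 0 R). x \<in> ball (0::'a) R"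
    using AE_space[of "lebesgue_on (ball (0::'a) R)"] by simp
  ultimately have "AE x in lebesgue_on (ball 0 R). v x = 0"
  proof eventually_elim
    case (elim x)
    then have "ln (norm x / R) < 0" using R by (intro ln_less_zero) auto
    with elim show ?case by (auto simp: hs_dens_def)
  qed
  with nz show False by simp
qed

section \<open>From test functions to their limit by Fatou's lemma\<close>

lemma liminf_frequently_le:
  fixes X :: "nat \<Rightarrow> ennreal"
  assumes "\<exists>\<^sub>F n in sequentially. X n \<le> c" shows "liminf X \<le> c"
proof (rule ccontr)
  assume "\<not> liminf X \<le> c"
  then have "c < liminf X" by simp
  then have "\<forall>\<^sub>F n in sequentially. c < X n" by (rule less_LiminfD)
  then have "\<forall>\<^sub>F n in sequentially. \<not> X n \<le> c" by (rule eventually_mono) simp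
  with assms show False unfolding frequently_def by blast
qed

text \<open>If infinitely many energies along a ray stayed below \<open>k\<close>, then
  \<open>ray_bliss\<close> and Fatou's lemma would bound the integral of the limit profile by a
  number that it exceeds. A level \<open>k\<close> in place of that integral leaves room for the
  integral to be infinite, a case which the lemma itself later excludes.\<close>

lemma energy_lower_bound:
  fixes v :: "'a::euclidean_space \<Rightarrow> real"
  assumes R: "R > 0" and q: "q > 0" and k: "k \<ge> 0"
    and \<phi>: "\<And>n. \<phi> n \<in> Cc_infty (ball 0 R)" and G: "G \<in> borel_measurable borel"
    and limG: "(\<lambda>n. energy R (\<lambda>x. grad (\<phi> n) x - G x)) \<longlonglongrightarrow> 0"
    and ae: "AE x in lborel. x \<in> ball 0 R \<longrightarrow> (\<lambda>n. \<phi> n x) \<longlonglongrightarrow> v x"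
    and g: "AE x in lborel. x \<in> ball 0 R \<longrightarrow> v x = g (norm x)"
    and gt: "bliss_int q (\<lambda>t. g (R * exp (- t))) > ennreal ((k / bliss_const q) powr (q + 1))"
    and e: "e > 0"
  shows "ennreal (ang_mass TYPE('a) * k) \<le> ennreal (1 + e) * energy R G"
proof -
  have "\<exists>K. C1_cpt K (\<phi> n) \<and> K \<subseteq> ball 0 R" for n using Cc_infty_C1_cpt[OF \<phi>[of n]] by blast
  then obtain K where K: "\<And>n. C1_cpt (K n) (\<phi> n)" "\<And>n. K n \<subseteq> ball 0 R" by metis
  have [measurable]: "\<phi> n \<in> borel_measurable borel" "grad (\<phi> n) \<in> borel_measurable borel" for n
    using C1_cpt_measurable C1_cpt_grad_measurable K by blast+
  have [measurable]: "ray_energy R (\<phi> n) \<in> borel_measurable borel" for n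
    by (rule ray_energy_measurable[OF K(1)])
  define A where "A = density lborel (ang :: 'a \<Rightarrow> ennreal)"
  have "AE x in lborel. x \<in> ball 0 R \<longrightarrow> (\<lambda>n. \<phi> n x) \<longlonglongrightarrow> g (norm x)"
    using ae g by eventually_elim auto
  from AE_ray[OF this R]
  have "AE x in lborel. 0 < ang x \<longrightarrow> ennreal k \<le> liminf (\<lambda>n. ray_energy R (\<phi> n) x)"
  proof eventually_elim
    case (elim x)
    show ?case
    proof
      assume "0 < ang x"
      then have x: "x \<noteq> 0" and conv: "AE t in lborel. ray R x t \<in> ball 0 R \<longrightarrow> (\<lambda>n. \<phi> n (ray R x t)) \<longlonglongrightarrow> g (norm (ray R x t))"
        using elim by (auto simp: ang_def)
      have fatou: "bliss_int q (\<lambda>t. g (R * exp (- t))) \<le> liminf (\<lambda>n. bliss_int q (\<lambda>t. \<phi> n (ray R x t)))"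
      proof -
        have "bliss_int q (\<lambda>t. g (R * exp (- t))) = (\<integral>\<^sup>+t. liminf (\<lambda>n. ennreal (\<bar>\<phi> n (ray R x t)\<bar> powr (2 * q + 2) * t powr - (q + 2)) * indicator {0<..} t) \<partial>lborel)"
          unfolding bliss_int_def
        proof (rule nn_integral_cong_AE, use conv in eventually_elim)
          case (elim t)
          show ?case
          proof (cases "t > 0")
            case True
            then have "(\<lambda>n. \<phi> n (ray R x t)) \<longlonglongrightarrow> g (R * exp (- t))"
              using elim by (simp add: ray_in_ball[OF R x] norm_ray[OF R x] del: mem_ball mem_ball_0)
            then have "(\<lambda>n. ennreal (\<bar>\<phi> n (ray R x t)\<bar> powr (2 * q + 2) * t powr - (q + 2))) \<longlonglongrightarrow> ennreal (\<bar>g (R * exp (- t))\<bar> powr (2 * q + 2) * t powr - (q + 2))"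
              using q by (intro tendsto_intros tendsto_powr') auto
            then have "liminf (\<lambda>n. ennreal (\<bar>\<phi> n (ray R x t)\<bar> powr (2 * q + 2) * t powr - (q + 2))) = ennreal (\<bar>g (R * exp (- t))\<bar> powr (2 * q + 2) * t powr - (q + 2))"
              by (intro lim_imp_Liminf) auto
            then show ?thesis using True by simp
          qed (simp add: Liminf_const)
        qed
        also have "\<dots> \<le> liminf (\<lambda>n. bliss_int q (\<lambda>t. \<phi> n (ray R x t)))"
          unfolding bliss_int_def by (rule nn_integral_liminf) measurable
        finally show ?thesis .
      qed
      show "ennreal k \<le> liminf (\<lambda>n. ray_energy R (\<phi> n) x)"
      proof (rule ccontr)
        assume "\<not> ennreal k \<le> liminf (\<lambda>n. ray_energy R (\<phi> n) x)"
        then have "\<not> (\<forall>\<^sub>F n in sequentially. ennreal k \<le> ray_energy R (\<phi> n) x)"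
          by (rule contrapos_nn) (rule Liminf_bounded)
        then have "\<exists>\<^sub>F n in sequentially. ray_energy R (\<phi> n) x \<le> ennreal k"
          unfolding not_eventually by (rule frequently_elim1) (simp add: not_le less_imp_le)
        then have "\<exists>\<^sub>F n in sequentially. bliss_int q (\<lambda>t. \<phi> n (ray R x t)) \<le> ennreal ((k / bliss_const q) powr (q + 1))"
          by (rule frequently_elim1) (rule ray_bliss[OF R K x q k])
        then have "liminf (\<lambda>n. bliss_int q (\<lambda>t. \<phi> n (ray R x t))) \<le> ennreal ((k / bliss_const q) powr (q + 1))"
          by (rule liminf_frequently_le)
        from le_less_trans[OF order_trans[OF fatou this] gt] show False by (rule less_irrefl[THEN notE])
      qed
    qed
  qed
  then have "AE x in A. ennreal k \<le> liminf (\<lambda>n. ray_energy R (\<phi> n) x)"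
    unfolding A_def by (subst AE_density) auto
  then have "(\<integral>\<^sup>+x. ennreal k \<partial>A) \<le> (\<integral>\<^sup>+x. liminf (\<lambda>n. ray_energy R (\<phi> n) x) \<partial>A)"
    by (rule nn_integral_mono_AE)
  also have "\<dots> \<le> liminf (\<lambda>n. \<integral>\<^sup>+x. ray_energy R (\<phi> n) x \<partial>A)"
    by (rule nn_integral_liminf) (simp add: A_def)
  also have "\<dots> \<le> liminf (\<lambda>n. ennreal (1 + e) * energy R G + ennreal (1 + 1 / e) * energy R (\<lambda>x. grad (\<phi> n) x - G x))"
  proof (rule Liminf_mono, rule always_eventually, rule allI)
    fix n
    have "(\<integral>\<^sup>+x. ray_energy R (\<phi> n) x \<partial>A) = (\<integral>\<^sup>+x. ang x * ray_energy R (\<phi> n) x \<partial>lborel)"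
      unfolding A_def by (rule nn_integral_density) auto
    also have "\<dots> \<le> energy R (grad (\<phi> n))" by (rule ray_energy_le[OF R K(1)])
    also have "\<dots> \<le> ennreal (1 + e) * energy R G + ennreal (1 + 1 / e) * energy R (\<lambda>x. grad (\<phi> n) x - G x)"
      by (rule energy_triangle) (use G e in auto)
    finally show "(\<integral>\<^sup>+x. ray_energy R (\<phi> n) x \<partial>A) \<le> \<dots>" .
  qed
  also have "\<dots> = ennreal (1 + e) * energy R G"
  proof (rule lim_imp_Liminf)
    have "(\<lambda>n. ennreal (1 + e) * energy R G + ennreal (1 + 1 / e) * energy R (\<lambda>x. grad (\<phi> n) x - G x))
       \<longlonglongrightarrow> ennreal (1 + e) * energy R G + ennreal (1 + 1 / e) * 0"
      by (intro tendsto_add tendsto_const ennreal_tendsto_cmult limG) simp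
    then show "(\<lambda>n. ennreal (1 + e) * energy R G + ennreal (1 + 1 / e) * energy R (\<lambda>x. grad (\<phi> n) x - G x))
       \<longlonglongrightarrow> ennreal (1 + e) * energy R G" by simp
  qed simp
  also have "(\<integral>\<^sup>+x. ennreal k \<partial>A) = ennreal (ang_mass TYPE('a) * k)"
    unfolding A_def using k ang_mass_pos[where 'a='a]
    by (subst nn_integral_density) (auto simp: nn_integral_multc nn_integral_ang ennreal_mult)
  finally show ?thesis .
qed

lemma HS_ratio_lower_bound:
  fixes v :: "'a::euclidean_space \<Rightarrow> real"
  assumes R: "R > 0" and N: "DIM('a) \<ge> 3" and q: "q = 2 / (real DIM('a) - 2)" and v: "v \<in> W0_rad R"
  shows "bliss_const q * ang_mass TYPE('a) powr (q / (q + 1)) \<le> HS_ratio R v"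
proof -
  let ?\<omega> = "ang_mass TYPE('a)" and ?B = "ball (0::'a) R"
  have q0: "q > 0" using hs_exponents(5)[of "real DIM('a)" q] N q by simp
  have b0: "bliss_const q > 0" by (rule bliss_const_pos[OF q0])
  have w0: "?\<omega> > 0" by (rule ang_mass_pos)
  have vW: "v \<in> W0_ball R" and nz: "\<not> (AE x in lebesgue_on ?B. v x = 0)"
    and "\<exists>g. AE x in lebesgue_on ?B. v x = g (norm x)"
    using v by (auto simp: W0_rad_def radially_symmetric_on_def)
  then obtain g where "AE x in lebesgue_on ?B. v x = g (norm x)" by blast
  then have g: "AE x in lborel. x \<in> ?B \<longrightarrow> v x = g (norm x)"
    by (subst (asm) AE_restrict_space_iff) (auto simp: AE_completion_iff)
  have vm: "v \<in> borel_measurable (lebesgue_on ?B)" using vW by (simp add: W0_ball_def W0_12_def)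
  obtain \<phi> G where \<phi>: "\<And>n. \<phi> n \<in> Cc_infty ?B" and G: "G \<in> borel_measurable borel"
    and limG: "(\<lambda>n. energy R (\<lambda>x. grad (\<phi> n) x - G x)) \<longlonglongrightarrow> 0"
    and lim: "(\<lambda>n. \<integral>\<^sup>+x. ennreal ((\<phi> n x - v x)\<^sup>2) \<partial>lebesgue_on ?B) \<longlonglongrightarrow> 0"
    and ae: "AE x in lborel. x \<in> ?B \<longrightarrow> (\<lambda>n. \<phi> n x) \<longlonglongrightarrow> v x"
    using W0_ball_approx[OF R vW] by blast
  have wg: "is_weak_gradient ?B v G"
    by (rule weak_gradient_of_limit[OF R _ \<phi> vm lim G limG]) (use N in simp)
  have num: "HS_numerator R v = enn2real (energy R G)" by (rule HS_numerator_eq[OF wg G])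
  have fin: "energy R G < top"
  proof -
    have "\<forall>\<^sub>F n in sequentially. energy R (\<lambda>x. grad (\<phi> n) x - G x) < top"
      by (rule order_tendstoD(2)[OF limG]) simp
    then obtain n where n: "energy R (\<lambda>x. grad (\<phi> n) x - G x) < top"
      unfolding eventually_sequentially by blast
    obtain K where K: "C1_cpt K (\<phi> n)" by (rule Cc_infty_C1_cpt[OF \<phi>])
    obtain B where B: "\<And>x. norm (grad (\<phi> n) x) \<le> B" using C1_cpt_grad_bound[OF K] by blast
    have "energy R G \<le> ennreal (1 + 1) * energy R (grad (\<phi> n)) + ennreal (1 + 1 / 1) * energy R (\<lambda>x. G x - grad (\<phi> n) x)"
      by (rule energy_triangle[OF G C1_cpt_grad_measurable[OF K]]) simp
    also have "energy R (\<lambda>x. G x - grad (\<phi> n) x) = energy R (\<lambda>x. grad (\<phi> n) x - G x)"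
      by (simp add: energy_def norm_minus_commute)
    finally show ?thesis
      using n energy_finite[OF R B] by (auto simp: ennreal_mult_less_top elim!: le_less_trans)
  qed
  define E where "E = enn2real (energy R G)"
  have E: "energy R G = ennreal E" "E \<ge> 0" using fin by (auto simp: E_def)
  define \<kappa> where "\<kappa> = bliss_int q (\<lambda>t. g (R * exp (- t)))"
  have bound: "?\<omega> * k \<le> E" if k: "k \<ge> 0" "\<kappa> > ennreal ((k / bliss_const q) powr (q + 1))" for k
  proof -
    have "?\<omega> * k \<le> (1 + e) * E" if e: "e > 0" for e
    proof -
      have "ennreal (?\<omega> * k) \<le> ennreal (1 + e) * energy R G"
        by (rule energy_lower_bound[OF R q0 k(1) \<phi> G limG ae g k(2)[unfolded \<kappa>_def] e])
      also have "\<dots> = ennreal ((1 + e) * E)" unfolding E(1) by (rule ennreal_mult[symmetric]) (use E e in auto)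
      finally show ?thesis using E e by (subst (asm) ennreal_le_iff) auto
    qed
    moreover have "((\<lambda>e. (1 + e) * E) \<longlongrightarrow> (1 + 0) * E) (at_right 0)"
      by (intro tendsto_intros)
    ultimately have "?\<omega> * k \<le> (1 + 0) * E"
      by (intro tendsto_lowerbound[where F="at_right 0"]) (auto simp: eventually_at_filter)
    then show ?thesis by simp
  qed
  \<comment> \<open>An infinite integral would admit every level, in particular one that pushes the
    bound above \<open>E\<close>. The case must be excluded because \<open>enn2real\<close> would
    make the denominator 0.\<close>
  have "\<kappa> \<noteq> top"
  proof
    assume "\<kappa> = top"
    then have "?\<omega> * (E / ?\<omega> + 1) \<le> E" using E w0 by (intro bound) (auto simp: ennreal_less_top)
    moreover have "?\<omega> * (E / ?\<omega> + 1) = E + ?\<omega>" using w0 by (simp add: distrib_left)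
    ultimately show False using w0 by linarith
  qed
  then obtain c where c: "\<kappa> = ennreal c" "c \<ge> 0" by (cases \<kappa>) auto
  have "c \<noteq> 0" using bliss_int_nonzero[OF R N q vm g nz] c by (auto simp: \<kappa>_def)
  then have c0: "c > 0" using c by simp
  \<comment> \<open>The level must lie strictly below the optimal one, so it is approached by
    factors \<open>z < 1\<close>.\<close>
  have main: "?\<omega> * (bliss_const q * c powr (1 / (q + 1))) \<le> E"
  proof (rule field_le_mult_one_interval)
    fix z :: real assume z: "0 < z" "z < 1"
    have "?\<omega> * (z * (bliss_const q * c powr (1 / (q + 1)))) \<le> E"
    proof (rule bound)
      show "0 \<le> z * (bliss_const q * c powr (1 / (q + 1)))" using z b0 by simp
      have "(z * (bliss_const q * c powr (1 / (q + 1))) / bliss_const q) powr (q + 1) = z powr (q + 1) * c"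
        using b0 q0 c0 by (simp add: powr_mult powr_powr)
      also have "\<dots> < 1 * c" using z q0 c0 by (intro mult_strict_right_mono) (auto simp: powr01_less_one)
      finally show "ennreal ((z * (bliss_const q * c powr (1 / (q + 1))) / bliss_const q) powr (q + 1)) < \<kappa>"
        using c c0 by (simp add: ennreal_less_iff)
    qed
    then show "z * (?\<omega> * (bliss_const q * c powr (1 / (q + 1)))) \<le> E" by (simp add: mult_ac)
  qed
  have den: "HS_denominator R v = ?\<omega> powr (1 / (q + 1)) * c powr (1 / (q + 1))"
    unfolding HS_denominator_eq[OF R N q vm g] \<kappa>_def[symmetric] using c by (simp add: powr_mult)
  have w1: "?\<omega> powr (q / (q + 1)) * ?\<omega> powr (1 / (q + 1)) = ?\<omega>"
  proof -
    have "q / (q + 1) + 1 / (q + 1) = 1" using q0 by (simp add: field_simps)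
    then show ?thesis using w0 by (simp add: powr_add[symmetric])
  qed
  have "bliss_const q * ?\<omega> powr (q / (q + 1)) * (?\<omega> powr (1 / (q + 1)) * c powr (1 / (q + 1)))
     = ?\<omega> * (bliss_const q * c powr (1 / (q + 1)))"
    using w1 by (simp add: mult_ac)
  also have "\<dots> \<le> E" by (rule main)
  finally have "bliss_const q * ?\<omega> powr (q / (q + 1)) \<le> E / (?\<omega> powr (1 / (q + 1)) * c powr (1 / (q + 1)))"
    using w0 c0 by (subst pos_le_divide_eq) auto
  then show ?thesis unfolding HS_ratio_def num den E_def .
qed

section \<open>Beta integrals and the constant\<close>

text \<open>For a nonnegative integrand, substitution also transfers integrability. It is read off
  from the Beta density, and no separate estimate at the singular endpoints \<open>A\<close> and
  \<open>B\<close> is needed.\<close>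

lemma Beta_substitution:
  fixes f T T' :: "real \<Rightarrow> real" and A B :: ereal
  assumes T: "\<And>z. 0 < z \<Longrightarrow> z < 1 \<Longrightarrow> (T has_real_derivative T' z) (at z)"
    and T'c: "\<And>z. 0 < z \<Longrightarrow> z < 1 \<Longrightarrow> isCont T' z"
    and fc: "\<And>z. 0 < z \<Longrightarrow> z < 1 \<Longrightarrow> isCont f (T z)"
    and f0: "\<And>z. 0 < z \<Longrightarrow> z < 1 \<Longrightarrow> 0 \<le> f (T z)"
    and T'0: "\<And>z. 0 \<le> z \<Longrightarrow> z \<le> 1 \<Longrightarrow> 0 \<le> T' z"
    and A: "((\<lambda>z. ereal (T z)) \<longlongrightarrow> A) (at_right 0)"
    and B: "((\<lambda>z. ereal (T z)) \<longlongrightarrow> B) (at_left 1)"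
    and eq: "\<And>z. 0 < z \<Longrightarrow> z < 1 \<Longrightarrow> f (T z) * T' z = c * (z powr (\<alpha> - 1) * (1 - z) powr (\<beta> - 1))"
    and ab: "\<alpha> > 0" "\<beta> > 0"
  shows "set_integrable lborel (einterval A B) f" "(LBINT x=A..B. f x) = c * Beta \<alpha> \<beta>"
proof -
  let ?b = "\<lambda>z::real. c * (z powr (\<alpha> - 1) * (1 - z) powr (\<beta> - 1))"
  have B1: "((\<lambda>t. t powr (\<alpha> - 1) * (1 - t) powr (\<beta> - 1)) has_integral Beta \<alpha> \<beta>) {0<..<1}"
    using has_integral_Beta_real[OF ab] by (simp add: has_integral_Icc_iff_Ioo)
  have "(\<lambda>t. t powr (\<alpha> - 1) * (1 - t) powr (\<beta> - 1)) absolutely_integrable_on {0<..<1}"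
    using B1 by (intro nonnegative_absolutely_integrable_1) (auto simp: has_integral_integrable)
  then have "set_integrable lborel {0<..<1} (\<lambda>t. t powr (\<alpha> - 1) * (1 - t) powr (\<beta> - 1))"
    unfolding set_integrable_def by (subst (asm) integrable_completion) auto
  then have bi: "set_integrable lborel {0<..<1} ?b"
    by (rule set_integrable_mult_right)
  have bint: "(LINT z:{0<..<1}|lborel. ?b z) = c * Beta \<alpha> \<beta>"
    by (rule trans[OF set_borel_integral_eq_integral(2)[OF bi] integral_unique[OF has_integral_mult_right[OF B1]]])
  have cong: "indicator {0<..<1} z *\<^sub>R (f (T z) * T' z) = indicator {0<..<1} z *\<^sub>R ?b z" for z :: real
    using eq[of z] by (auto simp: indicator_def)
  have e: "einterval 0 1 = {0<..<1::real}" by (simp add: zero_ereal_def one_ereal_def)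
  have int: "set_integrable lborel (einterval 0 1) (\<lambda>z. f (T z) * T' z)"
    using bi unfolding e set_integrable_def cong .
  have A': "((ereal \<circ> T \<circ> real_of_ereal) \<longlongrightarrow> A) (at_right 0)"
  proof -
    have "((ereal \<circ> T) \<longlongrightarrow> A) (at_right 0)" using A by (simp add: o_def)
    then show ?thesis by (simp only: zero_ereal_def ereal_tendsto_simps)
  qed
  have B': "((ereal \<circ> T \<circ> real_of_ereal) \<longlongrightarrow> B) (at_left 1)"
  proof -
    have "((ereal \<circ> T) \<longlongrightarrow> B) (at_left 1)" using B by (simp add: o_def)
    then show ?thesis by (simp only: one_ereal_def ereal_tendsto_simps)
  qed
  have sub: "set_integrable lborel (einterval A B) f" "(LBINT x=A..B. f x) = (LBINT z=0..1. f (T z) * T' z)"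
    by (rule interval_integral_substitution_nonneg[of 0 1 T T' f];
        (rule A' B' int)?; use T T'c fc f0 T'0 in \<open>simp add: zero_ereal_def one_ereal_def\<close>)+
  show "set_integrable lborel (einterval A B) f" by (rule sub(1))
  have "(LBINT z=0..1. f (T z) * T' z) = (LINT z:{0<..<1}|lborel. ?b z)"
    unfolding interval_lebesgue_integral_def e set_lebesgue_integral_def cong by simp
  then show "(LBINT x=A..B. f x) = c * Beta \<alpha> \<beta>" using sub(2) bint by simp
qed

text \<open>The substitution \<open>u = z powr (1 / (2 * q))\<close> turns
  \<open>u powr (2 * q)\<close> into \<open>z\<close>, and the density becomes a power of
  \<open>z\<close> times \<open>sqrt (1 - z)\<close>.\<close>

lemma bliss_half_Beta:
  assumes q: "q > 0"
  shows "bliss_half q = 1 / (2 * q) * Beta (1 / q) (3 / 2)"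
proof -
  define a where "a = 1 / q"
  have a: "a > 0" "a * q = 1" using q by (auto simp: a_def)
  let ?T = "\<lambda>z::real. z powr (a / 2)" and ?T' = "\<lambda>z::real. a / 2 * z powr (a / 2 - 1)"
  have "(LBINT x=0..1. bliss_dens q x) = a / 2 * Beta a (3 / 2)"
  proof (rule Beta_substitution(2)[where T="?T" and T'="?T'"])
    fix z :: real assume z: "0 < z" "z < 1"
    show "(?T has_real_derivative ?T' z) (at z)" using z by (intro has_real_derivative_powr)
    show "isCont ?T' z" using z by (intro continuous_intros) auto
    show "isCont (bliss_dens q) (?T z)"
      using bliss_dens_cont[OF q, of UNIV] by (simp add: continuous_on_eq_continuous_at)
    show "0 \<le> bliss_dens q (?T z)" by (rule bliss_dens_nonneg)
    have "(z powr (a / 2)) powr (2 * q) = z" using z a by (simp add: powr_powr)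
    then have "bliss_dens q (?T z) = z powr (a / 2) * (1 - z) powr (1 / 2)"
      using z by (simp add: bliss_dens_def powr_half_sqrt)
    then show "bliss_dens q (?T z) * ?T' z = a / 2 * (z powr (a - 1) * (1 - z) powr (3 / 2 - 1))"
      using z by (simp add: mult_ac powr_add[symmetric] flip: powr_add)
  next
    fix z :: real assume "0 \<le> z" "z \<le> 1" then show "0 \<le> ?T' z" using a by simp
  next
    have "(?T \<longlongrightarrow> 0) (at_right 0)"
      using a by (intro tendsto_zero_powrI[OF tendsto_ident_at tendsto_const]) (auto simp: eventually_at_filter)
    then show "((\<lambda>z. ereal (?T z)) \<longlongrightarrow> 0) (at_right 0)" by (simp add: zero_ereal_def)
    have "(?T \<longlongrightarrow> 1 powr (a / 2)) (at_left 1)" by (intro tendsto_intros) auto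
    then show "((\<lambda>z. ereal (?T z)) \<longlongrightarrow> 1) (at_left 1)" by (simp add: one_ereal_def)
  qed (use a in auto)
  moreover have "(LBINT x=0..1. bliss_dens q x) = integral {0..1} (bliss_dens q)"
  proof -
    have "set_integrable lborel {0..1} (bliss_dens q)"
      unfolding set_integrable_def by (rule borel_integrable_compact) (auto intro: bliss_dens_cont[OF q])
    then show ?thesis
      using interval_integral_eq_integral[of 0 1 "bliss_dens q"] by (simp add: zero_ereal_def one_ereal_def)
  qed
  ultimately show ?thesis by (simp add: bliss_half_eq[OF q] a_def)
qed

section \<open>Integrals of the extremal profiles\<close>

definition ext_prof :: "real \<Rightarrow> real \<Rightarrow> real \<Rightarrow> real \<Rightarrow> real" where
  "ext_prof q \<mu> \<nu> t = (\<mu>\<^sup>2 + \<nu>\<^sup>2 * t powr - q) powr - (1 / q)"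

definition ext_prof' :: "real \<Rightarrow> real \<Rightarrow> real \<Rightarrow> real \<Rightarrow> real" where
  "ext_prof' q \<mu> \<nu> t = \<nu>\<^sup>2 * t powr (- q - 1) * (\<mu>\<^sup>2 + \<nu>\<^sup>2 * t powr - q) powr (- (1 / q) - 1)"

lemma ext_prof_base_pos: "\<mu> \<noteq> 0 \<Longrightarrow> \<mu>\<^sup>2 + \<nu>\<^sup>2 * t powr - q > (0::real)"
  by (intro add_pos_nonneg) auto

lemma ext_prof_deriv:
  assumes "q > 0" "\<mu> \<noteq> 0" "t > 0"
  shows "(ext_prof q \<mu> \<nu> has_real_derivative ext_prof' q \<mu> \<nu> t) (at t)"
proof -
  have "((\<lambda>t. \<mu>\<^sup>2 + \<nu>\<^sup>2 * t powr - q) has_real_derivative \<nu>\<^sup>2 * (- q * t powr (- q - 1))) (at t)"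
    using assms by (auto intro!: derivative_eq_intros has_real_derivative_powr)
  from DERIV_chain2[OF has_real_derivative_powr[OF ext_prof_base_pos[OF assms(2)], of "- (1 / q)"] this]
  show ?thesis unfolding ext_prof_def[abs_def] ext_prof'_def
    using assms by (simp add: mult_ac)
qed

text \<open>A single substitution makes both integrands Beta densities. The parameters survive only
  in powers of \<open>(\<mu> * \<nu>)\<^sup>2\<close>, with exponents \<open>- a\<close> and
  \<open>- (a + 1)\<close> that will cancel in the quotient.\<close>

lemma
  fixes q \<mu> \<nu> :: real
  assumes q: "q > 0" and \<mu>: "\<mu> \<noteq> 0" and \<nu>: "\<nu> \<noteq> 0"
  defines "s \<equiv> (\<mu> * \<nu>)\<^sup>2" and "a \<equiv> 1 / q"
  shows ext_prof_energy: "(\<integral>\<^sup>+t\<in>{0<..}. ennreal ((ext_prof' q \<mu> \<nu> t)\<^sup>2) \<partial>lborel) = ennreal (a * s powr - a * Beta a (a + 2))"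
    and ext_prof_bliss_int: "bliss_int q (ext_prof q \<mu> \<nu>) = ennreal (a * s powr - (a + 1) * Beta (a + 1) (a + 1))"
proof -
  have a: "a > 0" "a * q = 1" using q by (auto simp: a_def)
  \<comment> \<open>\<open>T\<close> is the inverse of the substitution \<open>z = \<mu>\<^sup>2 / (\<mu>\<^sup>2 + \<nu>\<^sup>2 * t powr - q)\<close>.\<close>
  define \<kappa> where "\<kappa> = \<nu>\<^sup>2 / \<mu>\<^sup>2"
  have \<kappa>: "\<kappa> > 0" using \<mu> \<nu> by (simp add: \<kappa>_def)
  define u where "u z = \<kappa> * z / (1 - z)" for z
  define T where "T z = u z powr a" for z
  define T' where "T' z = a * T z / (z * (1 - z))" for z
  define m where "m = \<mu>\<^sup>2"
  have m: "m > 0" using \<mu> by (simp add: m_def)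
  have n: "\<nu>\<^sup>2 = \<kappa> * m" "s = m * (\<kappa> * m)" using \<mu> by (auto simp: \<kappa>_def m_def s_def power_mult_distrib)
  have u: "u z > 0" if "0 < z" "z < 1" for z using that \<kappa> by (simp add: u_def)
  have Td: "(T has_real_derivative T' z) (at z)" if z: "0 < z" "z < 1" for z
  proof -
    have "(u has_real_derivative (\<kappa> * (1 - z) - \<kappa> * z * (- 1)) / ((1 - z) * (1 - z))) (at z)"
      unfolding u_def[abs_def] using z by (auto intro!: derivative_eq_intros)
    moreover have "(\<kappa> * (1 - z) - \<kappa> * z * (- 1)) / ((1 - z) * (1 - z)) = u z / (z * (1 - z))"
    proof -
      have "\<kappa> * (1 - z) - \<kappa> * z * (- 1) = \<kappa>" by (simp add: algebra_simps)
      then show ?thesis using z by (simp add: u_def)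
    qed
    ultimately have "(u has_real_derivative u z / (z * (1 - z))) (at z)" by metis
    from DERIV_chain2[OF has_real_derivative_powr[OF u[OF z], of a] this]
    have "(T has_real_derivative a * u z powr (a - 1) * (u z / (z * (1 - z)))) (at z)"
      unfolding T_def[abs_def] .
    moreover have "u z powr (a - 1) * u z = T z"
      using u[OF z] by (simp add: T_def powr_diff)
    ultimately show ?thesis unfolding T'_def by (metis (no_types, lifting) mult.assoc times_divide_eq_right)
  qed
  have T'c: "isCont T' z" if z: "0 < z" "z < 1" for z
    unfolding T'_def[abs_def] using z DERIV_isCont[OF Td[OF z]] by (intro continuous_intros) auto
  \<comment> \<open>The endpoints are included; there \<open>T'\<close> is 0 because division by 0
    yields 0.\<close>
  have T'0: "0 \<le> T' z" if "0 \<le> z" "z \<le> 1" for z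
    using that a by (auto simp: T'_def T_def intro!: divide_nonneg_nonneg mult_nonneg_nonneg)
  have Tpos: "T z > 0" if "0 < z" "z < 1" for z using u[OF that] by (simp add: T_def)
  have lim0: "((\<lambda>z. ereal (T z)) \<longlongrightarrow> 0) (at_right 0)"
  proof -
    have "(u \<longlongrightarrow> \<kappa> * 0 / (1 - 0)) (at_right 0)" unfolding u_def[abs_def] by (intro tendsto_intros) auto
    then have u0: "(u \<longlongrightarrow> 0) (at_right 0)" by simp
    have "eventually (\<lambda>z. 0 \<le> u z) (at_right 0)"
      unfolding eventually_at_right_field using u by (intro exI[of _ 1]) (auto intro: less_imp_le)
    then have "(T \<longlongrightarrow> 0) (at_right 0)" unfolding T_def[abs_def]
      by (intro tendsto_zero_powrI[OF u0 tendsto_const]) (use a in auto)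
    then show ?thesis by (simp add: zero_ereal_def)
  qed
  have lim1: "((\<lambda>z. ereal (T z)) \<longlongrightarrow> \<infinity>) (at_left 1)"
  proof -
    have "filterlim u at_top (at_left 1)" unfolding u_def[abs_def]
    proof (rule LIM_at_top_divide)
      have "((\<lambda>z. \<kappa> * z) \<longlongrightarrow> \<kappa> * 1) (at_left 1)" by (intro tendsto_intros)
      then show "((\<lambda>z. \<kappa> * z) \<longlongrightarrow> \<kappa>) (at_left 1)" by simp
      show "0 < \<kappa>" by (rule \<kappa>)
      have "((\<lambda>z::real. 1 - z) \<longlongrightarrow> 1 - 1) (at_left 1)" by (intro tendsto_intros)
      then show "((\<lambda>z::real. 1 - z) \<longlongrightarrow> 0) (at_left 1)" by simp
      show "eventually (\<lambda>z::real. 0 < 1 - z) (at_left 1)" by (auto simp: eventually_at_filter)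
    qed
    then have "filterlim (\<lambda>z. exp (a * ln (u z))) at_top (at_left 1)"
      by (intro filterlim_compose[OF exp_at_top] filterlim_tendsto_pos_mult_at_top[OF tendsto_const a(1)]
          filterlim_compose[OF ln_at_top])
    moreover have "eventually (\<lambda>z. exp (a * ln (u z)) = T z) (at_left 1)"
    proof -
      have "exp (a * ln (u z)) = T z" if "0 < z" "z < 1" for z
        using u[OF that] by (simp add: T_def powr_def)
      then show ?thesis unfolding eventually_at_left_field by (intro exI[of _ 0]) auto
    qed
    ultimately have "filterlim T at_top (at_left 1)"
      by (rule filterlim_cong[OF refl refl, THEN iffD1, rotated])
    then show ?thesis by (simp add: tendsto_PInfty_eq_at_top)
  qed
  have Tq: "T z powr - q = (1 - z) / (\<kappa> * z)" if z: "0 < z" "z < 1" for z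
    using z u[OF z] a \<kappa> by (simp add: T_def powr_powr powr_neg_one) (simp add: u_def)
  have base: "\<mu>\<^sup>2 + \<kappa> * m * T z powr - q = m / z" if z: "0 < z" "z < 1" for z
    unfolding Tq[OF z] using z \<kappa> by (simp add: m_def[symmetric] field_simps)
  have Tpow: "T z powr r = \<kappa> powr (a * r) * z powr (a * r) * (1 - z) powr (- (a * r))" if z: "0 < z" "z < 1" for z r
    using z by (simp add: T_def u_def powr_powr powr_mult powr_divide powr_minus_divide)
  have T'eq: "T' z = a * T z powr 1 * z powr (-1) * (1 - z) powr (-1)" if z: "0 < z" "z < 1" for z
    using z Tpos[OF z] by (simp add: T'_def powr_neg_one)
  have mz: "(m / z) powr r = m powr r * z powr - r" if "0 < z" for z r :: real
    using that by (simp add: powr_divide powr_minus_divide)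
  have spow: "s powr r = m powr (2 * r) * \<kappa> powr r" for r
    unfolding n(2) powr_mult using m by (simp add: mult_ac flip: powr_add)
  have e: "einterval 0 \<infinity> = {0<..}" by (simp add: zero_ereal_def)
  have conv: "(\<integral>\<^sup>+t\<in>{0<..}. ennreal (f t) \<partial>lborel) = ennreal c"
    if "set_integrable lborel (einterval 0 \<infinity>) f" "(LBINT x=0..\<infinity>. f x) = c" "\<And>t. t > 0 \<Longrightarrow> 0 \<le> f t" for f c
  proof -
    have "(\<integral>\<^sup>+t\<in>{0<..}. ennreal (f t) \<partial>lborel) = (\<integral>\<^sup>+t. ennreal (indicator {0<..} t *\<^sub>R f t) \<partial>lborel)"
      by (intro nn_integral_cong) (auto simp: indicator_def)
    also have "\<dots> = ennreal (\<integral>t. indicator {0<..} t *\<^sub>R f t \<partial>lborel)"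
      by (rule nn_integral_eq_integral) (use that in \<open>auto simp: set_integrable_def e indicator_def\<close>)
    also have "(\<integral>t. indicator {0<..} t *\<^sub>R f t \<partial>lborel) = c"
      using that(2) by (simp add: interval_lebesgue_integral_def e set_lebesgue_integral_def)
    finally show ?thesis .
  qed
  have fc1: "isCont (\<lambda>t. (ext_prof' q \<mu> \<nu> t)\<^sup>2) t" if "t > 0" for t
    unfolding ext_prof'_def[abs_def] using that ext_prof_base_pos[OF \<mu>, of \<nu> t q]
    by (intro continuous_intros) auto
  have fc2: "isCont (\<lambda>t. \<bar>ext_prof q \<mu> \<nu> t\<bar> powr (2 * q + 2) * t powr - (q + 2)) t" if "t > 0" for t
    unfolding ext_prof_def[abs_def] using that ext_prof_base_pos[OF \<mu>, of \<nu> t q]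
    by (intro continuous_intros) auto
  have I1: "(ext_prof' q \<mu> \<nu> (T z))\<^sup>2 * T' z = a * s powr - a * (z powr (a - 1) * (1 - z) powr (a + 2 - 1))"
    if z: "0 < z" "z < 1" for z
  proof -
    have "(ext_prof' q \<mu> \<nu> (T z))\<^sup>2 = (\<kappa> * m)\<^sup>2 * (T z powr (- q - 1))\<^sup>2 * ((m / z) powr (- a - 1))\<^sup>2"
      unfolding ext_prof'_def n(1) base[OF z] by (simp add: power_mult_distrib a_def)
    also have "(T z powr (- q - 1))\<^sup>2 = T z powr (- 2 * q - 2)" using Tpos[OF z] by (simp add: powr_power algebra_simps)
    also have "((m / z) powr (- a - 1))\<^sup>2 = (m / z) powr (- 2 * a - 2)" using m z by (simp add: powr_power algebra_simps)
    also have "(\<kappa> * m)\<^sup>2 = \<kappa> powr 2 * m powr 2" using \<kappa> m by (simp add: power_mult_distrib)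
    finally have "(ext_prof' q \<mu> \<nu> (T z))\<^sup>2 * T' z = a * (m powr 2 * m powr (- 2 * a - 2)) * (\<kappa> powr 2)
       * (T z powr (- 2 * q - 2) * T z powr 1) * (z powr - (- 2 * a - 2) * z powr -1) * (1 - z) powr (-1)"
      unfolding T'eq[OF z] mz[OF z(1)] by (simp only: mult_ac)
    also have "T z powr (- 2 * q - 2) * T z powr 1 = T z powr (- 2 * q - 1)"
    proof -
      have "(- 2 * q - 2) + 1 = - 2 * q - 1" by simp
      then show ?thesis by (simp only: powr_add[symmetric])
    qed
    also have "\<dots> = \<kappa> powr (- 2 - a) * z powr (- 2 - a) * (1 - z) powr (2 + a)"
    proof -
      have "a * (- 2 * q - 1) = - 2 * (a * q) - a" by (simp add: algebra_simps)
      then have "a * (- 2 * q - 1) = - 2 - a" "- (a * (- 2 * q - 1)) = 2 + a" using a(2) by simp_all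
      then show ?thesis unfolding Tpow[OF z] by (simp only:)
    qed
    finally have "(ext_prof' q \<mu> \<nu> (T z))\<^sup>2 * T' z = a * (m powr 2 * m powr (- 2 * a - 2)) * (\<kappa> powr 2 * \<kappa> powr (- 2 - a))
       * (z powr (- 2 - a) * (z powr - (- 2 * a - 2) * z powr -1)) * ((1 - z) powr (2 + a) * (1 - z) powr (-1))"
      by (simp only: mult_ac)
    also have "\<dots> = a * s powr - a * (z powr (a - 1) * (1 - z) powr (a + 2 - 1))"
      unfolding spow powr_add[symmetric] by (simp add: algebra_simps)
    finally show ?thesis .
  qed
  have I2: "\<bar>ext_prof q \<mu> \<nu> (T z)\<bar> powr (2 * q + 2) * T z powr - (q + 2) * T' z
     = a * s powr - (a + 1) * (z powr (a + 1 - 1) * (1 - z) powr (a + 1 - 1))"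
    if z: "0 < z" "z < 1" for z
  proof -
    have "\<bar>ext_prof q \<mu> \<nu> (T z)\<bar> powr (2 * q + 2) = (m / z) powr (- a * (2 * q + 2))"
      unfolding ext_prof_def n(1) base[OF z] by (simp add: powr_powr a_def)
    also have "- a * (2 * q + 2) = - 2 * (a * q) - 2 * a" by (simp add: algebra_simps)
    also have "\<dots> = - 2 - 2 * a" using a(2) by simp
    finally have "\<bar>ext_prof q \<mu> \<nu> (T z)\<bar> powr (2 * q + 2) * T z powr - (q + 2) * T' z =
      a * m powr (- 2 - 2 * a) * (T z powr - (q + 2) * T z powr 1) * (z powr - (- 2 - 2 * a) * z powr -1) * (1 - z) powr -1"
      unfolding T'eq[OF z] mz[OF z(1)] by (simp only: mult_ac)
    also have "T z powr - (q + 2) * T z powr 1 = T z powr (- q - 1)"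
    proof -
      have "- (q + 2) + 1 = - q - 1" by simp
      then show ?thesis by (simp only: powr_add[symmetric])
    qed
    also have "\<dots> = \<kappa> powr (- 1 - a) * z powr (- 1 - a) * (1 - z) powr (1 + a)"
    proof -
      have "a * (- q - 1) = - (a * q) - a" by (simp add: algebra_simps)
      then have "a * (- q - 1) = - 1 - a" "- (a * (- q - 1)) = 1 + a" using a(2) by simp_all
      then show ?thesis unfolding Tpow[OF z] by (simp only:)
    qed
    finally have "\<bar>ext_prof q \<mu> \<nu> (T z)\<bar> powr (2 * q + 2) * T z powr - (q + 2) * T' z =
      a * (m powr (- 2 - 2 * a) * \<kappa> powr (- 1 - a)) * (z powr (- 1 - a) * (z powr - (- 2 - 2 * a) * z powr -1)) * ((1 - z) powr (1 + a) * (1 - z) powr -1)"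
      by (simp only: mult_ac)
    also have "\<dots> = a * s powr - (a + 1) * (z powr (a + 1 - 1) * (1 - z) powr (a + 1 - 1))"
      unfolding spow powr_add[symmetric] by (simp add: algebra_simps)
    finally show ?thesis .
  qed
  show "(\<integral>\<^sup>+t\<in>{0<..}. ennreal ((ext_prof' q \<mu> \<nu> t)\<^sup>2) \<partial>lborel) = ennreal (a * s powr - a * Beta a (a + 2))"
    using Beta_substitution[OF Td T'c fc1[OF Tpos] _ T'0 lim0 lim1 I1] a by (intro conv) auto
  show "bliss_int q (ext_prof q \<mu> \<nu>) = ennreal (a * s powr - (a + 1) * Beta (a + 1) (a + 1))"
    unfolding bliss_int_def
    using Beta_substitution[OF Td T'c fc2[OF Tpos] _ T'0 lim0 lim1 I2] a by (intro conv) auto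
qed

section \<open>Gamma identities that match the constants\<close>

lemma Gamma_legendre_duplication_real:
  assumes "x > (0::real)"
  shows "Gamma x * Gamma (x + 1 / 2) = 2 powr (1 - 2 * x) * sqrt pi * Gamma (2 * x)"
proof -
  have nn: "complex_of_real y \<notin> \<int>\<^sub>\<le>\<^sub>0" if "y > 0" for y
    using that by (auto simp: of_real_in_nonpos_Ints_iff)
  have "complex_of_real (Gamma x * Gamma (x + 1 / 2)) = Gamma (complex_of_real x) * Gamma (complex_of_real x + 1 / 2)"
    using Gamma_complex_of_real[of "x + 1 / 2"] by (simp add: Gamma_complex_of_real)
  also have "\<dots> = exp ((1 - 2 * complex_of_real x) * of_real (ln 2)) * of_real (sqrt pi) * Gamma (2 * complex_of_real x)"
    using nn[OF assms] nn[of "x + 1 / 2"] assms by (intro Gamma_legendre_duplication) auto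
  also have "\<dots> = complex_of_real (exp ((1 - 2 * x) * ln 2) * sqrt pi * Gamma (2 * x))"
    using Gamma_complex_of_real[of "2 * x"] by (simp flip: exp_of_real)
  finally show ?thesis by (simp only: of_real_eq_iff powr_def) simp
qed

text \<open>The left side comes from the lower bound and the right side from the extremals. The
  duplication formula at \<open>a + 1\<close> identifies them, and its power of 2 supplies the
  factor \<open>4 powr - a\<close>.\<close>

lemma bliss_half_Gamma:
  assumes a: "a > 0"
  shows "4 powr - a * (2 * bliss_half (1 / a)) = Beta (a + 1) (a + 1)"
proof -
  have pos: "Gamma (a + 3 / 2) > 0" "Gamma (2 * a + 2) > 0" "Gamma (a + 1) > 0" using a by auto
  have g1: "a * Gamma a = Gamma (a + 1)" using a by (subst Gamma_plus1) (auto elim: nonpos_Ints_cases)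
  have g2: "Gamma (3 / 2 :: real) = sqrt pi / 2"
  proof -
    have "(1 / 2 :: real) \<notin> \<int>\<^sub>\<le>\<^sub>0" using nonpos_Ints_nonpos[of "1 / 2 :: real"] by auto
    then show ?thesis using Gamma_plus1[of "1 / 2 :: real"] by (simp add: Gamma_one_half_real)
  qed
  have d: "Gamma (a + 1) * Gamma (a + 3 / 2) = 2 powr (- 1 - 2 * a) * sqrt pi * Gamma (2 * a + 2)"
    using Gamma_legendre_duplication_real[of "a + 1"] a by (simp add: algebra_simps)
  have p: "4 powr - a = (2::real) powr (- 2 * a)"
    using powr_powr[of 2 2 "- a"] by simp
  have p2: "2 powr (- 1 - 2 * a) = 4 powr - a / (2::real)"
    unfolding p by (simp add: powr_diff powr_minus_divide)
  have h: "2 * bliss_half (1 / a) = Gamma (a + 1) * (sqrt pi / 2) / Gamma (a + 3 / 2)"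
    using bliss_half_Beta[of "1 / a"] a by (simp add: Beta_def g2 g1[symmetric])
  have B: "Beta (a + 1) (a + 1) = Gamma (a + 1) * Gamma (a + 1) / Gamma (2 * a + 2)"
    by (simp add: Beta_def)
  have "4 powr - a * (Gamma (a + 1) * (sqrt pi / 2)) * Gamma (2 * a + 2) = Gamma (a + 1) * (Gamma (a + 1) * Gamma (a + 3 / 2))"
    unfolding d p2 by simp
  then show ?thesis unfolding h B using pos by (simp add: field_simps)
qed

text \<open>Brings the constant of the lower bound into the form in which the extremals produce it.
  The number 1/4 from the term with \<open>J\<close> in \<open>bliss_young\<close> becomes the
  factor \<open>4 powr - a\<close> that the preceding identity absorbs.\<close>

lemma bliss_const_Beta:
  assumes a: "a > 0"
  shows "bliss_const (1 / a) = (a + 1) / a * (a * Beta (a + 1) (a + 1)) powr (1 / (a + 1))"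
proof -
  define h where "h = bliss_half (1 / a)"
  have h: "h > 0" unfolding h_def by (rule bliss_half_pos) (use a in simp)
  have e: "1 / (1 / a + 1) = a * (1 / (a + 1))" "1 / a / (1 / a + 1) = 1 / (a + 1)" "1 / a + 1 = (a + 1) / a"
    using a by (auto simp: field_simps)
  have "bliss_const (1 / a) = (a + 1) / a * ((1/4) powr (a * (1 / (a + 1))) * (2 * h * a) powr (1 / (a + 1)))"
    unfolding bliss_const_def h_def[symmetric] e using a by simp
  also have "(1/4) powr (a * (1 / (a + 1))) = (4 powr - a) powr (1 / (a + 1))"
  proof -
    have "(1/4::real) powr a = 4 powr - a" by (simp add: powr_divide powr_minus_divide)
    then show ?thesis by (metis powr_powr)
  qed
  also have "(4 powr - a) powr (1 / (a + 1)) * (2 * h * a) powr (1 / (a + 1)) = (a * (4 powr - a * (2 * h))) powr (1 / (a + 1))"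
    unfolding powr_mult[symmetric] by (simp add: mult_ac)
  finally show ?thesis unfolding h_def bliss_half_Gamma[OF a] .
qed

lemma C_HS_eq:
  assumes N: "DIM('a::euclidean_space) \<ge> 3" and q: "q = 2 / (real DIM('a) - 2)"
  shows "C_HS DIM('a) = bliss_const q * ang_mass TYPE('a) powr (q / (q + 1))"
proof -
  define n where "n = real DIM('a)"
  define a where "a = (n - 2) / 2"
  have n: "n \<ge> 3" using N by (simp add: n_def)
  have a: "a > 0" "n = 2 * a + 2" using n by (auto simp: a_def field_simps)
  have qa: "q = 1 / a" unfolding q n_def[symmetric] a_def using n by simp
  have e: "q / (q + 1) = 1 / (a + 1)" using a unfolding qa by (simp add: field_simps)
  define \<omega> where "\<omega> = ang_mass TYPE('a)"
  define b where "b = Beta (a + 1) (a + 1)"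
  define A where "A = sphere_area DIM('a)"
  have pos: "Gamma (a + 1) > 0" "Gamma (a + 3 / 2) > 0" "Gamma (2 * a + 2) > 0" using a by auto
  have w: "\<omega> = 2 * pi powr (a + 1) / Gamma (a + 1)"
  proof -
    have "Gamma (a + 1 + 1) = (a + 1) * Gamma (a + 1)" using a by (intro Gamma_plus1) (auto elim: nonpos_Ints_cases)
    then have "\<omega> = (2 * a + 2) * (pi powr (a + 1) / ((a + 1) * Gamma (a + 1)))"
      unfolding \<omega>_def ang_mass_def unit_ball_vol_def n_def[symmetric] a(2) by (simp add: add_divide_distrib)
    also have "\<dots> = 2 * pi powr (a + 1) / Gamma (a + 1)"
    proof -
      have "2 * w * (P / (w * G)) = 2 * P / G" if "w \<noteq> 0" for w P G :: real using that by simp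
      from this[of "a + 1" "pi powr (a + 1)" "Gamma (a + 1)"] show ?thesis using a by (simp add: distrib_left)
    qed
    finally show ?thesis .
  qed
  have Aeq: "A = 2 * pi powr (a + 3 / 2) / Gamma (a + 3 / 2)"
    unfolding A_def sphere_area_def n_def[symmetric] a(2) by (simp add: add_divide_distrib add.commute)
  have d: "Gamma (a + 1) * Gamma (a + 3 / 2) = 2 powr (- 1 - 2 * a) * sqrt pi * Gamma (2 * a + 2)"
    using Gamma_legendre_duplication_real[of "a + 1"] a by (simp add: algebra_simps)
  have b: "b = Gamma (a + 1) * Gamma (a + 1) / Gamma (2 * a + 2)"
    by (simp add: b_def Beta_def)
  \<comment> \<open>Here the area of the sphere in the given space is exchanged for that of the
    sphere of one dimension more, on which \<open>Sobolev_const\<close> is built.\<close>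
  have wb: "\<omega> * b = 2 powr (- 1 - 2 * a) * A"
  proof -
    have "pi powr (a + 3 / 2) = pi powr (a + 1) * sqrt pi"
      using powr_add[of pi "a + 1" "1 / 2"] by (simp add: powr_half_sqrt add.assoc)
    then have "2 powr (- 1 - 2 * a) * A = 2 * pi powr (a + 1) * (2 powr (- 1 - 2 * a) * sqrt pi * Gamma (2 * a + 2)) / (Gamma (a + 3 / 2) * Gamma (2 * a + 2))"
      unfolding Aeq using pos by (simp add: field_simps)
    also have "\<dots> = 2 * pi powr (a + 1) * Gamma (a + 1) / Gamma (2 * a + 2)"
      unfolding d[symmetric] using pos by (simp add: field_simps)
    also have "\<dots> = \<omega> * b" unfolding w b using pos by (simp add: field_simps)
    finally show ?thesis ..
  qed
  have "bliss_const q * \<omega> powr (q / (q + 1)) = (a + 1) / a * ((a * b) powr (1 / (a + 1)) * \<omega> powr (1 / (a + 1)))"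
    unfolding e unfolding qa bliss_const_Beta[OF a(1)] b_def by simp
  also have "(a * b) powr (1 / (a + 1)) * \<omega> powr (1 / (a + 1)) = (a * 2 powr (- 1 - 2 * a) * A) powr (1 / (a + 1))"
  proof -
    have "a * b * \<omega> = a * (\<omega> * b)" by simp
    also have "\<dots> = a * 2 powr (- 1 - 2 * a) * A" unfolding wb by simp
    finally show ?thesis by (simp only: powr_mult[symmetric])
  qed
  also have "\<dots> = (a * 2 powr (- 1 - 2 * a)) powr (1 / (a + 1)) * A powr (1 / (a + 1))" by (rule powr_mult)
  also have "a * 2 powr (- 1 - 2 * a) = (2 * a) * 2 powr (- 2 * (a + 1))"
    by (simp add: powr_diff powr_minus_divide field_simps powr_add)
  also have "((2 * a) * 2 powr (- 2 * (a + 1))) powr (1 / (a + 1)) = (2 * a) powr (1 / (a + 1)) / 4"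
  proof -
    have "- 2 * w * (1 / w) = - 2" if "w \<noteq> 0" for w :: real using that by simp
    from this[of "a + 1"] have "(2 powr (- 2 * (a + 1))) powr (1 / (a + 1)) = 2 powr - (2::real)"
      using a by (simp only: powr_powr)
    also have "\<dots> = 1 / 4" by (simp add: powr_neg_numeral)
    finally show ?thesis by (simp only: powr_mult)
  qed
  \<comment> \<open>Since \<open>2 * a\<close> is the dimension minus 2, the last factor is the
    power that occurs in \<open>C_HS\<close>; the square goes into
    \<open>Sobolev_const\<close>.\<close>
  also have "(2 * a) powr (1 / (a + 1)) = (2 * a)\<^sup>2 * (2 * a) powr (- ((2 * a + 1) / (a + 1)))"
  proof -
    have "1 / (a + 1) = 2 + (- ((2 * a + 1) / (a + 1)))" using a by (simp add: field_simps)
    then have "(2 * a) powr (1 / (a + 1)) = (2 * a) powr 2 * (2 * a) powr (- ((2 * a + 1) / (a + 1)))"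
      by (simp only: powr_add)
    then show ?thesis using a by simp
  qed
  finally have "bliss_const q * \<omega> powr (q / (q + 1)) =
     (a + 1) / a * ((2 * a)\<^sup>2 * (2 * a) powr (- ((2 * a + 1) / (a + 1))) / 4 * A powr (1 / (a + 1)))" .
  moreover have "(a + 1) / a * ((2 * a)\<^sup>2 * X / 4 * Y) = (a + 1) * a * X * Y" for X Y
    using a by (simp add: power2_eq_square)
  ultimately have "bliss_const q * \<omega> powr (q / (q + 1)) =
     (a + 1) * a * (2 * a) powr (- ((2 * a + 1) / (a + 1))) * A powr (1 / (a + 1))"
    by (simp only:)
  moreover have "C_HS DIM('a) = (a + 1) * a * A powr (1 / (a + 1)) * (2 * a) powr (- ((2 * a + 1) / (a + 1)))"
  proof -
    have "2 / n = 1 / (a + 1)" "2 * (n - 1) / n = (2 * a + 1) / (a + 1)" "n * (n - 2) / 4 = (a + 1) * a" "n - 2 = 2 * a"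
      unfolding a(2) using a(1) by (auto simp: field_simps)
    then show ?thesis unfolding C_HS_def Sobolev_const_def n_def[symmetric] A_def[symmetric] by simp
  qed
  ultimately show ?thesis unfolding \<omega>_def by simp
qed

section \<open>The extremal functions\<close>

definition cutoff :: "real \<Rightarrow> nat \<Rightarrow> real \<Rightarrow> real" where
  "cutoff m n y = bump (real n * y - 1) * bump (real n * (m - y) - 1)"

text \<open>It vanishes below \<open>1 / n\<close> and is constant above \<open>m - 1 / n\<close>.
  Composition with an extremal, which tends to 0 at the boundary and to \<open>m\<close> at the
  origin, gives compact support and removes the blow-up of the gradient at the origin. The base
  point -1 makes all of \<open>[0, m]\<close> interior.\<close>

definition trunc :: "real \<Rightarrow> nat \<Rightarrow> real \<Rightarrow> real" where
  "trunc m n y = integral {-1..y} (cutoff m n)"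

lemma cutoff_range: "0 \<le> cutoff m n y" "cutoff m n y \<le> 1"
  unfolding cutoff_def by (auto intro!: mult_nonneg_nonneg mult_le_one bump_nonneg bump_le_1)

lemma Ck_on_cutoff: "Ck_on k UNIV (cutoff m n)"
  unfolding cutoff_def[abs_def]
proof (intro Ck_on_mult open_UNIV)
  have id: "Ck_on k UNIV (\<lambda>y::real. y)" using Ck_on_inner[of UNIV k "1::real"] by simp
  show "Ck_on k UNIV (\<lambda>y. bump (real n * y - 1))" "Ck_on k UNIV (\<lambda>y. bump (real n * (m - y) - 1))"
    by (rule Ck_on_compose[OF open_UNIV open_UNIV UNIV_I Ck_on_bump_fam];
        intro Ck_on_mult Ck_on_diff Ck_on_const open_UNIV id)+
qed

lemma cutoff_cont: "continuous_on S (cutoff m n)"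
  using Ck_on_cutoff[of 0 m n] continuous_on_subset by auto

lemma cutoff_zero: "real n * y \<le> 1 \<or> real n * (m - y) \<le> 1 \<Longrightarrow> cutoff m n y = 0"
  by (auto simp: cutoff_def bump_eq)

lemma cutoff_tendsto: "0 < y \<Longrightarrow> y < m \<Longrightarrow> (\<lambda>n. cutoff m n y) \<longlonglongrightarrow> 1"
proof -
  assume y: "0 < y" "y < m"
  have lim: "filterlim (\<lambda>n. real n * c - 1) at_top sequentially" if "c > 0" for c
  proof -
    have "filterlim (\<lambda>n. -1 + real n * c) at_top sequentially"
      using that by (intro filterlim_tendsto_add_at_top[OF tendsto_const] filterlim_at_top_mult_tendsto_pos[OF tendsto_const] filterlim_real_sequentially)
    then show ?thesis by simp
  qed
  have "(\<lambda>n. cutoff m n y) \<longlonglongrightarrow> 1 * 1"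
    unfolding cutoff_def using y by (intro tendsto_mult bump_tendsto_1 lim) auto
  then show ?thesis by simp
qed

lemma trunc_deriv: "y > -1 \<Longrightarrow> (trunc m n has_real_derivative cutoff m n y) (at y)"
proof -
  assume y: "y > -1"
  have "((\<lambda>y. integral {-1..y} (cutoff m n)) has_real_derivative cutoff m n y) (at y within {-1..y+1})"
    by (rule integral_has_real_derivative[OF cutoff_cont]) (use y in auto)
  moreover have "at y within {-1..y+1} = at y" by (rule at_within_interior) (use y in auto)
  ultimately show ?thesis unfolding trunc_def[abs_def] by metis
qed

lemma Ck_on_trunc: "Ck_on k {-1<..} (trunc m n)"
proof (cases k)
  case 0
  then show ?thesis
    by (auto intro!: continuous_at_imp_continuous_on DERIV_isCont[OF trunc_deriv])
next
  case (Suc j)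
  show ?thesis unfolding Suc
    by (rule Ck_on_SucI_real[OF open_greaterThan trunc_deriv Ck_on_subset[OF Ck_on_cutoff]]) auto
qed

lemma trunc_zero: "n > 0 \<Longrightarrow> y \<le> 1 / real n \<Longrightarrow> trunc m n y = 0"
proof -
  assume n: "n > 0" "y \<le> 1 / real n"
  have "cutoff m n s = 0" if "s \<in> {-1..y}" for s
  proof (rule cutoff_zero)
    have "real n * s \<le> real n * y" using that by (intro mult_left_mono) auto
    also have "\<dots> \<le> 1" using n by (simp add: field_simps)
    finally show "real n * s \<le> 1 \<or> real n * (m - s) \<le> 1" ..
  qed
  then have "trunc m n y = integral {-1..y} (\<lambda>_. 0)"
    unfolding trunc_def by (rule Henstock_Kurzweil_Integration.integral_cong)
  then show ?thesis by simp
qed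

lemma trunc_const:
  assumes n: "n > 0" and y: "m - 1 / real n \<le> y" "m - 1 / real n \<le> z" "-1 \<le> m - 1 / real n"
  shows "trunc m n y = trunc m n z"
proof -
  have "trunc m n y = trunc m n (m - 1 / real n)" if y: "m - 1 / real n \<le> y" for y
  proof -
    have "integral {-1..m - 1 / real n} (cutoff m n) + integral {m - 1 / real n..y} (cutoff m n) = trunc m n y"
      unfolding trunc_def
      by (rule Henstock_Kurzweil_Integration.integral_combine)
         (use that y assms(4) in \<open>auto intro: integrable_continuous_real cutoff_cont\<close>)
    moreover have "integral {m - 1 / real n..y} (cutoff m n) = integral {m - 1 / real n..y} (\<lambda>_. 0)"
      by (rule Henstock_Kurzweil_Integration.integral_cong, rule cutoff_zero) (use n in \<open>auto simp: field_simps\<close>)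
    ultimately show ?thesis by (simp add: trunc_def)
  qed
  from this[OF y(1)] this[OF y(2)] show ?thesis by simp
qed

text \<open>The cutoffs tend to the indicator of the interval from 0 to \<open>m\<close> and are
  bounded by 1, so dominated convergence applies to their primitives.\<close>

lemma trunc_tendsto:
  assumes "0 \<le> y" "y \<le> m" shows "(\<lambda>n. trunc m n y) \<longlonglongrightarrow> y"
proof -
  let ?g = "\<lambda>s::real. if s \<in> {0<..<m} then 1 else 0 :: real"
  have "(\<lambda>n. integral {-1..y} (cutoff m n)) \<longlonglongrightarrow> integral {-1..y} ?g"
  proof (rule dominated_convergence(2)[where h="\<lambda>_. 1"])
    show "cutoff m n integrable_on {-1..y}" for n by (intro integrable_continuous_real cutoff_cont)
    show "norm (cutoff m n s) \<le> 1" for n s using cutoff_range[of m n s] by simp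
    show "(\<lambda>n. cutoff m n s) \<longlonglongrightarrow> ?g s" for s
    proof (cases "s \<in> {0<..<m}")
      case False
      then have "cutoff m n s = 0" for n
        by (intro cutoff_zero) (auto simp: mult_nonneg_nonpos intro: order_trans[of _ 0])
      then show ?thesis using False by auto
    qed (use cutoff_tendsto[of s m] in auto)
  qed auto
  moreover have "integral {-1..y} ?g = y"
  proof -
    have "((\<lambda>_. 1::real) has_integral y) {0..y}" using assms has_integral_const_real[of "1::real" 0 y] by simp
    then have "((\<lambda>s. if s \<in> {0..y} then 1 else 0 :: real) has_integral y) {-1..y}"
      by (subst has_integral_restrict) auto
    then have "(?g has_integral y) {-1..y}"
      by (rule has_integral_spike[of "{0, m}", rotated 2]) (use assms in auto)
    then show ?thesis by (rule integral_unique)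
  qed
  ultimately show ?thesis by (simp add: trunc_def)
qed

text \<open>The crude upper bound, an interval length counted from -1, is enough as a majorant for
  convergence in L2.\<close>

lemma trunc_bounds: "0 \<le> trunc m n y" "y \<ge> -1 \<Longrightarrow> trunc m n y \<le> y + 1"
proof -
  have i: "cutoff m n integrable_on {-1..y}" by (intro integrable_continuous_real cutoff_cont)
  show "0 \<le> trunc m n y" unfolding trunc_def using cutoff_range by (intro integral_nonneg[OF i]) auto
  assume y: "y \<ge> -1"
  have "trunc m n y \<le> integral {-1..y} (\<lambda>_. 1)"
    unfolding trunc_def using cutoff_range by (intro integral_le[OF i]) auto
  then show "trunc m n y \<le> y + 1" using y by simp
qed

text \<open>The type token \<open>ty\<close> lets an interpretation choose the space, and with it
  the dimension that determines \<open>q\<close>.\<close>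

locale extremal =
  fixes R \<mu> \<nu> q :: real and ty :: "'a::euclidean_space itself"
  assumes R: "R > 0" and N: "DIM('a) \<ge> 3" and q: "q = 2 / (real DIM('a) - 2)"
    and \<mu>: "\<mu> \<noteq> 0" and \<nu>: "\<nu> \<noteq> 0"
begin

abbreviation v :: "'a \<Rightarrow> real" where "v \<equiv> v_ext R \<mu> \<nu>"
abbreviation B :: "'a set" where "B \<equiv> ball 0 R"
definition tm :: "'a \<Rightarrow> real" where "tm x = - ln (norm x / R)"
definition m :: real where "m = (\<mu>\<^sup>2) powr - (1 / q)"
text \<open>The gradient of \<open>v\<close> in the punctured ball by the chain rule;
  \<open>tm\<close> has gradient \<open>- x / |x|^2\<close>.\<close>

definition G :: "'a \<Rightarrow> 'a" where
  "G x = (ext_prof' q \<mu> \<nu> (tm x) * - (1 / (norm x)\<^sup>2)) *\<^sub>R x"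
text \<open>Outside the ball \<open>v\<close> is junk, a negative base raised by \<open>powr\<close>; its value at the origin is the limit \<open>m\<close>.\<close>
definition \<phi> :: "nat \<Rightarrow> 'a \<Rightarrow> real" where
  "\<phi> n x = (if x \<in> B then trunc m n (v x) else 0)"

lemma q0: "q > 0" using hs_exponents(5)[of "real DIM('a)" q] N q by simp

lemma v_eq: "v x = ext_prof q \<mu> \<nu> (tm x)"
proof -
  have "2 / (real DIM('a) - 2) = q" "(real DIM('a) - 2) / 2 = 1 / q" using q N by auto
  then show ?thesis by (simp add: v_ext_def ext_prof_def tm_def Let_def)
qed

lemma m_pos: "m > 0" using \<mu> by (simp add: m_def)

lemma tm_pos: "x \<in> B \<Longrightarrow> x \<noteq> 0 \<Longrightarrow> tm x > 0"
  using R by (simp add: tm_def ln_less_zero)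

lemma norm_tm: "x \<noteq> 0 \<Longrightarrow> norm x = R * exp (- tm x)"
  using R by (simp add: tm_def)

lemma prof_range: "t > 0 \<Longrightarrow> 0 < ext_prof q \<mu> \<nu> t" "t > 0 \<Longrightarrow> ext_prof q \<mu> \<nu> t < m"
proof -
  assume t: "t > 0"
  have p: "\<nu>\<^sup>2 * t powr - q > 0" using t \<nu> by simp
  show "0 < ext_prof q \<mu> \<nu> t" using ext_prof_base_pos[OF \<mu>, of \<nu> t q] by (simp add: ext_prof_def)
  show "ext_prof q \<mu> \<nu> t < m" unfolding ext_prof_def m_def
    using p \<mu> q0 by (intro powr_less_mono2_neg) auto
qed

text \<open>The conventions \<open>ln 0 = 0\<close> and \<open>0 powr - q = 0\<close> happen to give
  the limit. So the truncated function is constant on a full ball, with no exception at its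
  centre.\<close>

lemma v_zero: "v 0 = m"
  by (simp add: v_eq ext_prof_def tm_def m_def)

lemma v_range: "x \<in> B \<Longrightarrow> 0 < v x" "x \<in> B \<Longrightarrow> v x \<le> m" "x \<in> B \<Longrightarrow> x \<noteq> 0 \<Longrightarrow> v x < m"
proof -
  have *: "0 < v x \<and> v x < m" if "x \<in> B" "x \<noteq> 0" for x
    using prof_range[OF tm_pos[OF that]] by (simp add: v_eq)
  show "x \<in> B \<Longrightarrow> 0 < v x" "x \<in> B \<Longrightarrow> v x \<le> m" "x \<in> B \<Longrightarrow> x \<noteq> 0 \<Longrightarrow> v x < m"
    using * v_zero m_pos by (cases "x = 0"; force)+
qed

text \<open>Dropping \<open>\<mu>\<^sup>2\<close> from the base leaves a linear function of
  \<open>t\<close> as an upper bound.\<close>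

lemma prof_small: "e > 0 \<Longrightarrow> \<exists>\<tau>>0. \<forall>t. 0 < t \<and> t \<le> \<tau> \<longrightarrow> ext_prof q \<mu> \<nu> t \<le> e"
proof -
  assume e: "e > 0"
  define c where "c = (\<nu>\<^sup>2) powr - (1 / q)"
  have c: "c > 0" using \<nu> by (simp add: c_def)
  have "ext_prof q \<mu> \<nu> t \<le> c * t" if t: "t > 0" for t
  proof -
    have "ext_prof q \<mu> \<nu> t \<le> (\<nu>\<^sup>2 * t powr - q) powr - (1 / q)"
      unfolding ext_prof_def using q0 \<nu> t by (intro powr_mono2') auto
    also have "\<dots> = c * t" using t q0 by (simp add: c_def powr_mult powr_powr)
    finally show ?thesis .
  qed
  moreover have "c * t \<le> e" if "t \<le> e / c" for t using that c by (simp add: field_simps)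
  ultimately show ?thesis using e c by (intro exI[of _ "e / c"]) (auto intro: order_trans)
qed

lemma prof_large: "e > 0 \<Longrightarrow> \<exists>T>0. \<forall>t\<ge>T. m - e \<le> ext_prof q \<mu> \<nu> t"
proof -
  assume e: "e > 0"
  have "((\<lambda>t. t powr - q) \<longlongrightarrow> 0) at_top" using q0 by (intro tendsto_neg_powr filterlim_ident) auto
  then have "((\<lambda>t. (\<mu>\<^sup>2 + \<nu>\<^sup>2 * t powr - q) powr - (1 / q)) \<longlongrightarrow> (\<mu>\<^sup>2 + \<nu>\<^sup>2 * 0) powr - (1 / q)) at_top"
    using \<mu> by (intro tendsto_intros) auto
  then have "(ext_prof q \<mu> \<nu> \<longlongrightarrow> m) at_top" by (simp add: ext_prof_def[abs_def] m_def)
  then have "\<forall>\<^sub>F t in at_top. m - e < ext_prof q \<mu> \<nu> t" using e by (intro order_tendstoD) auto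
  then obtain T where "\<forall>t\<ge>T. m - e < ext_prof q \<mu> \<nu> t" by (auto simp: eventually_at_top_linorder)
  then show ?thesis by (intro exI[of _ "max T 1"]) (auto intro: less_imp_le)
qed

lemma measurables [measurable]: "tm \<in> borel_measurable borel" "v \<in> borel_measurable borel" "G \<in> borel_measurable borel"
proof -
  show 1: "tm \<in> borel_measurable borel" unfolding tm_def[abs_def] by measurable
  have "v = (\<lambda>x. ext_prof q \<mu> \<nu> (tm x))" using v_eq by blast
  then show "v \<in> borel_measurable borel" using 1 unfolding ext_prof_def[abs_def] by simp
  show "G \<in> borel_measurable borel" unfolding G_def[abs_def] ext_prof'_def using 1 by measurable
qed

lemma open_punctured: "open (B - {0})" by (intro open_Diff) auto

text \<open>The norm is traded for the polynomial \<open>x \<bullet> x\<close>, whose logarithm is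
  \<open>2 * ln (norm x)\<close>.\<close>

lemma Ck_on_tm: "Ck_on k (B - {0}) tm"
proof -
  have s: "Ck_on k (B - {0}) (\<lambda>x. x \<bullet> x)"
    by (subst euclidean_inner) (intro Ck_on_sum Ck_on_mult Ck_on_inner open_punctured)
  have l: "Ck_on k (B - {0}) (\<lambda>x. ln (x \<bullet> x))"
    by (rule Ck_on_compose[OF open_punctured open_greaterThan _ Ck_on_ln s]) auto
  have "Ck_on k (B - {0}) (\<lambda>x. ln R - ln (x \<bullet> x) * (1 / 2))"
    by (intro Ck_on_diff Ck_on_mult Ck_on_const l open_punctured)
  then show ?thesis
  proof (rule Ck_on_cong[OF open_punctured, rotated])
    fix x assume "x \<in> B - {0}"
    then have x: "x \<noteq> 0" by simp
    have "ln (x \<bullet> x) = 2 * ln (norm x)" using x by (simp add: ln_realpow flip: power2_norm_eq_inner)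
    then show "ln R - ln (x \<bullet> x) * (1 / 2) = tm x" using x R by (simp add: tm_def ln_div)
  qed
qed

lemma Ck_on_v: "Ck_on k (B - {0}) v"
proof -
  have "Ck_on k (B - {0}) (\<lambda>x. tm x powr - q)"
    by (rule Ck_on_compose[OF open_punctured open_greaterThan _ Ck_on_powr Ck_on_tm]) (auto intro: tm_pos)
  then have b: "Ck_on k (B - {0}) (\<lambda>x. \<mu>\<^sup>2 + \<nu>\<^sup>2 * tm x powr - q)"
    by (intro Ck_on_add Ck_on_mult Ck_on_const open_punctured)
  have "Ck_on k (B - {0}) (\<lambda>x. (\<mu>\<^sup>2 + \<nu>\<^sup>2 * tm x powr - q) powr - (1 / q))"
    by (rule Ck_on_compose[OF open_punctured open_greaterThan _ Ck_on_powr b]) (use ext_prof_base_pos[OF \<mu>] in auto)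
  then show ?thesis by (rule Ck_on_cong[OF open_punctured, rotated]) (simp add: v_eq ext_prof_def)
qed

lemma v_has_derivative:
  assumes x: "x \<in> B - {0}"
  shows "(v has_derivative (\<lambda>h. G x \<bullet> h)) (at x)"
proof -
  have xn: "x \<noteq> 0" using x by simp
  have tp: "tm x > 0" using x tm_pos by auto
  have "((\<lambda>x. norm x / R) has_derivative (\<lambda>h. (sgn x \<bullet> h) / R)) (at x)"
    using has_derivative_norm[OF xn] R by (auto intro!: derivative_eq_intros simp: inner_commute)
  moreover have "(ln has_derivative (\<lambda>h. h * inverse (norm x / R))) (at (norm x / R))"
  proof -
    have "(ln has_real_derivative inverse (norm x / R)) (at (norm x / R))" using R xn by (intro DERIV_ln) simp
    from this[unfolded has_field_derivative_def] show ?thesis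
      by (rule has_derivative_eq_rhs) (simp add: fun_eq_iff)
  qed
  ultimately have "((\<lambda>x. ln (norm x / R)) has_derivative (\<lambda>h. (sgn x \<bullet> h) / R * inverse (norm x / R))) (at x)"
    by (rule has_derivative_compose)
  from has_derivative_minus[OF this]
  have tmd: "(tm has_derivative (\<lambda>h. - ((sgn x \<bullet> h) / R * inverse (norm x / R)))) (at x)"
    by (simp add: tm_def[abs_def])
  have "(ext_prof q \<mu> \<nu> has_derivative (\<lambda>h. ext_prof' q \<mu> \<nu> (tm x) * h)) (at (tm x))"
    using ext_prof_deriv[OF q0 \<mu> tp] by (simp only: has_field_derivative_def)
  from has_derivative_compose[OF tmd this]
  have "((\<lambda>x. ext_prof q \<mu> \<nu> (tm x)) has_derivative
     (\<lambda>h. ext_prof' q \<mu> \<nu> (tm x) * - ((sgn x \<bullet> h) / R * inverse (norm x / R)))) (at x)" .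
  moreover have "(\<lambda>x. ext_prof q \<mu> \<nu> (tm x)) = v" using v_eq by presburger
  moreover have "ext_prof' q \<mu> \<nu> (tm x) * - ((sgn x \<bullet> h) / R * inverse (norm x / R)) = G x \<bullet> h" for h
    using R xn by (simp add: G_def sgn_div_norm power2_eq_square field_simps)
  ultimately show ?thesis by simp
qed

text \<open>Near the origin \<open>v\<close> is within \<open>1 / n\<close> of \<open>m\<close>,
  where the truncation is constant; near the boundary it is below \<open>1 / n\<close>, where the
  truncation is 0. The two radii are the images of the thresholds in \<open>t\<close>.\<close>

lemma \<phi>_smooth_aux:
  assumes n: "n > 0" "1 / real n < m"
  shows "\<exists>\<delta> \<rho>. 0 < \<delta> \<and> 0 < \<rho> \<and> \<rho> < R \<and> (\<forall>x\<in>ball 0 \<delta>. \<phi> n x = trunc m n m) \<and> \<delta> \<le> R \<and> (\<forall>x. norm x > \<rho> \<longrightarrow> \<phi> n x = 0)"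
proof -
  obtain T where T: "T > 0" "\<And>t. t \<ge> T \<Longrightarrow> m - 1 / real n \<le> ext_prof q \<mu> \<nu> t"
    using prof_large[of "1 / real n"] n by auto
  obtain \<tau> where \<tau>: "\<tau> > 0" "\<And>t. 0 < t \<Longrightarrow> t \<le> \<tau> \<Longrightarrow> ext_prof q \<mu> \<nu> t \<le> 1 / real n"
    using prof_small[of "1 / real n"] n by auto
  define \<delta> where "\<delta> = R * exp (- T)"
  define \<rho> where "\<rho> = R * exp (- \<tau>)"
  have "0 < \<delta>" "\<delta> \<le> R" "0 < \<rho>" "\<rho> < R" using R T \<tau> by (auto simp: \<delta>_def \<rho>_def)
  moreover have "\<phi> n x = trunc m n m" if x: "x \<in> ball 0 \<delta>" for x
  proof -
    have xB: "x \<in> B" using x \<open>\<delta> \<le> R\<close> by auto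
    have "m - 1 / real n \<le> v x"
    proof (cases "x = 0")
      case True then show ?thesis by (simp add: v_zero)
    next
      case False
      have "R * exp (- tm x) < R * exp (- T)" using x norm_tm[OF False] by (simp add: \<delta>_def)
      then have "T \<le> tm x" using R by simp
      then show ?thesis using T(2) by (simp add: v_eq)
    qed
    then have "trunc m n (v x) = trunc m n m" using n by (intro trunc_const) auto
    then show ?thesis using xB by (simp add: \<phi>_def)
  qed
  moreover have "\<phi> n x = 0" if x: "norm x > \<rho>" for x
  proof (cases "x \<in> B")
    case True
    have xn: "x \<noteq> 0" using x \<open>0 < \<rho>\<close> by auto
    have "R * exp (- \<tau>) < R * exp (- tm x)" using x norm_tm[OF xn] by (simp add: \<rho>_def)
    then have "tm x \<le> \<tau>" using R by simp
    then have "v x \<le> 1 / real n" using \<tau>(2)[OF tm_pos[OF True xn]] by (simp add: v_eq)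
    then show ?thesis using n by (simp add: \<phi>_def trunc_zero)
  qed (simp add: \<phi>_def)
  ultimately show ?thesis by blast
qed

text \<open>Smoothness is glued from three overlapping open sets: a small ball and the outside of a
  large one, where the function is constant, and the punctured ball, where \<open>v\<close> itself
  is smooth.\<close>

lemma \<phi>_Cc_infty:
  assumes n: "n > 0" "1 / real n < m"
  shows "\<phi> n \<in> Cc_infty B"
proof -
  obtain \<delta> \<rho> where d: "0 < \<delta>" "0 < \<rho>" "\<rho> < R" "\<And>x. x \<in> ball 0 \<delta> \<Longrightarrow> \<phi> n x = trunc m n m" "\<delta> \<le> R"
    "\<And>x. norm x > \<rho> \<Longrightarrow> \<phi> n x = 0"
    using \<phi>_smooth_aux[OF n] by blast
  have c1: "Ck_on k (ball 0 \<delta>) (\<phi> n)" for k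
    by (rule Ck_on_cong[OF open_ball _ Ck_on_const[OF open_ball]]) (use d(4) in auto)
  have o3: "open {x::'a. norm x > \<rho>}" by (intro open_Collect_less continuous_intros)
  have c3: "Ck_on k {x. norm x > \<rho>} (\<phi> n)" for k
    by (rule Ck_on_cong[OF o3 _ Ck_on_const[OF o3]]) (use d(6) in auto)
  have c2: "Ck_on k (B - {0}) (\<phi> n)" for k
  proof -
    have "Ck_on k (B - {0}) (\<lambda>x. trunc m n (v x))"
      by (rule Ck_on_compose[OF open_punctured open_greaterThan _ Ck_on_trunc Ck_on_v]) (use v_range(1) in force)
    then show ?thesis by (rule Ck_on_cong[OF open_punctured, rotated]) (simp add: \<phi>_def)
  qed
  have "C_diff k (\<phi> n)" for k
    unfolding C_diff_iff_Ck_on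
  proof (rule Ck_on_local)
    fix x :: 'a
    consider "x \<in> ball 0 \<delta>" | "x \<in> B - {0}" | "x \<in> {x. norm x > \<rho>}" using d by force
    then show "\<exists>T. open T \<and> x \<in> T \<and> Ck_on k T (\<phi> n)"
      using c1 c2 c3 o3 open_punctured open_ball by cases blast+
  qed
  moreover have s: "closure {x. \<phi> n x \<noteq> 0} \<subseteq> cball 0 \<rho>"
    by (rule closure_minimal) (use d(6) in \<open>auto simp: not_less[symmetric]\<close>)
  moreover have "compact (closure {x. \<phi> n x \<noteq> 0})"
    using compact_Int_closed[OF compact_cball closed_closure] s by (metis Int_absorb1)
  moreover have "cball (0::'a) \<rho> \<subseteq> B" using d by auto
  ultimately show ?thesis by (auto simp: Cc_infty_def)
qed

lemma grad_\<phi>: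
  assumes x: "x \<in> B - {0}"
  shows "grad (\<phi> n) x = cutoff m n (v x) *\<^sub>R G x"
proof (rule grad_eqI)
  have vx: "v x > -1" using x v_range(1)[of x] by auto
  have "(trunc m n has_derivative (\<lambda>h. cutoff m n (v x) * h)) (at (v x))"
    using trunc_deriv[OF vx] by (simp only: has_field_derivative_def)
  from has_derivative_compose[OF v_has_derivative[OF x] this]
  have "((\<lambda>x. trunc m n (v x)) has_derivative (\<lambda>h. (cutoff m n (v x) *\<^sub>R G x) \<bullet> h)) (at x)" by simp
  then show "(\<phi> n has_derivative (\<lambda>h. (cutoff m n (v x) *\<^sub>R G x) \<bullet> h)) (at x)"
    by (rule has_derivative_transform_within_open[OF _ open_punctured x]) (simp add: \<phi>_def)
qed

lemma wt_G: "x \<in> B \<Longrightarrow> x \<noteq> 0 \<Longrightarrow> wt x * (norm (G x))\<^sup>2 = (ext_prof' q \<mu> \<nu> (tm x))\<^sup>2 * norm x powr - real DIM('a)"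
  by (simp add: wt_eq G_def power_mult_distrib power_divide field_simps)

lemma energy_G: "energy R G = ennreal (ang_mass TYPE('a)) * (\<integral>\<^sup>+t\<in>{0<..}. ennreal ((ext_prof' q \<mu> \<nu> t)\<^sup>2) \<partial>lborel)"
proof -
  define F where "F r = ennreal ((ext_prof' q \<mu> \<nu> (- ln (r / R)))\<^sup>2) * indicator {..<R} r" for r
  have [measurable]: "F \<in> borel_measurable borel" unfolding F_def ext_prof'_def by measurable
  have "energy R G = (\<integral>\<^sup>+y. F (norm y) * ennreal (norm y powr - real DIM('a)) \<partial>(lborel::'a measure))"
    unfolding energy_def
  proof (rule nn_integral_cong_AE)
    have "AE x in (lborel::'a measure). x \<noteq> 0" by (rule AE_lborel_singleton)
    then show "AE x in lborel. ennreal (wt x * (norm (G x))\<^sup>2) * indicator B x = F (norm x) * ennreal (norm x powr - real DIM('a))"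
    proof eventually_elim
      case (elim x)
      show ?case
      proof (cases "x \<in> B")
        case True
        then show ?thesis using wt_G[OF True elim] by (simp add: F_def tm_def ennreal_mult)
      qed (simp add: F_def)
    qed
  qed
  also have "\<dots> = ennreal (ang_mass TYPE('a)) * (\<integral>\<^sup>+t. F (R * exp (- t)) \<partial>lborel)"
    by (rule polar_radial) (use R in auto)
  also have "(\<integral>\<^sup>+t. F (R * exp (- t)) \<partial>lborel) = (\<integral>\<^sup>+t\<in>{0<..}. ennreal ((ext_prof' q \<mu> \<nu> t)\<^sup>2) \<partial>lborel)"
    using R by (intro nn_integral_cong) (auto simp: F_def indicator_def)
  finally show ?thesis .
qed

lemma energy_G_finite: "energy R G < top"
  unfolding energy_G ext_prof_energy[OF q0 \<mu> \<nu>] by (simp add: ennreal_mult_less_top)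

text \<open>The difference of the fields is \<open>cutoff - 1\<close> times \<open>G\<close>, so the
  finite energy of \<open>G\<close> dominates and the cutoff tends to 1 off the origin.\<close>

lemma energy_lim: "(\<lambda>n. energy R (\<lambda>x. grad (\<phi> n) x - G x)) \<longlonglongrightarrow> 0"
proof -
  define w where "w x = ennreal (wt x * (norm (G x))\<^sup>2) * indicator B x" for x
  have [measurable]: "w \<in> borel_measurable borel" unfolding w_def by measurable
  have cm[measurable]: "cutoff m n \<in> borel_measurable borel" for n
    by (rule borel_measurable_continuous_onI[OF cutoff_cont])
  have eq: "energy R (\<lambda>x. grad (\<phi> n) x - G x) = (\<integral>\<^sup>+x. w x * ennreal ((cutoff m n (v x) - 1)\<^sup>2) \<partial>lborel)" for n
    unfolding energy_def
  proof (rule nn_integral_cong_AE)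
    have "AE x in (lborel::'a measure). x \<noteq> 0" by (rule AE_lborel_singleton)
    then show "AE x in lborel. ennreal (wt x * (norm (grad (\<phi> n) x - G x))\<^sup>2) * indicator B x = w x * ennreal ((cutoff m n (v x) - 1)\<^sup>2)"
    proof eventually_elim
      case (elim x)
      show ?case
      proof (cases "x \<in> B")
        case True
        then have "grad (\<phi> n) x - G x = (cutoff m n (v x) - 1) *\<^sub>R G x"
          using grad_\<phi>[of x n] elim by (simp add: scaleR_left_diff_distrib)
        then have "wt x * (norm (grad (\<phi> n) x - G x))\<^sup>2 = (wt x * (norm (G x))\<^sup>2) * (cutoff m n (v x) - 1)\<^sup>2"
          by (simp add: power_mult_distrib)
        then have "ennreal (wt x * (norm (grad (\<phi> n) x - G x))\<^sup>2) = ennreal (wt x * (norm (G x))\<^sup>2) * ennreal ((cutoff m n (v x) - 1)\<^sup>2)"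
          by (simp only: ennreal_mult[OF mult_nonneg_nonneg[OF wt_nonneg zero_le_power2] zero_le_power2])
        then show ?thesis using True by (simp only: w_def indicator_simps mult_1_right)
      qed (simp add: w_def)
    qed
  qed
  have "(\<lambda>n. \<integral>\<^sup>+x. w x * ennreal ((cutoff m n (v x) - 1)\<^sup>2) \<partial>lborel) \<longlonglongrightarrow> (\<integral>\<^sup>+x. 0 \<partial>(lborel::'a measure))"
  proof (rule nn_integral_dominated_convergence[where w=w])
    show "AE x in lborel. w x * ennreal ((cutoff m n (v x) - 1)\<^sup>2) \<le> w x" for n
    proof (rule AE_I2)
      fix x
      have "\<bar>cutoff m n (v x) - 1\<bar> \<le> 1" using cutoff_range[of m n "v x"] by auto
      then have "ennreal ((cutoff m n (v x) - 1)\<^sup>2) \<le> 1"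
        by (simp add: abs_square_le_1)
      then show "w x * ennreal ((cutoff m n (v x) - 1)\<^sup>2) \<le> w x" using mult_left_mono[of _ 1 "w x"] by simp
    qed
    show "(\<integral>\<^sup>+x. w x \<partial>lborel) < \<infinity>" using energy_G_finite by (simp add: energy_def w_def)
    have "AE x in (lborel::'a measure). x \<noteq> 0" by (rule AE_lborel_singleton)
    then show "AE x in lborel. (\<lambda>n. w x * ennreal ((cutoff m n (v x) - 1)\<^sup>2)) \<longlonglongrightarrow> 0"
    proof eventually_elim
      case (elim x)
      show ?case
      proof (cases "x \<in> B")
        case True
        then have "(\<lambda>n. cutoff m n (v x)) \<longlonglongrightarrow> 1" using v_range[of x] elim by (intro cutoff_tendsto)
        then have "(\<lambda>n. (cutoff m n (v x) - 1)\<^sup>2) \<longlonglongrightarrow> (1 - 1)\<^sup>2" by (intro tendsto_intros)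
        then have "(\<lambda>n. ennreal ((cutoff m n (v x) - 1)\<^sup>2)) \<longlonglongrightarrow> ennreal ((1 - 1)\<^sup>2)" by (rule tendsto_ennrealI)
        then have "(\<lambda>n. w x * ennreal ((cutoff m n (v x) - 1)\<^sup>2)) \<longlonglongrightarrow> w x * ennreal ((1 - 1)\<^sup>2)"
          using True by (intro ennreal_tendsto_cmult) (simp_all add: w_def)
        then show ?thesis by simp
      qed (simp add: w_def)
    qed
  qed measurable
  then show ?thesis unfolding eq by simp
qed

lemma L2_lim: "(\<lambda>n. \<integral>\<^sup>+x. ennreal ((\<phi> n x - v x)\<^sup>2) \<partial>lebesgue_on B) \<longlonglongrightarrow> 0"
proof -
  \<comment> \<open>Continuity of \<open>trunc\<close> is available only above -1 and
    \<open>v\<close> is junk outside the ball, so measurability is argued on the ball.\<close>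
  have tmeas: "(\<lambda>x. trunc m n (v x)) \<in> borel_measurable (restrict_space borel B)" for n
  proof -
    have "continuous_on {-1<..} (trunc m n)" using Ck_on_trunc[of 0 m n] by simp
    then have "trunc m n \<in> borel_measurable (restrict_space borel {-1<..})" by (rule borel_measurable_continuous_on_restrict)
    moreover have "v \<in> restrict_space borel B \<rightarrow>\<^sub>M restrict_space borel {-1<..}"
      using v_range(1) by (intro measurable_restrict_space3) (auto intro: less_trans[of "-1" 0])
    ultimately show ?thesis by (rule measurable_compose[rotated])
  qed
  have \<phi>m[measurable]: "\<phi> n \<in> borel_measurable borel" for n
  proof -
    have "(\<lambda>x. indicator B x *\<^sub>R trunc m n (v x)) \<in> borel_measurable borel"
      using tmeas by (subst (asm) borel_measurable_restrict_space_iff) auto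
    moreover have "(\<lambda>x. indicator B x *\<^sub>R trunc m n (v x)) = \<phi> n" by (auto simp: \<phi>_def indicator_def)
    ultimately show ?thesis by simp
  qed
  define c where "c = (m + 1)\<^sup>2"
  have "(\<lambda>n. \<integral>\<^sup>+x\<in>B. ennreal ((\<phi> n x - v x)\<^sup>2) \<partial>lborel) \<longlonglongrightarrow> (\<integral>\<^sup>+x. 0 \<partial>(lborel::'a measure))"
  proof (rule nn_integral_dominated_convergence[where w="\<lambda>x. ennreal c * indicator B x"])
    show "AE x in lborel. ennreal ((\<phi> n x - v x)\<^sup>2) * indicator B x \<le> ennreal c * indicator B x" for n
    proof (rule AE_I2)
      fix x
      show "ennreal ((\<phi> n x - v x)\<^sup>2) * indicator B x \<le> ennreal c * indicator B x"
      proof (cases "x \<in> B")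
        case True
        have "\<bar>\<phi> n x - v x\<bar> \<le> m + 1"
          using trunc_bounds[where m=m and n=n and y="v x"] v_range[OF True] m_pos True by (auto simp: \<phi>_def abs_le_iff)
        then have "(\<phi> n x - v x)\<^sup>2 \<le> c" unfolding c_def by (metis abs_ge_zero power2_abs power_mono)
        then show ?thesis by (auto simp: indicator_def intro: ennreal_leI)
      qed simp
    qed
    show "(\<integral>\<^sup>+x. ennreal c * indicator B x \<partial>lborel) < \<infinity>"
      using emeasure_bounded_finite[OF bounded_ball, of "0::'a" R]
      by (simp add: nn_integral_cmult ennreal_mult_less_top)
    show "AE x in lborel. (\<lambda>n. ennreal ((\<phi> n x - v x)\<^sup>2) * indicator B x) \<longlonglongrightarrow> 0"
    proof (rule AE_I2)
      fix x
      show "(\<lambda>n. ennreal ((\<phi> n x - v x)\<^sup>2) * indicator B x) \<longlonglongrightarrow> 0"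
      proof (cases "x \<in> B")
        case True
        then have "(\<lambda>n. \<phi> n x) \<longlonglongrightarrow> v x"
          using trunc_tendsto[of "v x" m] v_range[OF True] by (simp add: \<phi>_def)
        then have "(\<lambda>n. (\<phi> n x - v x)\<^sup>2) \<longlonglongrightarrow> (v x - v x)\<^sup>2" by (intro tendsto_intros)
        then have "(\<lambda>n. ennreal ((\<phi> n x - v x)\<^sup>2)) \<longlonglongrightarrow> ennreal ((v x - v x)\<^sup>2)" by (rule tendsto_ennrealI)
        then show ?thesis using True by simp
      qed simp
    qed
  qed measurable
  then show ?thesis by (simp add: nn_integral_lebesgue_on)
qed

definition n0 :: nat where "n0 = nat \<lceil>1 / m\<rceil> + 1"

lemma n0: "n \<ge> n0 \<Longrightarrow> n > 0" "n \<ge> n0 \<Longrightarrow> 1 / real n < m"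
proof -
  assume "n \<ge> n0"
  then have "real n > 1 / m" unfolding n0_def using real_nat_ceiling_ge[of "1 / m"] by linarith
  moreover have "0 < 1 / m" using m_pos by simp
  ultimately have "real n > 0" by linarith
  then show "1 / real n < m" using \<open>real n > 1 / m\<close> m_pos by (simp add: pos_divide_less_eq mult.commute)
  show "n > 0" using \<open>real n > 0\<close> by simp
qed

lemma vm: "v \<in> borel_measurable (lebesgue_on B)"
  by (rule borel_measurable_lebesgue_on) measurable

lemma sub_Cc: "\<phi> (n + n0) \<in> Cc_infty B"
  using n0[of "n + n0"] by (intro \<phi>_Cc_infty) auto

lemma in_W0_ball: "v \<in> W0_ball R"
proof -
  have "\<exists>M. \<forall>i\<ge>M. \<forall>j\<ge>M. W_norm wt B (\<lambda>x. \<phi> (i + n0) x - \<phi> (j + n0) x) < e" if e: "e > 0" for e :: real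
  proof -
    \<comment> \<open>Two applications of the bound, each with factor 2, give
      \<open>e\<^sup>2 / 2\<close>, which is strictly below \<open>e\<^sup>2\<close>.\<close>
    define d where "d = ennreal (e\<^sup>2 / 8)"
    have d: "d > 0" using e by (simp add: d_def)
    have "\<forall>\<^sub>F n in sequentially. energy R (\<lambda>x. grad (\<phi> n) x - G x) < d"
      using order_tendstoD(2)[OF energy_lim d] .
    then obtain M where M: "\<And>n. n \<ge> M \<Longrightarrow> energy R (\<lambda>x. grad (\<phi> n) x - G x) < d"
      unfolding eventually_sequentially by blast
    have "W_norm wt B (\<lambda>x. \<phi> (i + n0) x - \<phi> (j + n0) x) < e" if ij: "i \<ge> M" "j \<ge> M" for i j
    proof -
      obtain K where K: "C1_cpt K (\<phi> (i + n0))" by (rule Cc_infty_C1_cpt[OF sub_Cc])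
      obtain L where L: "C1_cpt L (\<phi> (j + n0))" by (rule Cc_infty_C1_cpt[OF sub_Cc])
      have mm[measurable]: "grad (\<phi> (i + n0)) \<in> borel_measurable borel" "grad (\<phi> (j + n0)) \<in> borel_measurable borel"
        using C1_cpt_grad_measurable K L by blast+
      have "ennreal ((W_norm wt B (\<lambda>x. \<phi> (i + n0) x - \<phi> (j + n0) x))\<^sup>2) = energy R (\<lambda>x. grad (\<phi> (i + n0)) x - grad (\<phi> (j + n0)) x)"
        using W_norm_energy[OF R Cc_infty_diff(1)[OF sub_Cc[of i] sub_Cc[of j]]]
        by (simp add: Cc_infty_diff(2)[OF sub_Cc sub_Cc] energy_def)
      also have "\<dots> \<le> ennreal (1 + 1) * energy R (\<lambda>x. grad (\<phi> (i + n0)) x - G x)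
         + ennreal (1 + 1 / 1) * energy R (\<lambda>x. (grad (\<phi> (i + n0)) x - grad (\<phi> (j + n0)) x) - (grad (\<phi> (i + n0)) x - G x))"
        by (rule energy_triangle) auto
      also have "energy R (\<lambda>x. (grad (\<phi> (i + n0)) x - grad (\<phi> (j + n0)) x) - (grad (\<phi> (i + n0)) x - G x))
         = energy R (\<lambda>x. grad (\<phi> (j + n0)) x - G x)"
        unfolding energy_def by (simp add: norm_minus_commute algebra_simps)
      also have "ennreal (1 + 1) * energy R (\<lambda>x. grad (\<phi> (i + n0)) x - G x) + ennreal (1 + 1 / 1) * energy R (\<lambda>x. grad (\<phi> (j + n0)) x - G x)
          \<le> ennreal (1 + 1) * d + ennreal (1 + 1 / 1) * d"
        using M[of "i + n0"] M[of "j + n0"] ij by (intro add_mono mult_left_mono) (auto intro: less_imp_le)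
      also have "\<dots> = ennreal (e\<^sup>2 / 2)"
      proof -
        have "ennreal (1 + 1) * d = ennreal (e\<^sup>2 / 4)" "ennreal (1 + 1 / 1) * d = ennreal (e\<^sup>2 / 4)"
          unfolding d_def by (subst ennreal_mult[symmetric]; simp)+
        moreover have "ennreal (e\<^sup>2 / 4) + ennreal (e\<^sup>2 / 4) = ennreal (e\<^sup>2 / 2)"
          by (subst ennreal_plus[symmetric]) simp_all
        ultimately show ?thesis by (simp only:)
      qed
      finally have "(W_norm wt B (\<lambda>x. \<phi> (i + n0) x - \<phi> (j + n0) x))\<^sup>2 \<le> e\<^sup>2 / 2"
        by (subst (asm) ennreal_le_iff) auto
      also have "\<dots> < e\<^sup>2" using e by simp
      finally show ?thesis using e by (simp add: power2_less_imp_less)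
    qed
    then show ?thesis by blast
  qed
  moreover have "(\<lambda>n. \<integral>\<^sup>+x. ennreal ((\<phi> (n + n0) x - v x)\<^sup>2) \<partial>lebesgue_on B) \<longlonglongrightarrow> 0"
    by (rule LIMSEQ_ignore_initial_segment[OF L2_lim])
  moreover have "(\<lambda>x::'a. norm x powr - (real DIM('a) - 2)) = wt" by (simp add: wt_def[abs_def])
  ultimately show ?thesis
    unfolding W0_ball_def W0_12_def using vm sub_Cc by (auto intro!: exI[of _ "\<lambda>n. \<phi> (n + n0)"])
qed

lemma in_W0_rad: "v \<in> W0_rad R"
proof -
  have "radially_symmetric_on B v" unfolding radially_symmetric_on_def
    by (intro exI[of _ "\<lambda>r. ext_prof q \<mu> \<nu> (- ln (r / R))"]) (simp add: v_eq tm_def)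
  moreover have "\<not> (AE x in lebesgue_on B. v x = 0)"
  proof
    assume "AE x in lebesgue_on B. v x = 0"
    moreover have "AE x in lebesgue_on B. x \<in> B" using AE_space[of "lebesgue_on B"] by simp
    ultimately have "AE x in lebesgue_on B. False"
      by eventually_elim (use v_range(1) in force)
    then have "(\<integral>\<^sup>+x. 1 \<partial>lebesgue_on B) = (\<integral>\<^sup>+x. 0 \<partial>lebesgue_on B)"
      by (intro nn_integral_cong_AE) (auto elim: eventually_mono)
    then have "emeasure lborel B = 0" by (simp add: emeasure_restrict_space)
    moreover have "unit_ball_vol (real DIM('a)) * R ^ DIM('a) > 0" using R by (intro mult_pos_pos) auto
    ultimately show False using R by (simp add: emeasure_ball ennreal_eq_0_iff)
  qed
  ultimately show ?thesis using in_W0_ball by (simp add: W0_rad_def)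
qed

lemma HS_ratio_v: "HS_ratio R v = C_HS DIM('a)"
proof -
  define a where "a = 1 / q"
  define s where "s = (\<mu> * \<nu>)\<^sup>2"
  define b where "b = Beta (a + 1) (a + 1)"
  let ?\<omega> = "ang_mass TYPE('a)"
  have a: "a > 0" "q = 1 / a" using q0 by (auto simp: a_def)
  have s: "s > 0" using \<mu> \<nu> by (simp add: s_def)
  have b: "b > 0" unfolding b_def Beta_def using a by simp
  have w: "?\<omega> > 0" by (rule ang_mass_pos)
  \<comment> \<open>The recursion of Gamma reduces the Beta value of the numerator to that of the
    denominator.\<close>
  have Bt: "a * Beta a (a + 2) = (a + 1) * b"
  proof -
    have g1: "Gamma (a + 1) = a * Gamma a" using a by (intro Gamma_plus1) (auto elim: nonpos_Ints_cases)
    have g2: "Gamma (a + 1 + 1) = (a + 1) * Gamma (a + 1)" using a by (intro Gamma_plus1) (auto elim: nonpos_Ints_cases)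
    have "Beta a (a + 2) = Gamma a * Gamma (a + 1 + 1) / Gamma (a + (a + 2))" by (simp add: Beta_def add.assoc)
    also have "\<dots> = Gamma a * ((a + 1) * Gamma (a + 1)) / Gamma (a + (a + 2))" by (simp only: g2)
    finally have "a * Beta a (a + 2) = (a + 1) * ((a * Gamma a) * Gamma (a + 1) / Gamma (a + (a + 2)))" by simp
    then show ?thesis unfolding g1[symmetric] b_def Beta_def by (simp add: algebra_simps)
  qed
  have wg: "is_weak_gradient B v G"
    by (rule weak_gradient_of_limit[OF R _ sub_Cc vm LIMSEQ_ignore_initial_segment[OF L2_lim] _ LIMSEQ_ignore_initial_segment[OF energy_lim]])
       (use N in auto)
  have "HS_numerator R v = enn2real (energy R G)" by (rule HS_numerator_eq[OF wg]) measurable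
  also have "\<dots> = ?\<omega> * (s powr - a * ((a + 1) * b))"
  proof -
    have e: "a * s powr - a * Beta a (a + 2) = s powr - a * (a * Beta a (a + 2))" by simp
    show ?thesis
      unfolding energy_G ext_prof_energy[OF q0 \<mu> \<nu>] a_def[symmetric] s_def[symmetric] e Bt
      using w a b by (simp add: enn2real_mult)
  qed
  finally have num: "HS_numerator R v = ?\<omega> * (s powr - a * ((a + 1) * b))" .
  have "AE x in lborel. x \<in> B \<longrightarrow> v x = (\<lambda>r. ext_prof q \<mu> \<nu> (- ln (r / R))) (norm x)"
    by (simp add: v_eq tm_def)
  from HS_denominator_eq[OF R N q vm this]
  have "HS_denominator R v = (?\<omega> * enn2real (bliss_int q (ext_prof q \<mu> \<nu>))) powr (1 / (q + 1))"
    using R by simp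
  also have "enn2real (bliss_int q (ext_prof q \<mu> \<nu>)) = a * s powr - (a + 1) * b"
    unfolding ext_prof_bliss_int[OF q0 \<mu> \<nu>] a_def[symmetric] s_def[symmetric] b_def[symmetric]
    using a b by (subst enn2real_ennreal) auto
  finally have "HS_denominator R v = (?\<omega> * (a * s powr - (a + 1) * b)) powr (a / (a + 1))"
    using a by (simp add: field_simps)
  also have "\<dots> = (?\<omega> * (a * b)) powr (a / (a + 1)) * (s powr - (a + 1)) powr (a / (a + 1))"
    unfolding powr_mult[symmetric] by (simp add: mult_ac)
  \<comment> \<open>The same power of \<open>s\<close> as in the numerator, so the quotient does not
    depend on \<open>\<mu>\<close> and \<open>\<nu>\<close>.\<close>
  also have "(s powr - (a + 1)) powr (a / (a + 1)) = s powr - a"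
  proof -
    have "- w * (a / w) = - a" if "w \<noteq> 0" for w using that by simp
    from this[of "a + 1"] show ?thesis using a(1) by (simp only: powr_powr)
  qed
  finally have den: "HS_denominator R v = (?\<omega> * (a * b)) powr (a / (a + 1)) * s powr - a" .
  define X where "X = ?\<omega> * (a * b)"
  have X: "X > 0" using w a b by (simp add: X_def)
  have Xp: "X = X powr (1 / (a + 1)) * X powr (a / (a + 1))"
  proof -
    have "1 / (a + 1) + a / (a + 1) = 1" using a by (simp add: field_simps)
    then show ?thesis using X by (simp add: powr_add[symmetric])
  qed
  have "HS_numerator R v = s powr - a * ((a + 1) / a * X)"
    unfolding num X_def using a by simp
  also have "\<dots> = ((a + 1) / a * X powr (1 / (a + 1))) * (X powr (a / (a + 1)) * s powr - a)"
    by (subst Xp) (simp only: mult_ac)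
  finally have "HS_ratio R v = (a + 1) / a * X powr (1 / (a + 1))"
    unfolding HS_ratio_def den X_def[symmetric] using X s by simp
  also have "\<dots> = bliss_const q * ?\<omega> powr (q / (q + 1))"
  proof -
    have "q / (q + 1) = 1 / (a + 1)" using a(1) unfolding a(2) by (simp add: field_simps)
    then show ?thesis unfolding X_def a(2) bliss_const_Beta[OF a(1)] b_def by (simp add: powr_mult)
  qed
  also have "\<dots> = C_HS DIM('a)" by (rule C_HS_eq[OF N q, symmetric])
  finally show ?thesis .
qed

end

theorem theorem1p1:
  fixes R :: real and N :: nat
  assumes "N = CARD('n::finite)" and "N \<ge> 3" and "R > 0"
  shows "(INF v \<in> (W0_rad R :: (real ^ 'n \<Rightarrow> real) set). HS_ratio R v) = C_HS N \<and>
    (\<forall>\<mu> \<nu> :: real. \<mu> \<noteq> 0 \<longrightarrow> \<nu> \<noteq> 0 \<longrightarrow>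
       (v_ext R \<mu> \<nu> :: real ^ 'n \<Rightarrow> real) \<in> W0_rad R \<and>
       HS_ratio R (v_ext R \<mu> \<nu> :: real ^ 'n \<Rightarrow> real) = C_HS N)"
proof -
  define q where "q = 2 / (real DIM(real ^ 'n) - 2)"
  have N: "DIM(real ^ 'n) = N" "DIM(real ^ 'n) \<ge> 3" using assms by simp_all
  have ext: "(v_ext R \<mu> \<nu> :: real ^ 'n \<Rightarrow> real) \<in> W0_rad R \<and>
       HS_ratio R (v_ext R \<mu> \<nu> :: real ^ 'n \<Rightarrow> real) = C_HS N" if "\<mu> \<noteq> 0" "\<nu> \<noteq> 0" for \<mu> \<nu> :: real
  proof -
    interpret extremal R \<mu> \<nu> q "TYPE(real ^ 'n)"
      by unfold_locales (use assms that N in \<open>auto simp: q_def\<close>)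
    show ?thesis using in_W0_rad HS_ratio_v assms(1) by simp
  qed
  have lower: "C_HS N \<le> HS_ratio R v" if "v \<in> W0_rad R" for v :: "real ^ 'n \<Rightarrow> real"
    using HS_ratio_lower_bound[OF assms(3) N(2) q_def that] C_HS_eq[OF N(2) q_def] N(1) by simp
  \<comment> \<open>An infimum of reals is meaningful only for a nonempty set bounded below. Showing
    that it is a minimum, with any extremal as witness, settles both.\<close>
  have "(INF v \<in> (W0_rad R :: (real ^ 'n \<Rightarrow> real) set). HS_ratio R v) = C_HS N"
  proof (rule cInf_eq_minimum)
    show "C_HS N \<in> HS_ratio R ` (W0_rad R :: (real ^ 'n \<Rightarrow> real) set)"
      using ext[of 1 1] by force
  qed (use lower in auto)
  with ext show ?thesis by blast
qed

end
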